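(* Let $a$ and $b$ be integers with $(a,b)\neq(0,0)$ and $a\equiv 3b\pmod 5$. Then the function $F(\tau)=r(\tau)^a r(2\tau)^b$ is a modular function on $\Gamma_1(10)$. Moreover, if $F(\tau)$ generates $A_0(\Gamma_1(10))$ (i.e. $A_0(\Gamma_1(10))=\mathbb{C}(F(\tau))$), then up to taking reciprocals $F$ is one of exactly two such functions, namely $k(\tau)$ and $l(\tau)$; that is, $F\in\{k,1/k,l,1/l\}$, equivalently $(a,b)\in\{(1,2),(-1,-2),(-2,1),(2,-1)\}$.
   Context: For $\tau$ in the upper half-plane $\mathbb{H}$ put $q=e^{2\pi i\tau}$. The Rogers–Ramanujan continued fraction is $r(\tau)=q^{1/5}\prod_{n\ge1}\frac{(1-q^{5n-1})(1-q^{5n-4})}{(1-q^{5n-2})(1-q^{5n-3})}$. Define $k(\tau)=r(\tau)r(2\tau)^2$ and $l(\tau)=r(2\tau)/r(\tau)^2$. $\Gamma_1(N)=\{\left[\begin{smallmatrix}a&b\\c&d\end{smallmatrix}\right]\in\mathrm{SL}_2(\mathbb{Z}): a\equiv d\equiv1,\ c\equiv0 \pmod N\}$. For a congruence subgroup $\Gamma$, a modular function on $\Gamma$ is a function meromorphic on $\mathbb{H}$, invariant under $\Gamma$ acting by linear fractional transformations, and meromorphic at all cusps; $A_0(\Gamma)$ denotes the field of all modular functions on $\Gamma$. *)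

theory Defs
  imports
    "HOL-Complex_Analysis.Complex_Analysis"
    "HOL-Number_Theory.Cong"
    "HOL-Computational_Algebra.Polynomial"
begin

definition upper_half_plane :: "complex set" where
  "upper_half_plane = {\<tau>. Im \<tau> > 0}"

definition nome :: "complex \<Rightarrow> complex" where
  "nome \<tau> = exp (2 * of_real pi * \<i> * \<tau>)"

(* nome (tau / 5) is the factor q^(1/5); the product over n >= 1 is indexed by Suc n. *)
definition rr_cf :: "complex \<Rightarrow> complex" where
  "rr_cf \<tau> = nome (\<tau> / 5) *
     (\<Prod>n. ((1 - nome \<tau> ^ (5 * Suc n - 1)) * (1 - nome \<tau> ^ (5 * Suc n - 4))) /
           ((1 - nome \<tau> ^ (5 * Suc n - 2)) * (1 - nome \<tau> ^ (5 * Suc n - 3))))"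

definition rr_k :: "complex \<Rightarrow> complex" where
  "rr_k \<tau> = rr_cf \<tau> * rr_cf (2 * \<tau>) ^ 2"

definition rr_l :: "complex \<Rightarrow> complex" where
  "rr_l \<tau> = rr_cf (2 * \<tau>) / rr_cf \<tau> ^ 2"

definition SL2Z :: "(int ^ 2 ^ 2) set" where
  "SL2Z = {A. det A = 1}"

definition Gamma1 :: "nat \<Rightarrow> (int ^ 2 ^ 2) set" where
  "Gamma1 N = {A \<in> SL2Z. [A $ 1 $ 1 = 1] (mod int N) \<and> [A $ 2 $ 2 = 1] (mod int N) \<and>
                         [A $ 2 $ 1 = 0] (mod int N)}"

definition mobius :: "int ^ 2 ^ 2 \<Rightarrow> complex \<Rightarrow> complex" where
  "mobius A \<tau> = (of_int (A $ 1 $ 1) * \<tau> + of_int (A $ 1 $ 2)) /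
                (of_int (A $ 2 $ 1) * \<tau> + of_int (A $ 2 $ 2))"

(* Every cusp has the form A(infinity) with A in SL2(Z).  Near infinity, f(A tau) is required to be
   a function of q^(1/h) = exp (2 pi i tau / h) given by a Laurent series with finite principal part. *)
definition meromorphic_at_cusps :: "(complex \<Rightarrow> complex) \<Rightarrow> bool" where
  "meromorphic_at_cusps f \<longleftrightarrow>
     (\<forall>A\<in>SL2Z. \<exists>h::nat. h > 0 \<and> (\<exists>g. g meromorphic_on {0} \<and>
        (\<exists>y>0. \<forall>\<tau>. Im \<tau> > y \<longrightarrow> f (mobius A \<tau>) = g (nome (\<tau> / of_nat h)))))"

(* Meromorphic functions on the upper half-plane are represented by their normal form there (removable
   singularities removed, value 0 at poles), so that two of them are equal iff they agree
   on the upper half-plane pointwise.  Values outside the upper half-plane are irrelevant. *)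
definition modular_functions :: "(int ^ 2 ^ 2) set \<Rightarrow> (complex \<Rightarrow> complex) set" where
  "modular_functions \<Gamma> =
     {f. f nicely_meromorphic_on upper_half_plane \<and>
         (\<forall>A\<in>\<Gamma>. \<forall>\<tau>\<in>upper_half_plane. f (mobius A \<tau>) = f \<tau>) \<and>
         meromorphic_at_cusps f}"

(* The field C(F): quotients p(F)/q(F) with q(F) not identically zero.  The equation is one between
   meromorphic functions, i.e. it may fail on a discrete set (poles of F, zeros of q(F)). *)
definition rational_functions_in :: "(complex \<Rightarrow> complex) \<Rightarrow> (complex \<Rightarrow> complex) set" where
  "rational_functions_in F =
     {f. f nicely_meromorphic_on upper_half_plane \<and>
         (\<exists>p q :: complex poly. \<forall>\<^sub>\<approx>\<tau>\<in>upper_half_plane.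
            poly q (F \<tau>) \<noteq> 0 \<and> f \<tau> = poly p (F \<tau>) / poly q (F \<tau>))}"

definition eq_on_H :: "(complex \<Rightarrow> complex) \<Rightarrow> (complex \<Rightarrow> complex) \<Rightarrow> bool" where
  "eq_on_H f g \<longleftrightarrow> (\<forall>\<tau>\<in>upper_half_plane. f \<tau> = g \<tau>)"

end

theory Submission
  imports Defs
begin

text \<open>
  The continued fraction \<open>r(\<tau>)\<close> is a quotient of two values of the Jacobi theta function for the
  modulus \<open>5\<tau>\<close>, so its behaviour under \<open>SL\<^sub>2(\<int>)\<close> follows from the uniqueness (up to a constant, which
  cancels) of an odd entire function with prescribed quasi-periods. This gives the transformation
  law on \<open>\<Gamma>\<^sub>0(5)\<close> and the order of \<open>r(\<tau>)\<^sup>a r(2\<tau>)\<^sup>b\<close> at every cusp. In particular \<open>1/k\<close> is holomorphic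
  on the upper half-plane and, up to \<open>\<Gamma>\<^sub>1(10)\<close>, has a single pole, a simple one at \<open>i\<infinity>\<close>. Any modular
  function becomes pole-free away from \<open>i\<infinity>\<close> after multiplication by a polynomial in \<open>1/k\<close>; subtracting
  polynomials in \<open>1/k\<close> then removes the pole at \<open>i\<infinity>\<close>, and the maximum principle shows that the
  remainder is constant. Hence \<open>k\<close> generates the function field, and the same argument gives
  \<open>l = (1 + k) / (1 - k)\<close>. So \<open>r(\<tau>)\<^sup>a r(2\<tau>)\<^sup>b = k\<^sup>m l\<^sup>n\<close> with \<open>5m = a + 2b\<close>, \<open>5n = b - 2a\<close> is a rational
  function of \<open>k\<close> of degree \<open>|m| + |n|\<close>, and it generates iff this degree is \<open>1\<close>.
\<close>

text \<open>The polynomial argument gives l = (\<alpha>/k + \<beta>) / (1/k - x0) with unknown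
  constants. The limits at i infinity give \<alpha> = 1. The matrix (3 2; 10 7) sends k to -1/k and
  l to -1/l, and comparing the relation with its image forces x0 = \<beta> and \<beta>^2 = 1. The
  last sign, which separates l from 1/l, is decided by the sizes of the products on the imaginary
  axis.

  Compactness of the modular curve enters through two finite facts: every SL2(Z)-orbit meets Im
  \<tau> \<ge> 1/2, and for an invariant f the function f(A \<tau>) depends only on A mod 10.
  Working with all residue matrices mod 10 avoids a list of the cusps of the group.

  The degree of F over k is never computed. If F = S(k) generates, then S has a rational left
  inverse; comparing orders at y = 0 and y = -1 bounds both exponents by 1 in absolute value, and
  when neither exponent is 0 an explicit involution preserving S rules out the left inverse.\<close>

no_notation fps_nth (infixl \<open>$\<close> 75)

section \<open>The nome and infinite products\<close>

lemma nome_add: "nome (x + y) = nome x * nome y"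
  by (simp add: nome_def algebra_simps flip: exp_add)

lemma nome_diff: "nome (x - y) = nome x / nome y"
  by (simp add: nome_def algebra_simps flip: exp_diff)

lemma nome_uminus: "nome (- x) = inverse (nome x)"
  by (simp add: nome_def exp_minus)

lemma nome_power: "nome x ^ n = nome (of_nat n * x)"
  by (simp add: nome_def algebra_simps flip: exp_of_nat_mult)

lemma nome_0 [simp]: "nome 0 = 1"
  by (simp add: nome_def)

lemma nome_nonzero [simp]: "nome x \<noteq> 0"
  by (simp add: nome_def)

lemma norm_nome: "norm (nome x) = exp (- (2 * pi * Im x))"
  by (simp add: nome_def norm_exp_eq_Re)

lemma norm_nome_less_1: "Im x > 0 \<Longrightarrow> norm (nome x) < 1"
  by (simp add: norm_nome)

lemma nome_eq_1_iff: "nome x = 1 \<longleftrightarrow> (\<exists>n::int. x = of_int n)"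
proof -
  have "nome x = 1 \<longleftrightarrow> (\<exists>n::int. 2 * pi * Re x = of_int (2 * n) * pi \<and> Im x = 0)"
    by (auto simp: nome_def exp_eq_1)
  also have "\<dots> \<longleftrightarrow> (\<exists>n::int. x = of_int n)"
    by (auto simp: complex_eq_iff conj_commute)
  finally show ?thesis .
qed

lemma nome_of_int [simp]: "nome (of_int n) = 1"
  by (auto simp: nome_eq_1_iff)

lemma nome_1 [simp]: "nome 1 = 1"
  using nome_of_int[of 1] by simp

lemma nome_half [simp]: "nome (1/2) = -1"
  by (simp add: nome_def)

lemma nome_holomorphic [holomorphic_intros]:
  "f holomorphic_on S \<Longrightarrow> (\<lambda>z. nome (f z)) holomorphic_on S"
  unfolding nome_def by (intro holomorphic_intros)

lemma nome_eq_iff: "nome x = nome y \<longleftrightarrow> (\<exists>n::int. x = y + of_int n)"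
proof -
  have "nome x = nome y \<longleftrightarrow> nome (x - y) = 1"
    by (simp add: nome_diff)
  also have "\<dots> \<longleftrightarrow> (\<exists>n::int. x = y + of_int n)"
    by (auto simp: nome_eq_1_iff algebra_simps)
  finally show ?thesis .
qed

text \<open>The infinite q-Pochhammer symbol (w; Q), with factors starting at n = 0.\<close>

definition qpoch :: "complex \<Rightarrow> complex \<Rightarrow> complex" where
  "qpoch w Q = (\<Prod>n. 1 - Q ^ n * w)"

lemma qpoch_has_prod:
  assumes "norm Q < 1"
  shows "(\<lambda>n. 1 - Q ^ n * w) has_prod qpoch w Q"
proof -
  have "summable (\<lambda>n. norm Q ^ n * norm w)"
    using assms by (intro summable_mult2 summable_geometric) auto
  then have "abs_convergent_prod (\<lambda>n. 1 - Q ^ n * w)"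
    by (intro summable_imp_abs_convergent_prod) (simp add: norm_mult norm_power)
  then show ?thesis
    unfolding qpoch_def
    by (intro convergent_prod_has_prod abs_convergent_prod_imp_convergent_prod)
qed

lemma qpoch_tendsto:
  "norm Q < 1 \<Longrightarrow> (\<lambda>n. \<Prod>k<n. 1 - Q ^ k * w) \<longlonglongrightarrow> qpoch w Q"
  by (intro has_prod_imp_tendsto' qpoch_has_prod)

lemma qpoch_rec:
  assumes "norm Q < 1"
  shows "qpoch w Q = (1 - w) * qpoch (Q * w) Q"
proof (rule LIMSEQ_unique)
  show "(\<lambda>n. \<Prod>k<Suc n. 1 - Q ^ k * w) \<longlonglongrightarrow> qpoch w Q"
    using qpoch_tendsto[OF assms] by (rule LIMSEQ_Suc)
  have "(\<lambda>n. (1 - w) * (\<Prod>k<n. 1 - Q ^ k * (Q * w))) \<longlonglongrightarrow> (1 - w) * qpoch (Q * w) Q"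
    by (intro tendsto_intros qpoch_tendsto assms)
  then show "(\<lambda>n. \<Prod>k<Suc n. 1 - Q ^ k * w) \<longlonglongrightarrow> (1 - w) * qpoch (Q * w) Q"
    by (simp only: prod.lessThan_Suc_shift) (simp add: algebra_simps)
qed

lemma qpoch_eq_0_iff:
  assumes "norm Q < 1"
  shows "qpoch w Q = 0 \<longleftrightarrow> (\<exists>n. Q ^ n * w = 1)"
  by (subst has_prod_eq_0_iff[OF qpoch_has_prod[OF assms]]) (auto simp: image_iff)

text \<open>Expanding the product bounds its distance from 1 by that of the product with absolute
  values, hence by an exponential of a geometric series. The explicit bound serves limits in which w
  and Q move together.\<close>

lemma norm_qpoch_minus_1_le:
  assumes "norm Q < 1"
  shows "norm (qpoch w Q - 1) \<le> exp (norm w / (1 - norm Q)) - 1"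
proof (rule LIMSEQ_le_const2)
  show "(\<lambda>n. norm ((\<Prod>k<n. 1 - Q ^ k * w) - 1)) \<longlonglongrightarrow> norm (qpoch w Q - 1)"
    by (intro tendsto_intros qpoch_tendsto assms)
  have "norm ((\<Prod>k<n. 1 - Q ^ k * w) - 1) \<le> exp (norm w / (1 - norm Q)) - 1" for n
  proof -
    have "norm ((\<Prod>k<n. 1 + (- (Q ^ k * w))) - 1) \<le> (\<Prod>k<n. 1 + norm (- (Q ^ k * w))) - 1"
      by (rule norm_prod_minus1_le_prod_minus1)
    also have "(\<Prod>k<n. 1 + norm (- (Q ^ k * w))) \<le> exp (\<Sum>k<n. norm (- (Q ^ k * w)))"
      by (rule prod_le_exp_sum) auto
    also have "(\<Sum>k<n. norm (- (Q ^ k * w))) = (\<Sum>k<n. norm Q ^ k) * norm w"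
      by (simp add: norm_mult norm_power sum_distrib_right)
    also have "(\<Sum>k<n. norm Q ^ k) \<le> (\<Sum>k. norm Q ^ k)"
      using assms by (intro sum_le_suminf summable_geometric) auto
    also have "(\<Sum>k. norm Q ^ k) = 1 / (1 - norm Q)"
      using assms by (intro suminf_geometric) auto
    finally show ?thesis
      by (simp add: mult_right_mono)
  qed
  then show "\<exists>N. \<forall>n\<ge>N. norm ((\<Prod>k<n. 1 - Q ^ k * w) - 1) \<le> exp (norm w / (1 - norm Q)) - 1"
    by blast
qed

text \<open>On a closed ball the norm of g attains a maximum below 1, so one geometric series
  majorises all factors and the partial products converge uniformly.\<close>

lemma qpoch_holomorphic [holomorphic_intros]:
  assumes "open S" "f holomorphic_on S" "g holomorphic_on S" "\<And>z. z \<in> S \<Longrightarrow> norm (g z) < 1"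
  shows "(\<lambda>z. qpoch (f z) (g z)) holomorphic_on S"
proof (rule holomorphic_uniform_sequence[OF \<open>open S\<close>])
  show "(\<lambda>z. \<Prod>k<n. 1 - g z ^ k * f z) holomorphic_on S" for n
    using assms by (intro holomorphic_intros)
  fix x assume "x \<in> S"
  then obtain d where d: "d > 0" "cball x d \<subseteq> S"
    using \<open>open S\<close> open_contains_cball by blast
  have cont: "continuous_on (cball x d) f" "continuous_on (cball x d) g"
    using assms d by (meson holomorphic_on_imp_continuous_on continuous_on_subset)+
  have "continuous_on (cball x d) (\<lambda>z. norm (g z))"
    by (intro continuous_intros cont)
  then obtain z0 where z0: "z0 \<in> cball x d" "\<And>z. z \<in> cball x d \<Longrightarrow> norm (g z) \<le> norm (g z0)"
    using continuous_attains_sup[of "cball x d" "\<lambda>z. norm (g z)"] d by auto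
  have "continuous_on (cball x d) (\<lambda>z. norm (f z))"
    by (intro continuous_intros cont)
  then obtain z1 where z1: "z1 \<in> cball x d" "\<And>z. z \<in> cball x d \<Longrightarrow> norm (f z) \<le> norm (f z1)"
    using continuous_attains_sup[of "cball x d" "\<lambda>z. norm (f z)"] d by auto
  have lt1: "norm (g z0) < 1"
    using assms(4) z0 d by auto
  have "uniformly_convergent_on (cball x d) (\<lambda>N z. \<Sum>n<N. norm ((1 - g z ^ n * f z) - 1))"
  proof (rule Weierstrass_m_test')
    show "norm (norm ((1 - g z ^ n * f z) - 1)) \<le> norm (g z0) ^ n * norm (f z1)"
      if "z \<in> cball x d" for n z
      using that z0 z1 by (auto simp: norm_mult norm_power intro!: mult_mono power_mono)
    show "summable (\<lambda>n. norm (g z0) ^ n * norm (f z1))"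
      using lt1 by (intro summable_mult2 summable_geometric) auto
  qed
  then have "uniformly_convergent_on (cball x d) (\<lambda>N z. \<Prod>n<N. 1 - g z ^ n * f z)"
    by (intro uniformly_convergent_on_prod') (auto intro!: continuous_intros cont)
  then have "uniform_limit (cball x d) (\<lambda>N z. \<Prod>n<N. 1 - g z ^ n * f z)
      (\<lambda>z. lim (\<lambda>N. \<Prod>n<N. 1 - g z ^ n * f z)) sequentially"
    by (simp add: uniformly_convergent_uniform_limit_iff)
  moreover have "lim (\<lambda>N. \<Prod>n<N. 1 - g z ^ n * f z) = qpoch (f z) (g z)" if "z \<in> cball x d" for z
    using that d assms(4) by (intro limI qpoch_tendsto) auto
  ultimately have "uniform_limit (cball x d) (\<lambda>N z. \<Prod>n<N. 1 - g z ^ n * f z)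
      (\<lambda>z. qpoch (f z) (g z)) sequentially"
    by (subst (asm) uniform_limit_cong') auto
  then show "\<exists>d>0. cball x d \<subseteq> S \<and> uniform_limit (cball x d) (\<lambda>N z. \<Prod>n<N. 1 - g z ^ n * f z)
      (\<lambda>z. qpoch (f z) (g z)) sequentially"
    using d by blast
qed

section \<open>The Jacobi theta function\<close>

text \<open>Up to a factor depending on \<open>T\<close> only, this is the theta function \<open>\<theta>\<^sub>1\<close>.\<close>

definition jtheta :: "complex \<Rightarrow> complex \<Rightarrow> complex" where
  "jtheta z T = nome (- z / 2) * qpoch (nome z) (nome T) * qpoch (nome (T - z)) (nome T)"

lemma jtheta_plus_1: "jtheta (z + 1) T = - jtheta z T"
proof -
  have "nome (- (z + 1) / 2) = - nome (- z / 2)"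
    using nome_diff[of "- z / 2" "1/2"] by (simp add: diff_divide_distrib)
  moreover have "nome (z + 1) = nome z" "nome (T - (z + 1)) = nome (T - z)"
    by (simp_all add: nome_add nome_diff)
  ultimately show ?thesis
    by (simp add: jtheta_def)
qed

context
  fixes T :: complex
  assumes T: "Im T > 0"
begin

lemma qpoch_nome_rec: "qpoch (nome z) (nome T) = (1 - nome z) * qpoch (nome (T + z)) (nome T)"
  unfolding nome_add by (rule qpoch_rec[OF norm_nome_less_1[OF T]])

text \<open>The shift removes 1 - \<open>nome z\<close> from the first product and adds 1 -
  \<open>nome (- z)\<close> to the second; the two differ by the factor
  -\<open>nome (- z)\<close>.\<close>

lemma jtheta_plus_T: "jtheta (z + T) T = - nome (- T / 2 - z) * jtheta z T"
proof -
  let ?Q = "nome T"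
  have 1: "nome (- (z + T) / 2) = nome (- z / 2) * nome (- T / 2)"
    by (simp add: diff_divide_distrib flip: nome_add)
  have 2: "qpoch (nome (- z)) ?Q = (1 - nome (- z)) * qpoch (nome (T - z)) ?Q"
    using qpoch_nome_rec[of "- z"] by simp
  have 3: "qpoch (nome z) ?Q = (1 - nome z) * qpoch (nome (z + T)) ?Q"
    using qpoch_nome_rec[of z] by (simp add: add.commute)
  have 4: "1 - nome (- z) = - nome (- z) * (1 - nome z)"
    by (simp add: nome_uminus field_simps)
  have 5: "nome (- T / 2 - z) = nome (- T / 2) * nome (- z)"
    by (simp flip: nome_add)
  have 6: "T - (z + T) = - z"
    by simp
  show ?thesis
    unfolding jtheta_def 6 1 2 3 4 5 by simp
qed

lemma jtheta_minus: "jtheta (- z) T = - jtheta z T"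
proof -
  let ?Q = "nome T"
  have 2: "qpoch (nome (- z)) ?Q = (1 - nome (- z)) * qpoch (nome (T - z)) ?Q"
    using qpoch_nome_rec[of "- z"] by simp
  have 3: "qpoch (nome z) ?Q = (1 - nome z) * qpoch (nome (T + z)) ?Q"
    using qpoch_nome_rec[of z] .
  have 4: "1 - nome (- z) = - nome (- z) * (1 - nome z)"
    by (simp add: nome_uminus field_simps)
  have 5: "nome (z / 2) * nome (- z) = nome (- z / 2)"
    by (simp flip: nome_add)
  show ?thesis
    unfolding jtheta_def 2 3 4 5[symmetric] by simp
qed

text \<open>The sign (-1)^(m+n) is written as \<open>nome\<close> of a half-integer, so that the
  whole multiplier is a single \<open>nome\<close> and later computations are additions of
  exponents.\<close>

lemma jtheta_quasi_periodic:
  fixes m n :: int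
  shows "jtheta (z + of_int m * T + of_int n) T =
           nome ((of_int m + of_int n) / 2 - of_int m ^ 2 * T / 2 - of_int m * z) * jtheta z T"
proof -
  have half: "nome (x + 1/2) = - nome x" "nome (x - 1/2) = - nome x" for x
    by (simp_all add: nome_add nome_diff)
  have 1: "jtheta (z + of_int n) T = nome (of_int n / 2) * jtheta z T" for z
  proof (induction n rule: int_induct[where k = 0])
    case (step1 i)
    show ?case
      using jtheta_plus_1[of "z + of_int i" T] step1 half[of "of_int i / 2"]
      by (simp add: algebra_simps add_divide_distrib)
  next
    case (step2 i)
    show ?case
      using jtheta_plus_1[of "z + of_int (i - 1)" T] step2 half[of "of_int i / 2"]
      by (simp add: algebra_simps diff_divide_distrib)
  qed auto
  have 2: "jtheta (z + of_int m * T) T =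
      nome (of_int m / 2 - of_int m ^ 2 * T / 2 - of_int m * z) * jtheta z T"
  proof (induction m rule: int_induct[where k = 0])
    case (step1 i)
    let ?e = "\<lambda>i::int. of_int i / 2 - of_int i ^ 2 * T / 2 - of_int i * z"
    have "jtheta (z + of_int (i + 1) * T) T
        = - nome (- T / 2 - (z + of_int i * T)) * nome (?e i) * jtheta z T"
      using jtheta_plus_T[of "z + of_int i * T"] step1 by (simp add: algebra_simps)
    also have "- nome (- T / 2 - (z + of_int i * T)) * nome (?e i)
        = nome (- T / 2 - (z + of_int i * T) + ?e i + 1 / 2)"
      by (simp only: half nome_add) simp
    also have "- T / 2 - (z + of_int i * T) + ?e i + 1 / 2 = ?e (i + 1)"
      by (simp add: field_simps power2_eq_square)
    finally show ?case .
  next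
    case (step2 i)
    let ?e = "\<lambda>i::int. of_int i / 2 - of_int i ^ 2 * T / 2 - of_int i * z"
    let ?f = "- T / 2 - (z + of_int (i - 1) * T) + 1 / 2"
    have "jtheta (z + of_int i * T) T = nome ?f * jtheta (z + of_int (i - 1) * T) T"
      using jtheta_plus_T[of "z + of_int (i - 1) * T"] unfolding half by (simp add: algebra_simps)
    then have "jtheta (z + of_int (i - 1) * T) T = nome (- ?f) * nome (?e i) * jtheta z T"
      using step2 by (simp add: nome_uminus field_simps)
    also have "nome (- ?f) * nome (?e i) = nome (- ?f + ?e i)"
      by (simp only: nome_add)
    also have "- ?f + ?e i = ?e (i - 1)"
      by (simp add: field_simps power2_eq_square)
    finally show ?case .
  qed auto
  have "jtheta (z + of_int m * T + of_int n) T
      = nome (of_int n / 2 + (of_int m / 2 - of_int m ^ 2 * T / 2 - of_int m * z)) * jtheta z T"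
    by (simp only: 1 2 nome_add) simp
  also have "of_int n / 2 + (of_int m / 2 - of_int m ^ 2 * T / 2 - of_int m * z)
      = (of_int m + of_int n) / 2 - of_int m ^ 2 * T / 2 - of_int m * z"
    by (simp add: field_simps)
  finally show ?thesis .
qed

lemma jtheta_holomorphic: "f holomorphic_on S \<Longrightarrow> open S \<Longrightarrow> (\<lambda>z. jtheta (f z) T) holomorphic_on S"
  unfolding jtheta_def using norm_nome_less_1[OF T] by (intro holomorphic_intros) auto

text \<open>The first product supplies the lattice points with m \<le> 0, the second those with m
  \<ge> 1.\<close>

lemma jtheta_eq_0_iff: "jtheta z T = 0 \<longleftrightarrow> (\<exists>m n::int. z = of_int m * T + of_int n)"
proof -
  note q = qpoch_eq_0_iff[OF norm_nome_less_1[OF T]]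
  have "jtheta z T = 0 \<longleftrightarrow> (\<exists>k. nome (of_nat k * T + z) = 1) \<or> (\<exists>k. nome (of_nat k * T + (T - z)) = 1)"
    by (simp add: jtheta_def q nome_power nome_add nome_diff)
  also have "\<dots> \<longleftrightarrow> (\<exists>m n::int. z = of_int m * T + of_int n)"
  proof safe
    fix k :: nat assume "nome (of_nat k * T + z) = 1"
    then obtain n where "of_nat k * T + z = of_int n"
      by (auto simp: nome_eq_1_iff)
    then have "z = of_int (- int k) * T + of_int n"
      by (simp add: algebra_simps)
    then show "\<exists>m n::int. z = of_int m * T + of_int n" by blast
  next
    fix k :: nat assume "nome (of_nat k * T + (T - z)) = 1"
    then obtain n where "of_nat k * T + (T - z) = of_int n"
      by (auto simp: nome_eq_1_iff)
    then have "z = of_int (int k + 1) * T + of_int (- n)"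
      by (simp add: algebra_simps)
    then show "\<exists>m n::int. z = of_int m * T + of_int n" by blast
  next
    fix m n :: int
    assume no: "\<nexists>k. nome (of_nat k * T + (T - (of_int m * T + of_int n))) = 1"
    have "m \<le> 0"
    proof (rule ccontr)
      assume "\<not> m \<le> 0"
      then obtain k where k: "m = int k + 1"
        by (metis add.commute not_le zle_iff_zadd zless_imp_add1_zle add_0)
      have "nome (of_nat k * T + (T - (of_int m * T + of_int n))) = nome (of_int (- n))"
        by (rule arg_cong[of _ _ nome]) (simp add: k algebra_simps)
      with no show False by (metis nome_of_int)
    qed
    then obtain k where k: "m = - int k"
      by (metis minus_minus neg_0_le_iff_le nonneg_int_cases)
    have "nome (of_nat k * T + (of_int m * T + of_int n)) = nome (of_int n)"
      by (rule arg_cong[of _ _ nome]) (simp add: k algebra_simps)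
    then show "\<exists>k. nome (of_nat k * T + (of_int m * T + of_int n)) = 1"
      by (metis nome_of_int)
  qed
  finally show ?thesis .
qed

lemma jtheta_0 [simp]: "jtheta 0 T = 0"
  by (subst jtheta_eq_0_iff, rule exI[of _ 0], rule exI[of _ 0]) simp

text \<open>The zero at 0 comes from the single factor 1 - \<open>nome z\<close>; the cofactor is
  nonzero there because |\<open>nome T\<close>| < 1. Simplicity of the zero is what makes the
  quotient in \<open>jtheta_unique\<close> extend.\<close>

lemma jtheta_deriv_0: "\<exists>D. D \<noteq> 0 \<and> ((\<lambda>z. jtheta z T) has_field_derivative D) (at 0)"
proof -
  define G where "G = (\<lambda>z. nome (- z / 2) * qpoch (nome (T + z)) (nome T) * qpoch (nome (T - z)) (nome T))"
  have "G holomorphic_on UNIV"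
    unfolding G_def using norm_nome_less_1[OF T] by (intro holomorphic_intros) auto
  then obtain G' where G': "(G has_field_derivative G') (at 0)"
    by (metis UNIV_I holomorphic_on_open open_UNIV)
  have eq: "(\<lambda>z. jtheta z T) = (\<lambda>z. (1 - nome z) * G z)"
    unfolding jtheta_def G_def by (subst qpoch_nome_rec) (simp add: mult_ac)
  have "qpoch (nome T) (nome T) \<noteq> 0"
  proof
    assume "qpoch (nome T) (nome T) = 0"
    then obtain n where "nome T ^ n * nome T = 1"
      by (auto simp: qpoch_eq_0_iff[OF norm_nome_less_1[OF T]])
    then have "norm (nome T ^ Suc n) = 1" by (simp add: mult.commute)
    moreover have "norm (nome T) ^ Suc n < 1 ^ Suc n"
      using norm_nome_less_1[OF T] by (intro power_strict_mono) auto
    ultimately show False by (simp only: norm_power power_one)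
  qed
  then have "G 0 \<noteq> 0" by (simp add: G_def)
  have "((\<lambda>z. (1 - nome z) * G z) has_field_derivative (- (2 * pi * \<i>) * G 0)) (at 0)"
    unfolding nome_def by (auto intro!: derivative_eq_intros G')
  with \<open>G 0 \<noteq> 0\<close> show ?thesis
    by (intro exI[of _ "- (2 * pi * \<i>) * G 0"]) (simp add: eq)
qed

end

text \<open>The quotient f / theta is doubly periodic. Its singularities at the lattice points are
  removable, since theta has simple zeros there and f vanishes too, so Liouville applies.\<close>

lemma jtheta_unique:
  assumes T: "Im T > 0" and hol: "f holomorphic_on UNIV" and f0: "f 0 = 0"
    and per1: "\<And>z. f (z + 1) = - f z" and perT: "\<And>z. f (z + T) = - nome (- T / 2 - z) * f z"
  obtains C where "\<And>z. f z = C * jtheta z T"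
proof -
  define th where "th = (\<lambda>z. jtheta z T)"
  have th0: "th 0 = 0" by (simp add: th_def T)
  have holth: "th holomorphic_on UNIV"
    unfolding th_def by (intro jtheta_holomorphic T holomorphic_intros) auto
  obtain D where D: "D \<noteq> 0" "(th has_field_derivative D) (at 0)"
    using jtheta_deriv_0[OF T] unfolding th_def by blast
  obtain f' where f': "(f has_field_derivative f') (at 0)"
    using hol by (metis UNIV_I holomorphic_on_open open_UNIV)
  \<comment> \<open>The limit of f / theta at 0, as a quotient of derivatives. Double periodicity of
    h makes the same value correct at every lattice point.\<close>
  define c where "c = f' / D"
  define h where "h = (\<lambda>z. if th z = 0 then c else f z / th z)"
  have lim_f: "((\<lambda>w. f w / w) \<longlongrightarrow> f') (at 0)" and lim_th: "((\<lambda>w. th w / w) \<longlongrightarrow> D) (at 0)"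
    using f' D(2) f0 th0 by (simp_all add: has_field_derivative_iff)
  have ne: "\<forall>\<^sub>F w in at 0. th w \<noteq> 0"
    using tendsto_imp_eventually_ne[OF lim_th D(1)] by eventually_elim auto
  have "((\<lambda>w. (f w / w) / (th w / w)) \<longlongrightarrow> c) (at 0)"
    unfolding c_def using D by (intro tendsto_intros lim_f lim_th) auto
  then have lim: "((\<lambda>w. f w / th w) \<longlongrightarrow> c) (at 0)"
    by (rule Lim_transform_eventually) (auto simp: eventually_at_filter)
  have h1: "h (z + 1) = h z" for z
    using per1[of z] jtheta_plus_1[of z T] by (simp add: h_def th_def)
  have hT: "h (z + T) = h z" for z
    using perT[of z] jtheta_plus_T[OF T, of z] by (simp add: h_def th_def)
  have hn: "h (z + of_int n) = h z" for z n
  proof (induction n rule: int_induct[where k = 0])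
    case (step1 i) then show ?case using h1[of "z + of_int i"] by (simp add: algebra_simps)
  next
    case (step2 i) then show ?case using h1[of "z + of_int (i - 1)"] by (simp add: algebra_simps)
  qed auto
  have hm: "h (z + of_int m * T) = h z" for z m
  proof (induction m rule: int_induct[where k = 0])
    case (step1 i) then show ?case using hT[of "z + of_int i * T"] by (simp add: algebra_simps)
  next
    case (step2 i) then show ?case using hT[of "z + of_int (i - 1) * T"] by (simp add: algebra_simps)
  qed auto
  have per: "h (z + (of_int m * T + of_int n)) = h z" for z m n
    using hn[of "z + of_int m * T" n] hm[of z m] by (simp add: add.assoc)
  obtain e where e: "e > 0" "\<And>w. w \<in> ball 0 e \<Longrightarrow> w \<noteq> 0 \<Longrightarrow> th w \<noteq> 0"
    using ne unfolding eventually_at by (auto simp: dist_commute)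
  have "(\<lambda>w. if w = 0 then c else f w / th w) holomorphic_on ball 0 e"
    using e by (intro removable_singularity lim holomorphic_intros holomorphic_on_subset[OF hol]
        holomorphic_on_subset[OF holth]) auto
  also have "?this \<longleftrightarrow> h holomorphic_on ball 0 e"
    using e th0 by (intro holomorphic_cong) (auto simp: h_def)
  finally have h_at_0: "h field_differentiable at 0"
    using e(1) by (intro holomorphic_on_imp_differentiable_at) auto
  have holh: "h holomorphic_on UNIV"
    unfolding holomorphic_on_def
  proof
    fix p :: complex
    have "h field_differentiable at p"
    proof (cases "th p = 0")
      case True
      then obtain m n where p: "p = of_int m * T + of_int n"
        unfolding th_def by (auto simp: jtheta_eq_0_iff[OF T])
      have "(h \<circ> (\<lambda>z. z - p)) field_differentiable at p"
        using h_at_0 by (intro field_differentiable_compose field_differentiable_diff) auto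
      also have "h \<circ> (\<lambda>z. z - p) = h"
        using per[of "z - p" m n for z] by (auto simp: p)
      finally show ?thesis .
    next
      case False
      have op: "open {z. th z \<noteq> 0}"
        using holomorphic_on_imp_continuous_on[OF holth] by (intro open_Collect_neq) auto
      have "(\<lambda>z. f z / th z) holomorphic_on {z. th z \<noteq> 0}"
        by (intro holomorphic_intros holomorphic_on_subset[OF hol] holomorphic_on_subset[OF holth]) auto
      also have "?this \<longleftrightarrow> h holomorphic_on {z. th z \<noteq> 0}"
        by (intro holomorphic_cong) (auto simp: h_def)
      finally show ?thesis
        using op False by (auto intro: holomorphic_on_imp_differentiable_at)
    qed
    then show "h field_differentiable at p within UNIV" by simp
  qed
  \<comment> \<open>The closed period parallelogram, on which h already takes all its
    values.\<close>
  define K where "K = (\<lambda>(s, t). complex_of_real s * T + complex_of_real t) ` ({0..1} \<times> {0..1})"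
  have "compact K"
    unfolding K_def case_prod_beta
    by (intro compact_continuous_image continuous_intros compact_Times) auto
  have "range h \<subseteq> h ` K"
  proof safe
    fix z
    define s where "s = Im z / Im T"
    define t where "t = Re z - s * Re T"
    have z: "z = of_real s * T + of_real t"
      using T by (simp add: complex_eq_iff s_def t_def)
    have "z = (of_real (frac s) * T + of_real (frac t)) + (of_int \<lfloor>s\<rfloor> * T + of_int \<lfloor>t\<rfloor>)"
      unfolding z by (simp add: frac_def algebra_simps)
    then have "h z = h (of_real (frac s) * T + of_real (frac t))"
      using per by metis
    moreover have "of_real (frac s) * T + of_real (frac t) \<in> K"
      unfolding K_def by (intro image_eqI[of _ _ "(frac s, frac t)"]) (auto simp: frac_lt_1 less_imp_le)
    ultimately show "h z \<in> h ` K" by blast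
  qed
  moreover have "bounded (h ` K)"
    using \<open>compact K\<close> holomorphic_on_imp_continuous_on[OF holh]
    by (intro compact_imp_bounded compact_continuous_image) (auto intro: continuous_on_subset)
  ultimately have "bounded (range h)"
    using bounded_subset by blast
  then obtain C where C: "\<And>z. h z = C"
    using Liouville_theorem[OF holh] unfolding constant_on_def by auto
  have "f z = C * jtheta z T" for z
  proof (cases "th z = 0")
    case False
    then show ?thesis using C[of z] by (auto simp: h_def th_def)
  next
    case True
    then obtain m n where z: "z = of_int m * T + of_int n"
      unfolding th_def by (auto simp: jtheta_eq_0_iff[OF T])
    have f1: "f (z + of_int n) = 0 \<longleftrightarrow> f z = 0" for z n
    proof (induction n rule: int_induct[where k = 0])
      case (step1 i) then show ?case using per1[of "z + of_int i"] by (simp add: algebra_simps)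
    next
      case (step2 i) then show ?case using per1[of "z + of_int (i - 1)"] by (simp add: algebra_simps)
    qed auto
    have f2: "f (z + of_int m * T) = 0 \<longleftrightarrow> f z = 0" for z m
    proof (induction m rule: int_induct[where k = 0])
      case (step1 i) then show ?case using perT[of "z + of_int i * T"] by (simp add: algebra_simps)
    next
      case (step2 i) then show ?case using perT[of "z + of_int (i - 1) * T"] by (simp add: algebra_simps)
    qed auto
    have "f z = 0"
      using f1[of "of_int m * T" n] f2[of 0 m] f0 by (simp add: z)
    then show ?thesis using True by (simp add: th_def)
  qed
  then show thesis by (rule that)
qed

section \<open>Theta and Klein forms under SL2(Z)\<close>

lemma Im_moebius:
  fixes a b c d :: int
  assumes "a * d - b * c = 1"
  shows "Im ((of_int a * T + of_int b) / (of_int c * T + of_int d))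
       = Im T / norm (of_int c * T + of_int d) ^ 2"
proof -
  have "real_of_int (a * d - b * c) = 1"
    unfolding assms by simp
  then have 1: "real_of_int a * real_of_int d = 1 + real_of_int b * real_of_int c"
    by (simp add: algebra_simps)
  have "(Im T * a) * (d + c * Re T) - (b + a * Re T) * (c * Im T)
      = Im T * (a * d) - b * c * Im T" by (simp add: algebra_simps)
  also have "\<dots> = Im T" by (simp add: 1 algebra_simps)
  finally show ?thesis
    by (simp add: Im_divide cmod_power2 algebra_simps)
qed

lemma moebius_denom_nonzero:
  fixes a b c d :: int
  assumes "a * d - b * c = 1" "Im T > 0"
  shows "of_int c * T + of_int d \<noteq> (0::complex)"
proof
  assume 0: "of_int c * T + of_int d = (0::complex)"
  then have "real_of_int c * Im T = 0" "real_of_int c * Re T + d = 0"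
    by (simp_all add: complex_eq_iff)
  with assms(2) have "c = 0" "d = 0" by auto
  with assms(1) show False by simp
qed

lemma Im_moebius_pos:
  fixes a b c d :: int
  assumes "a * d - b * c = 1" "Im T > 0"
  shows "Im ((of_int a * T + of_int b) / (of_int c * T + of_int d)) > 0"
  using assms moebius_denom_nonzero[OF assms] by (simp add: Im_moebius)

lemma nome_half_odd:
  assumes "odd (n::int)"
  shows "nome (of_int n / 2) = - 1"
proof -
  obtain k where "n = 2 * k + 1" using assms by (rule oddE)
  then have "of_int n / 2 = of_int k + (1/2 :: complex)" by (simp add: field_simps)
  then show ?thesis by (simp only: nome_add) simp
qed

text \<open>Since 1/j = -c T' + a and T/j = d T' - b lie in the lattice of T', pulling theta back
  along z / j gives a function quasi-periodic for 1 and T. The Gaussian factor adjusts its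
  multipliers to those of \<open>jtheta z T\<close>, and uniqueness finishes.\<close>

lemma jtheta_modular:
  fixes a b c d :: int
  assumes det: "a * d - b * c = 1" and T: "Im T > 0"
  defines "j \<equiv> of_int c * T + of_int d" and "T' \<equiv> (of_int a * T + of_int b) / (of_int c * T + of_int d)"
  obtains C where "C \<noteq> 0" "\<And>z. jtheta (z / j) T' = C * nome (of_int c * z\<^sup>2 / (2 * j)) * jtheta z T"
proof -
  have j: "j \<noteq> 0" unfolding j_def by (rule moebius_denom_nonzero[OF det T])
  have T': "Im T' > 0" unfolding T'_def by (rule Im_moebius_pos[OF det T])
  have jT': "j * T' = of_int a * T + of_int b"
    using j by (simp add: T'_def j_def)
  have detc: "of_int a * of_int d - of_int b * of_int c = (1::complex)"
    using det by (metis of_int_1 of_int_diff of_int_mult)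
  have inv_j: "1 / j = of_int (- c) * T' + of_int a"
  proof -
    have "j * (of_int (- c) * T' + of_int a) = - of_int c * (j * T') + of_int a * j"
      by (simp add: algebra_simps)
    also have "\<dots> = of_int a * of_int d - of_int b * of_int c"
      by (simp only: jT') (simp add: j_def algebra_simps)
    finally show ?thesis using j detc by (simp add: field_simps)
  qed
  have T_j: "T / j = of_int d * T' + of_int (- b)"
  proof -
    have "j * (of_int d * T' + of_int (- b)) = of_int d * (j * T') - of_int b * j"
      by (simp add: algebra_simps)
    also have "\<dots> = (of_int a * of_int d - of_int b * of_int c) * T"
      by (simp only: jT') (simp add: j_def algebra_simps)
    finally show ?thesis using j detc by (simp add: field_simps)
  qed
  define N where "N = (\<lambda>z. nome (- (of_int c * z\<^sup>2 / (2 * j))) * jtheta (z / j) T')"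
  \<comment> \<open>The multiplier of N under z + 1 is \<open>nome\<close> of half this integer, and
    must be -1. The determinant prevents a and c from both being even.\<close>
  have par1: "odd (a - c - c * a)"
  proof -
    have "odd a \<or> odd c" using det by (metis dvd_diff dvd_mult dvd_mult2 odd_one)
    then show ?thesis by auto
  qed
  have par2: "odd (d - b - b * d)"
  proof -
    have "odd b \<or> odd d" using det by (metis dvd_diff dvd_mult dvd_mult2 odd_one)
    then show ?thesis by auto
  qed
  have per1: "N (z + 1) = - N z" for z
  proof -
    let ?e = "(of_int (- c) + of_int a) / 2 - of_int (- c) ^ 2 * T' / 2 - of_int (- c) * (z / j)"
    have "jtheta ((z + 1) / j) T' = nome ?e * jtheta (z / j) T'"
      using jtheta_quasi_periodic[OF T', of "z / j" "- c" a]
      by (simp only: add_divide_distrib inv_j add.assoc)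
    then have "N (z + 1) = nome (- (of_int c * (z + 1)\<^sup>2 / (2 * j)) + ?e) * jtheta (z / j) T'"
      by (simp only: N_def nome_add mult.assoc)
    also have "- (of_int c * (z + 1)\<^sup>2 / (2 * j)) + ?e
        = - (of_int c * z\<^sup>2 / (2 * j)) + (of_int a - of_int c) / 2 - of_int c * (of_int c * T' + 1 / j) / 2"
      using j by (simp add: field_simps power2_eq_square)
    also have "of_int c * T' + 1 / j = of_int a"
      using inv_j by simp
    also have "- (of_int c * z\<^sup>2 / (2 * j)) + (of_int a - of_int c) / 2 - of_int c * of_int a / 2
        = of_int (a - c - c * a) / 2 + - (of_int c * z\<^sup>2 / (2 * j))"
      by (simp add: diff_divide_distrib)
    finally show ?thesis
      using nome_half_odd[OF par1] by (simp only: nome_add) (simp add: N_def)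
  qed
  have perT: "N (z + T) = - nome (- T / 2 - z) * N z" for z
  proof -
    let ?e = "(of_int d + of_int (- b)) / 2 - of_int d ^ 2 * T' / 2 - of_int d * (z / j)"
    have "jtheta ((z + T) / j) T' = nome ?e * jtheta (z / j) T'"
      using jtheta_quasi_periodic[OF T', of "z / j" d "- b"]
      by (simp only: add_divide_distrib T_j add.assoc)
    then have "N (z + T) = nome (- (of_int c * (z + T)\<^sup>2 / (2 * j)) + ?e) * jtheta (z / j) T'"
      by (simp only: N_def nome_add mult.assoc)
    also have "- (of_int c * (z + T)\<^sup>2 / (2 * j)) + ?e
        = - (of_int c * z\<^sup>2 / (2 * j)) + (of_int d - of_int b) / 2
          - (of_int c * T * (T / j) + of_int d * (of_int d * T')) / 2 - z * ((of_int c * T + of_int d) / j)"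
      using j by (simp add: field_simps power2_eq_square)
    also have "(of_int c * T + of_int d) / j = 1"
      using j by (simp add: j_def)
    also have "of_int c * T * (T / j) + of_int d * (of_int d * T') = T + of_int b * of_int d"
    proof -
      have "of_int c * T * (T / j) + of_int d * (of_int d * T') = of_int d * (j * T') - of_int b * of_int c * T"
        unfolding T_j by (simp add: j_def algebra_simps)
      also have "\<dots> = (of_int a * of_int d - of_int b * of_int c) * T + of_int b * of_int d"
        unfolding jT' by (simp add: algebra_simps)
      finally show ?thesis by (simp add: detc)
    qed
    also have "- (of_int c * z\<^sup>2 / (2 * j)) + (of_int d - of_int b) / 2 - (T + of_int b * of_int d) / 2 - z * 1
        = of_int (d - b - b * d) / 2 + (- T / 2 - z) + - (of_int c * z\<^sup>2 / (2 * j))"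
      by (simp add: diff_divide_distrib add_divide_distrib)
    finally show ?thesis
      using nome_half_odd[OF par2] by (simp only: nome_add) (simp add: N_def)
  qed
  have "N holomorphic_on UNIV"
    unfolding N_def using j by (intro holomorphic_intros jtheta_holomorphic T') auto
  then obtain C where C: "\<And>z. N z = C * jtheta z T"
    using jtheta_unique[OF T _ _ per1 perT] T' by (auto simp: N_def)
  have "C \<noteq> 0"
  proof
    assume "C = 0"
    \<comment> \<open>z = j / 2 corresponds to the argument 1/2, which is not in the lattice of T'
      and 1.\<close>
    then have "N (j / 2) = 0" by (simp add: C)
    then have "jtheta (1/2) T' = 0" using j by (simp add: N_def)
    then obtain m n :: int where mn: "1/2 = of_int m * T' + of_int n"
      by (auto simp: jtheta_eq_0_iff[OF T'])
    have "Im (1/2) = real_of_int m * Im T'" by (subst mn) simp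
    then have "m = 0" using T' by simp
    then have "1 = (2 :: complex) * of_int n" using mn by (simp add: field_simps)
    then have "of_int 1 = (of_int (2 * n) :: complex)" by simp
    then have "1 = 2 * n" by (simp only: of_int_eq_iff)
    then show False by presburger
  qed
  moreover have "jtheta (z / j) T' = C * nome (of_int c * z\<^sup>2 / (2 * j)) * jtheta z T" for z
    using C[of z] by (simp add: N_def nome_uminus field_simps)
  ultimately show thesis by (rule that)
qed

text \<open>Up to a factor depending on \<open>T\<close> only, this is the Klein form with characteristic \<open>(u, v)\<close>.\<close>

definition kap :: "complex \<Rightarrow> complex \<Rightarrow> complex \<Rightarrow> complex" where
  "kap u v T = nome (u * (u * T + v) / 2) * jtheta (u * T + v) T"

text \<open>The prefactor of \<open>kap\<close> absorbs the Gaussian factor of theta, by 1 + c (a T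
  + b) = a (c T + d). The remaining C does not depend on u, so it cancels in quotients of two
  values.\<close>

lemma kap_modular:
  fixes a b c d :: int
  assumes det: "a * d - b * c = 1" and T: "Im T > 0"
  obtains C where "C \<noteq> 0" "\<And>u. kap u 0 ((of_int a * T + of_int b) / (of_int c * T + of_int d)) =
    C * kap (u * of_int a) (u * of_int b) T"
proof -
  define j where "j = of_int c * T + of_int d"
  define T' where "T' = (of_int a * T + of_int b) / (of_int c * T + of_int d)"
  have j: "j \<noteq> 0" unfolding j_def by (rule moebius_denom_nonzero[OF det T])
  have jT': "j * T' = of_int a * T + of_int b"
    using j by (simp add: T'_def j_def)
  have detc: "of_int a * of_int d - of_int b * of_int c = (1::complex)"
    using det by (metis of_int_1 of_int_diff of_int_mult)
  obtain C where C: "C \<noteq> 0"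
    "\<And>z. jtheta (z / j) T' = C * nome (of_int c * z\<^sup>2 / (2 * j)) * jtheta z T"
    using jtheta_modular[OF det T] unfolding j_def T'_def by blast
  have "kap u 0 T' = C * kap (u * of_int a) (u * of_int b) T" for u
  proof -
    define z where "z = u * of_int a * T + u * of_int b"
    have z: "z = u * (j * T')" unfolding jT' z_def by (simp add: algebra_simps)
    have aj: "1 + of_int c * (j * T') = of_int a * j"
    proof -
      have "of_int a * j = (of_int a * of_int d - of_int b * of_int c) + of_int c * (of_int a * T + of_int b)"
        by (simp add: j_def algebra_simps)
      then show ?thesis by (simp only: detc jT')
    qed
    have "kap u 0 T' = nome (u * (u * T') / 2) * (C * nome (of_int c * z\<^sup>2 / (2 * j)) * jtheta z T)"
      using C(2)[of z] j by (simp add: kap_def z)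
    also have "\<dots> = C * nome (u * (u * T') / 2 + of_int c * z\<^sup>2 / (2 * j)) * jtheta z T"
      by (simp add: nome_add)
    also have "u * (u * T') / 2 + of_int c * z\<^sup>2 / (2 * j) = u * u * T' * (1 + of_int c * (j * T')) / 2"
      using j by (simp add: z field_simps power2_eq_square)
    also have "\<dots> = u * of_int a * z / 2"
      unfolding aj z by simp
    finally show ?thesis by (simp add: kap_def z_def)
  qed
  with C(1) show thesis using that by (simp add: T'_def)
qed

text \<open>The prefactor also removes T from the multiplier, which is therefore a root of unity for
  rational u and v.\<close>

lemma kap_shift:
  fixes m n :: int
  assumes T: "Im T > 0"
  shows "kap (u + of_int m) (v + of_int n) T =
    nome ((of_int m + of_int n + of_int m * of_int n + u * of_int n - of_int m * v) / 2) * kap u v T"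
proof -
  let ?e = "(of_int m + of_int n) / 2 - of_int m ^ 2 * T / 2 - of_int m * (u * T + v)"
  let ?z = "(u + of_int m) * T + (v + of_int n)"
  have "?z = u * T + v + of_int m * T + of_int n"
    by (simp add: algebra_simps)
  then have "kap (u + of_int m) (v + of_int n) T = nome ((u + of_int m) * ?z / 2 + ?e) * jtheta (u * T + v) T"
    by (simp only: kap_def jtheta_quasi_periodic[OF T] nome_add mult.assoc)
  also have "(u + of_int m) * ?z / 2 + ?e =
      (of_int m + of_int n + of_int m * of_int n + u * of_int n - of_int m * v) / 2 + u * (u * T + v) / 2"
    by (simp add: field_simps power2_eq_square)
  finally show ?thesis by (simp only: nome_add kap_def mult.assoc)
qed

lemma kap_minus: "Im T > 0 \<Longrightarrow> kap (- u) (- v) T = - kap u v T"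
  using jtheta_minus[of T "u * T + v"] by (simp add: kap_def algebra_simps)

section \<open>The Rogers--Ramanujan continued fraction\<close>

text \<open>The continued fraction without q^(1/5), as a function of q on the unit disc; its limit
  at i infinity is then continuity at q = 0.\<close>

definition rr_prod :: "complex \<Rightarrow> complex" where
  "rr_prod q = (qpoch (q ^ 4) (q ^ 5) * qpoch q (q ^ 5)) / (qpoch (q ^ 3) (q ^ 5) * qpoch (q ^ 2) (q ^ 5))"

lemma norm_pow5_less_1: "norm (q::complex) < 1 \<Longrightarrow> norm (q ^ 5) < 1"
  using power_strict_mono[of "norm q" 1 5] by (simp add: norm_power)

lemma rr_prod_has_prod:
  assumes "norm q < 1"
  shows "(\<lambda>n. ((1 - q ^ (5 * Suc n - 1)) * (1 - q ^ (5 * Suc n - 4))) /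
           ((1 - q ^ (5 * Suc n - 2)) * (1 - q ^ (5 * Suc n - 3)))) has_prod rr_prod q"
proof -
  have "(\<lambda>n. ((1 - (q ^ 5) ^ n * q ^ 4) * (1 - (q ^ 5) ^ n * q)) /
      ((1 - (q ^ 5) ^ n * q ^ 3) * (1 - (q ^ 5) ^ n * q ^ 2))) has_prod rr_prod q"
    unfolding rr_prod_def using assms
    by (intro has_prod_divide has_prod_mult qpoch_has_prod norm_pow5_less_1)
  also have "(\<lambda>n. ((1 - (q ^ 5) ^ n * q ^ 4) * (1 - (q ^ 5) ^ n * q)) /
      ((1 - (q ^ 5) ^ n * q ^ 3) * (1 - (q ^ 5) ^ n * q ^ 2))) =
    (\<lambda>n. ((1 - q ^ (5 * Suc n - 1)) * (1 - q ^ (5 * Suc n - 4))) /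
           ((1 - q ^ (5 * Suc n - 2)) * (1 - q ^ (5 * Suc n - 3))))"
  proof
    fix n
    have e: "5 * Suc n - 1 = 5 * n + 4" "5 * Suc n - 4 = 5 * n + 1" "5 * Suc n - 2 = 5 * n + 3"
      "5 * Suc n - 3 = 5 * n + 2" by simp_all
    show "((1 - (q ^ 5) ^ n * q ^ 4) * (1 - (q ^ 5) ^ n * q)) /
        ((1 - (q ^ 5) ^ n * q ^ 3) * (1 - (q ^ 5) ^ n * q ^ 2)) =
      ((1 - q ^ (5 * Suc n - 1)) * (1 - q ^ (5 * Suc n - 4))) /
           ((1 - q ^ (5 * Suc n - 2)) * (1 - q ^ (5 * Suc n - 3)))"
      unfolding e by (simp only: power_add power_mult power_one_right)
  qed
  finally show ?thesis .
qed

lemma rr_cf_eq: "Im \<tau> > 0 \<Longrightarrow> rr_cf \<tau> = nome (\<tau> / 5) * rr_prod (nome \<tau>)"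
  using rr_prod_has_prod[OF norm_nome_less_1] unfolding rr_cf_def by (simp add: has_prod_iff)

lemma qpoch_power_nonzero:
  assumes "norm q < 1" "m > 0"
  shows "qpoch (q ^ m) (q ^ 5) \<noteq> 0"
proof
  assume "qpoch (q ^ m) (q ^ 5) = 0"
  then obtain n where "(q ^ 5) ^ n * q ^ m = 1"
    by (auto simp: qpoch_eq_0_iff[OF norm_pow5_less_1[OF assms(1)]])
  then have "q ^ (5 * n + m) = 1" by (simp add: power_add power_mult)
  then have "norm q ^ (5 * n + m) = 1" by (metis norm_one norm_power)
  moreover have "norm q ^ (5 * n + m) < 1 ^ (5 * n + m)"
    using assms by (intro power_strict_mono) auto
  ultimately show False by simp
qed

lemma rr_prod_nonzero: "norm q < 1 \<Longrightarrow> rr_prod q \<noteq> 0"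
  using qpoch_power_nonzero[of q] qpoch_power_nonzero[of q 1] by (simp add: rr_prod_def)

lemma rr_prod_holomorphic: "rr_prod holomorphic_on ball 0 1"
  unfolding rr_prod_def
  by (intro holomorphic_intros) (auto simp: norm_pow5_less_1 qpoch_power_nonzero)

lemma qpoch_0 [simp]: "qpoch 0 Q = 1"
  by (simp add: qpoch_def)

lemma rr_prod_0 [simp]: "rr_prod 0 = 1"
  by (simp add: rr_prod_def)

lemma rr_cf_nonzero: "Im \<tau> > 0 \<Longrightarrow> rr_cf \<tau> \<noteq> 0"
  by (simp add: rr_cf_eq rr_prod_nonzero norm_nome_less_1)

lemma open_upper_half_plane: "open upper_half_plane"
  unfolding upper_half_plane_def by (simp add: open_halfspace_Im_gt)

lemma connected_upper_half_plane: "connected upper_half_plane"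
  unfolding upper_half_plane_def by (intro convex_connected convex_halfspace_Im_gt)

lemma rr_cf_holomorphic: "rr_cf holomorphic_on upper_half_plane"
proof -
  have "(\<lambda>\<tau>. nome (\<tau> / 5) * (rr_prod \<circ> nome) \<tau>) holomorphic_on upper_half_plane"
    using norm_nome_less_1
    by (intro holomorphic_intros holomorphic_on_compose_gen[OF _ rr_prod_holomorphic])
       (auto simp: upper_half_plane_def intro: nome_holomorphic[of "\<lambda>z. z", simplified])
  also have "?this \<longleftrightarrow> ?thesis"
    by (intro holomorphic_cong) (auto simp: rr_cf_eq upper_half_plane_def)
  finally show ?thesis .
qed

text \<open>For modulus 5 \<tau>, theta at \<tau> and 2 \<tau> has the exponents congruent to 1, 4
  and to 2, 3 mod 5. The prefactors contribute \<tau>/10 - \<tau>/2 and 2\<tau>/5 - \<tau>, whose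
  difference is \<tau>/5.\<close>

lemma rr_cf_eq_kap:
  assumes "Im \<tau> > 0"
  shows "rr_cf \<tau> = kap (1/5) 0 (5 * \<tau>) / kap (2/5) 0 (5 * \<tau>)"
proof -
  have 1: "kap (1/5) 0 (5 * \<tau>) = nome (\<tau> / 10) * (nome (- \<tau> / 2) * qpoch (nome \<tau>) (nome \<tau> ^ 5) * qpoch (nome \<tau> ^ 4) (nome \<tau> ^ 5))"
    by (simp add: kap_def jtheta_def nome_power)
  have 2: "kap (2/5) 0 (5 * \<tau>) = nome (2 * \<tau> / 5) * (nome (- \<tau>) * qpoch (nome \<tau> ^ 2) (nome \<tau> ^ 5) * qpoch (nome \<tau> ^ 3) (nome \<tau> ^ 5))"
    by (simp add: kap_def jtheta_def nome_power)
  have "nome (\<tau> / 10) * nome (- \<tau> / 2) = nome (\<tau> / 5) * (nome (2 * \<tau> / 5) * nome (- \<tau>))"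
    unfolding nome_add[symmetric] by (rule arg_cong[of _ _ nome]) (simp add: field_simps)
  then show ?thesis
    using assms unfolding 1 2
    by (simp add: rr_cf_eq rr_prod_def qpoch_power_nonzero norm_nome_less_1 field_simps)
qed

abbreviation moeb :: "int \<Rightarrow> int \<Rightarrow> int \<Rightarrow> int \<Rightarrow> complex \<Rightarrow> complex" where
  "moeb a b c d \<tau> \<equiv> (of_int a * \<tau> + of_int b) / (of_int c * \<tau> + of_int d)"

text \<open>Multiplication by 5 turns the matrix into (a 5b; c/5 d) acting on 5 \<tau>, so the
  characteristic u goes to (u a, u b) and only a mod 5 matters up to roots of unity. The classes 1
  and -1 fix the pair 1/5, 2/5; the classes 2 and -2 exchange its members and invert r.\<close>

lemma rr_cf_Gamma0_5:
  fixes a b c d m s :: int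
  assumes det: "a * d - b * c = 1" and "5 dvd c" and \<tau>: "Im \<tau> > 0" and a: "a = 5 * m + s"
  defines "\<zeta> \<equiv> nome ((of_int m + of_int b + of_int m * of_int b) / 2 - 3 * of_int s * of_int b / 10)"
  shows "s \<in> {1, -1} \<Longrightarrow> rr_cf (moeb a b c d \<tau>) = \<zeta> * rr_cf \<tau>"
    and "s \<in> {2, -2} \<Longrightarrow> rr_cf (moeb a b c d \<tau>) = \<zeta> / rr_cf \<tau>"
proof -
  obtain c' where c: "c = 5 * c'" using \<open>5 dvd c\<close> by (rule dvdE)
  define T where "T = 5 * \<tau>"
  have T: "Im T > 0" using \<tau> by (simp add: T_def)
  have det': "a * d - (5 * b) * c' = 1" using det c by simp
  obtain C where C: "C \<noteq> 0" "\<And>u. kap u 0 (moeb a (5 * b) c' d T) = C * kap (u * of_int a) (u * of_int (5 * b)) T"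
    using kap_modular[OF det' T] by blast
  have eq: "moeb a (5 * b) c' d T = 5 * moeb a b c d \<tau>"
    by (simp add: T_def c mult_ac algebra_simps)
  define e1 :: complex where "e1 = (of_int m + of_int b + of_int m * of_int b + of_int s / 5 * of_int b) / 2"
  define e2 :: complex where "e2 = 2 * of_int s * of_int b / 5"
  have 1: "kap (of_int a / 5) (of_int b) T = nome e1 * kap (of_int s / 5) 0 T"
    using kap_shift[OF T, of "of_int s / 5" m 0 b] by (simp add: a add_divide_distrib add_ac e1_def)
  have 2: "kap (2 * of_int a / 5) (2 * of_int b) T = nome e2 * kap (2 * of_int s / 5) 0 T"
  proof -
    have "kap (2 * of_int a / 5) (2 * of_int b) T = kap (2 * of_int s / 5 + of_int (2 * m)) (0 + of_int (2 * b)) T"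
      by (simp add: a field_simps)
    also have "\<dots> = nome ((of_int (2 * m) + of_int (2 * b) + of_int (2 * m) * of_int (2 * b)
        + 2 * of_int s / 5 * of_int (2 * b) - of_int (2 * m) * 0) / 2) * kap (2 * of_int s / 5) 0 T"
      by (rule kap_shift[OF T])
    also have "(of_int (2 * m) + of_int (2 * b) + of_int (2 * m) * of_int (2 * b)
        + 2 * of_int s / 5 * of_int (2 * b) - of_int (2 * m) * 0) / 2 = of_int (m + b + 2 * m * b) + e2"
      by (simp add: field_simps e2_def)
    finally show ?thesis by (simp only: nome_add nome_of_int mult_1)
  qed
  have \<zeta>: "\<zeta> = nome e1 / nome e2"
    unfolding \<zeta>_def nome_diff[symmetric] by (rule arg_cong[of _ _ nome]) (simp add: e1_def e2_def field_simps)
  have "rr_cf (moeb a b c d \<tau>) = kap (1/5) 0 (5 * moeb a b c d \<tau>) / kap (2/5) 0 (5 * moeb a b c d \<tau>)"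
    by (rule rr_cf_eq_kap[OF Im_moebius_pos[OF det \<tau>]])
  also have "\<dots> = kap (of_int a / 5) (of_int b) T / kap (2 * of_int a / 5) (2 * of_int b) T"
    unfolding eq[symmetric] C using C(1) by simp
  finally have main: "rr_cf (moeb a b c d \<tau>) = \<zeta> * (kap (of_int s / 5) 0 T / kap (2 * of_int s / 5) 0 T)"
    unfolding 1 2 \<zeta> by simp
  have neg: "kap (- u) 0 T = - kap u 0 T" for u
    using kap_minus[OF T, of u 0] by simp
  \<comment> \<open>Doubling 2/5 gives 4/5, which is -1/5 mod 1; the sign of the shift cancels the
    sign of oddness.\<close>
  have 45: "kap (4/5) 0 T = kap (1/5) 0 T"
    using kap_shift[OF T, of "-1/5" 1 0 0] neg[of "1/5"] by simp
  have r: "rr_cf \<tau> = kap (1/5) 0 T / kap (2/5) 0 T"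
    unfolding T_def by (rule rr_cf_eq_kap[OF \<tau>])
  show "rr_cf (moeb a b c d \<tau>) = \<zeta> * rr_cf \<tau>" if "s \<in> {1, -1}"
    using that main neg[of "1/5"] neg[of "2/5"] r by auto
  show "rr_cf (moeb a b c d \<tau>) = \<zeta> / rr_cf \<tau>" if "s \<in> {2, -2}"
    using that main neg[of "2/5"] neg[of "4/5"] r 45 by auto
qed

section \<open>Orders at the cusps\<close>

definition at_ii :: "complex filter" where
  "at_ii = filtercomap Im at_top"

lemma eventually_at_ii: "eventually P at_ii \<longleftrightarrow> (\<exists>Y. \<forall>\<tau>. Im \<tau> > Y \<longrightarrow> P \<tau>)"
  unfolding at_ii_def by (auto simp: eventually_filtercomap_at_top_dense)

lemma eventually_at_ii_gt: "eventually (\<lambda>\<tau>. Im \<tau> > y) at_ii"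
  by (auto simp: eventually_at_ii)

lemma at_ii_neq_bot [simp]: "at_ii \<noteq> bot"
proof
  assume "at_ii = bot"
  then have "eventually (\<lambda>_. False) at_ii" by simp
  then obtain Y where "\<forall>\<tau>. \<not> Im \<tau> > Y" by (auto simp: eventually_at_ii)
  then show False by (metis complex.sel(2) lt_ex gt_ex)
qed

lemma filterlim_Im_at_ii: "filterlim Im at_top at_ii"
  unfolding at_ii_def by (rule filterlim_filtercomap)

lemma filterlim_at_ii_iff: "filterlim f at_ii F \<longleftrightarrow> filterlim (\<lambda>x. Im (f x)) at_top F"
  unfolding at_ii_def by (simp add: filterlim_filtercomap_iff o_def)

lemma filterlim_affine_at_ii:
  assumes "\<alpha> > (0::real)"
  shows "filterlim (\<lambda>\<tau>. of_real \<alpha> * \<tau> + \<beta>) at_ii at_ii"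
  unfolding filterlim_at_ii_iff
  using filterlim_tendsto_add_at_top[OF tendsto_const
      filterlim_tendsto_pos_mult_at_top[OF tendsto_const assms filterlim_Im_at_ii], of "Im \<beta>"]
  by (simp add: add.commute)

lemma nome_tendsto_0: "((\<lambda>\<tau>. nome \<tau>) \<longlongrightarrow> 0) at_ii"
proof (rule tendsto_norm_zero_cancel)
  have "filterlim (\<lambda>\<tau>. - (2 * pi * Im \<tau>)) at_bot at_ii"
    unfolding filterlim_uminus_at_bot minus_minus
    by (intro filterlim_tendsto_pos_mult_at_top[OF tendsto_const _ filterlim_Im_at_ii]) auto
  then show "((\<lambda>\<tau>. norm (nome \<tau>)) \<longlongrightarrow> 0) at_ii"
    unfolding norm_nome by (rule filterlim_compose[OF exp_at_bot])
qed

lemma nome_scaled_tendsto_0: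
  assumes "e > (0::real)"
  shows "((\<lambda>\<tau>. nome (of_real e * \<tau>)) \<longlongrightarrow> 0) at_ii"
  using filterlim_compose[OF nome_tendsto_0 filterlim_affine_at_ii[OF assms, of 0]] by simp

text \<open>The exact order: f is asymptotic to a nonzero multiple of q^e. The exponent is real
  because cusps of width h produce multiples of 1/h.\<close>

definition cusp_order :: "(complex \<Rightarrow> complex) \<Rightarrow> real \<Rightarrow> bool" where
  "cusp_order f e \<longleftrightarrow> (\<exists>L. L \<noteq> 0 \<and> ((\<lambda>\<tau>. f \<tau> / nome (of_real e * \<tau>)) \<longlongrightarrow> L) at_ii)"

lemma cusp_order_cong:
  assumes "cusp_order f e" "eventually (\<lambda>\<tau>. f \<tau> = g \<tau>) at_ii"
  shows "cusp_order g e"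
proof -
  obtain L where "L \<noteq> 0" "((\<lambda>\<tau>. f \<tau> / nome (of_real e * \<tau>)) \<longlongrightarrow> L) at_ii"
    using assms(1) by (auto simp: cusp_order_def)
  moreover from this(2) have "((\<lambda>\<tau>. g \<tau> / nome (of_real e * \<tau>)) \<longlongrightarrow> L) at_ii"
    by (rule Lim_transform_eventually) (use assms(2) in eventually_elim, simp)
  ultimately show ?thesis by (auto simp: cusp_order_def)
qed

lemma cusp_order_mult:
  assumes "cusp_order f e" "cusp_order g e'"
  shows "cusp_order (\<lambda>\<tau>. f \<tau> * g \<tau>) (e + e')"
proof -
  obtain L L' where L: "L \<noteq> 0" "((\<lambda>\<tau>. f \<tau> / nome (of_real e * \<tau>)) \<longlongrightarrow> L) at_ii"
    "L' \<noteq> 0" "((\<lambda>\<tau>. g \<tau> / nome (of_real e' * \<tau>)) \<longlongrightarrow> L') at_ii"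
    using assms by (auto simp: cusp_order_def)
  have "((\<lambda>\<tau>. (f \<tau> / nome (of_real e * \<tau>)) * (g \<tau> / nome (of_real e' * \<tau>))) \<longlongrightarrow> L * L') at_ii"
    by (intro tendsto_intros L)
  also have "(\<lambda>\<tau>. (f \<tau> / nome (of_real e * \<tau>)) * (g \<tau> / nome (of_real e' * \<tau>)))
      = (\<lambda>\<tau>. (f \<tau> * g \<tau>) / nome (of_real (e + e') * \<tau>))"
    by (simp add: ring_distribs nome_add)
  finally show ?thesis using L unfolding cusp_order_def by (intro exI[of _ "L * L'"]) auto
qed

lemma cusp_order_const: "C \<noteq> 0 \<Longrightarrow> cusp_order (\<lambda>_. C) 0"
  by (auto simp: cusp_order_def)

lemma cusp_order_inverse:
  assumes "cusp_order f e"
  shows "cusp_order (\<lambda>\<tau>. inverse (f \<tau>)) (- e)"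
proof -
  obtain L where L: "L \<noteq> 0" "((\<lambda>\<tau>. f \<tau> / nome (of_real e * \<tau>)) \<longlongrightarrow> L) at_ii"
    using assms by (auto simp: cusp_order_def)
  have "((\<lambda>\<tau>. inverse (f \<tau> / nome (of_real e * \<tau>))) \<longlongrightarrow> inverse L) at_ii"
    by (intro tendsto_intros L)
  also have "(\<lambda>\<tau>. inverse (f \<tau> / nome (of_real e * \<tau>))) = (\<lambda>\<tau>. inverse (f \<tau>) / nome (of_real (- e) * \<tau>))"
    by (simp add: nome_uminus field_simps)
  finally show ?thesis using L unfolding cusp_order_def by (intro exI[of _ "inverse L"]) auto
qed

lemma cusp_order_divide:
  "cusp_order f e \<Longrightarrow> cusp_order g e' \<Longrightarrow> cusp_order (\<lambda>\<tau>. f \<tau> / g \<tau>) (e - e')"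
  using cusp_order_mult[of f e "\<lambda>\<tau>. inverse (g \<tau>)" "- e'"] cusp_order_inverse[of g e']
  by (simp add: field_class.field_divide_inverse)

lemma cusp_order_power: "cusp_order f e \<Longrightarrow> cusp_order (\<lambda>\<tau>. f \<tau> ^ n) (real n * e)"
proof (induction n)
  case (Suc n)
  then show ?case using cusp_order_mult[of f e "\<lambda>\<tau>. f \<tau> ^ n" "real n * e"] by (simp add: algebra_simps)
qed (auto intro: cusp_order_const)

lemma cusp_order_powi:
  assumes "cusp_order f e"
  shows "cusp_order (\<lambda>\<tau>. f \<tau> powi n) (real_of_int n * e)"
proof (cases "n \<ge> 0")
  case True
  then show ?thesis using cusp_order_power[OF assms, of "nat n"] by (simp add: power_int_def)
next
  case False
  then show ?thesis
    using cusp_order_power[OF cusp_order_inverse[OF assms], of "nat (- n)"] by (simp add: power_int_def)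
qed

text \<open>Upper triangular integer matrices act as such affine maps; they remain after an SL2(Z)
  factor has been split off from (5 0; 0 1) A or (2 0; 0 1) A.\<close>

lemma cusp_order_affine:
  assumes "cusp_order f e" "\<alpha> > 0"
  shows "cusp_order (\<lambda>\<tau>. f (of_real \<alpha> * \<tau> + \<beta>)) (\<alpha> * e)"
proof -
  obtain L where L: "L \<noteq> 0" "((\<lambda>\<tau>. f \<tau> / nome (of_real e * \<tau>)) \<longlongrightarrow> L) at_ii"
    using assms by (auto simp: cusp_order_def)
  have "((\<lambda>\<tau>. nome (of_real e * \<beta>) * (f (of_real \<alpha> * \<tau> + \<beta>) / nome (of_real e * (of_real \<alpha> * \<tau> + \<beta>))))
      \<longlongrightarrow> nome (of_real e * \<beta>) * L) at_ii"
    by (intro tendsto_intros filterlim_compose[OF L(2) filterlim_affine_at_ii[OF assms(2)]])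
  also have "(\<lambda>\<tau>. nome (of_real e * \<beta>) * (f (of_real \<alpha> * \<tau> + \<beta>) / nome (of_real e * (of_real \<alpha> * \<tau> + \<beta>))))
     = (\<lambda>\<tau>. f (of_real \<alpha> * \<tau> + \<beta>) / nome (of_real (\<alpha> * e) * \<tau>))"
    by (simp add: ring_distribs nome_add mult_ac)
  finally show ?thesis using L unfolding cusp_order_def by (intro exI[of _ "nome (of_real e * \<beta>) * L"]) auto
qed

lemma cusp_order_bigo:
  assumes "cusp_order f e" "e' \<le> e"
  shows "f \<in> O[at_ii](\<lambda>\<tau>. nome (of_real e' * \<tau>))"
proof -
  obtain L where L: "L \<noteq> 0" "((\<lambda>\<tau>. f \<tau> / nome (of_real e * \<tau>)) \<longlongrightarrow> L) at_ii"
    using assms by (auto simp: cusp_order_def)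
  have "f \<in> O[at_ii](\<lambda>\<tau>. nome (of_real e * \<tau>))"
    by (rule bigoI_tendsto[OF L(2)]) auto
  also have "(\<lambda>\<tau>. nome (of_real e * \<tau>)) \<in> O[at_ii](\<lambda>\<tau>. nome (of_real e' * \<tau>))"
  proof (rule landau_o.big_mono)
    show "\<forall>\<^sub>F \<tau> in at_ii. norm (nome (of_real e * \<tau>)) \<le> norm (nome (of_real e' * \<tau>))"
      using eventually_at_ii_gt[of 0] by eventually_elim (use assms(2) in \<open>auto simp: norm_nome intro: mult_right_mono\<close>)
  qed
  finally show ?thesis .
qed

section \<open>Orders of r(\<tau>), r(2 \<tau>) and their monomials at every cusp\<close>

lemma isCont_rr_prod_0: "isCont rr_prod 0"
  using rr_prod_holomorphic by (intro holomorphic_on_imp_continuous_on[THEN continuous_on_interior]) auto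

lemma rr_prod_nome_tendsto: "((\<lambda>\<tau>. rr_prod (nome \<tau>)) \<longlongrightarrow> 1) at_ii"
  using isCont_tendsto_compose[OF isCont_rr_prod_0 nome_tendsto_0] by simp

lemma rr_cf_cusp_order: "cusp_order rr_cf (1/5)"
proof -
  note rr_prod_nome_tendsto
  moreover have "\<forall>\<^sub>F \<tau> in at_ii. rr_prod (nome \<tau>) = rr_cf \<tau> / nome (of_real (1/5) * \<tau>)"
    using eventually_at_ii_gt[of 0] by eventually_elim (simp add: rr_cf_eq)
  ultimately have "((\<lambda>\<tau>. rr_cf \<tau> / nome (of_real (1/5) * \<tau>)) \<longlongrightarrow> 1) at_ii"
    by (rule Lim_transform_eventually)
  then show ?thesis unfolding cusp_order_def by (intro exI[of _ 1]) simp
qed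

text \<open>For a real argument both products lose everything but the factor 1 -
  \<open>nome v\<close>. The limit is -2 i sin(pi v), nonzero off the integers.\<close>

lemma jtheta_real_tendsto:
  "((\<lambda>T. jtheta (of_real v) T) \<longlongrightarrow> nome (- of_real v / 2) * (1 - nome (of_real v))) at_ii"
proof -
  have *: "((\<lambda>T. qpoch (nome T * w) (nome T)) \<longlongrightarrow> 1) at_ii" for w
  proof (rule LIM_zero_cancel, rule Lim_null_comparison)
    show "\<forall>\<^sub>F T in at_ii. norm (qpoch (nome T * w) (nome T) - 1)
        \<le> exp (norm (nome T * w) / (1 - norm (nome T))) - 1"
      using eventually_at_ii_gt[of 0] by eventually_elim (intro norm_qpoch_minus_1_le norm_nome_less_1)
    have "((\<lambda>T. exp (norm (nome T * w) / (1 - norm (nome T))) - 1) \<longlongrightarrow>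
        exp (norm (0 * w) / (1 - norm (0::complex))) - 1) at_ii"
      by (intro tendsto_intros nome_tendsto_0) auto
    then show "((\<lambda>T. exp (norm (nome T * w) / (1 - norm (nome T))) - 1) \<longlongrightarrow> 0) at_ii"
      by simp
  qed
  let ?v = "of_real v :: complex"
  have lim: "((\<lambda>T. nome (- ?v / 2) * ((1 - nome ?v) * qpoch (nome T * nome ?v) (nome T)) *
      qpoch (nome T * nome (- ?v)) (nome T)) \<longlongrightarrow> nome (- ?v / 2) * ((1 - nome ?v) * 1) * 1) at_ii"
    by (intro tendsto_intros *)
  have "\<forall>\<^sub>F T in at_ii. nome (- ?v / 2) * ((1 - nome ?v) * qpoch (nome T * nome ?v) (nome T)) *
      qpoch (nome T * nome (- ?v)) (nome T) = jtheta ?v T"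
    using eventually_at_ii_gt[of 0]
  proof eventually_elim
    case (elim T)
    have 1: "qpoch (nome ?v) (nome T) = (1 - nome ?v) * qpoch (nome T * nome ?v) (nome T)"
      by (rule qpoch_rec[OF norm_nome_less_1[OF elim]])
    have 2: "nome (T - ?v) = nome T * nome (- ?v)"
      by (simp add: nome_diff nome_uminus divide_inverse)
    show ?case
      unfolding jtheta_def 1 2 ..
  qed
  from Lim_transform_eventually[OF lim this] show ?thesis by simp
qed

text \<open>Here (5 0; 0 1) A = (5a v; c \<delta>) (1 \<beta>; 0 5) with the first factor in SL2(Z).
  Hence r(A \<tau>) is, up to a constant, a quotient of theta values at the real points v/5 and
  2v/5, which are not integers, and both values have finite nonzero limits.\<close>

lemma rr_cf_cusp_order_not_dvd:
  fixes a b c d :: int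
  assumes det: "a * d - b * c = 1" and "\<not> 5 dvd c"
  shows "cusp_order (\<lambda>\<tau>. rr_cf (moeb a b c d \<tau>)) 0"
proof -
  have "c mod 5 \<in> {1, 2, 3, 4}"
    using \<open>\<not> 5 dvd c\<close> by auto presburger
  moreover have "c ^ 4 mod 5 = (c mod 5) ^ 4 mod 5"
    by (simp add: power_mod)
  ultimately have "c ^ 4 mod 5 = 1 mod 5" by auto
  then have "5 dvd 1 - c ^ 4"
    by (metis mod_eq_dvd_iff)
  then have "5 dvd (1 - c ^ 4) * d" by simp
  also have "(1 - c ^ 4) * d = d - c * (c ^ 3 * d)"
    by (simp add: algebra_simps eval_nat_numeral)
  finally have "5 dvd d - c * (c ^ 3 * d)" .
  \<comment> \<open>\<beta> = c^3 d solves c \<beta> = d mod 5, because c^4 = 1 mod 5.\<close>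
  then obtain \<beta> \<delta> where \<delta>: "d - c * \<beta> = 5 * \<delta>" by (metis dvdE)
  define v where "v = b - a * \<beta>"
  have det': "(5 * a) * \<delta> - v * c = 1"
  proof -
    have "(5 * a) * \<delta> - v * c = a * (5 * \<delta>) - v * c" by simp
    also have "\<dots> = 1" unfolding \<delta>[symmetric] v_def using det by (simp add: algebra_simps)
    finally show ?thesis .
  qed
  have "\<not> 5 dvd v"
  proof
    assume "5 dvd v"
    then have "5 dvd (5 * a) * \<delta> - v * c" by simp
    then show False unfolding det' by simp
  qed
  let ?v = "real_of_int v / 5"
  let ?J = "\<lambda>v T. jtheta (of_real v) T"
  have lim_nz: "nome (- of_real v / 2) * (1 - nome (of_real v)) \<noteq> 0" if "v \<notin> \<int>" for v
  proof -
    have "nome (of_real v) \<noteq> 1"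
      using that unfolding nome_eq_1_iff by (metis Ints_of_int of_real_eq_iff of_real_of_int_eq)
    then show ?thesis by simp
  qed
  have nz: "?v \<notin> \<int>" "2 * ?v \<notin> \<int>"
  proof -
    show "?v \<notin> \<int>"
    proof
      assume "?v \<in> \<int>"
      then obtain k where "real_of_int v / 5 = real_of_int k" by (auto elim: Ints_cases)
      then have "real_of_int v = real_of_int (5 * k)" by simp
      then have "v = 5 * k" by (simp only: of_int_eq_iff)
      with \<open>\<not> 5 dvd v\<close> show False by simp
    qed
    show "2 * ?v \<notin> \<int>"
    proof
      assume "2 * ?v \<in> \<int>"
      then obtain k where "2 * (real_of_int v / 5) = real_of_int k" by (auto elim: Ints_cases)
      then have "real_of_int (2 * v) = real_of_int (5 * k)" by simp
      then have "2 * v = 5 * k" by (simp only: of_int_eq_iff)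
      with \<open>\<not> 5 dvd v\<close> show False by presburger
    qed
  qed
  have J: "cusp_order (?J v) 0" if "v \<notin> \<int>" for v
    unfolding cusp_order_def
  proof (intro exI conjI)
    show "((\<lambda>T. ?J v T / nome (of_real 0 * T)) \<longlongrightarrow> nome (- of_real v / 2) * (1 - nome (of_real v))) at_ii"
      using jtheta_real_tendsto[of v] by simp
  qed (rule lim_nz[OF that])
  from cusp_order_divide[OF J[OF nz(1)] J[OF nz(2)]]
  have "cusp_order (\<lambda>T. ?J ?v T / ?J (2 * ?v) T) 0" by simp
  then have ord: "cusp_order (\<lambda>T. ?J ?v (of_real (1/5) * T + of_int \<beta> / 5) / ?J (2 * ?v) (of_real (1/5) * T + of_int \<beta> / 5)) (1/5 * 0)"
    by (rule cusp_order_affine) simp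
  \<comment> \<open>The exponent of the constant that arises when \<open>kap_shift\<close> moves the
    first characteristics a and 2a to 0.\<close>
  define e :: complex where "e = (of_int a - of_int a * of_real ?v) / 2 - (2 * of_int a - 2 * of_int a * (2 * of_real ?v)) / 2"
  from cusp_order_mult[OF cusp_order_const[of "nome e"] ord]
  have "cusp_order (\<lambda>T. nome e * (?J ?v (of_real (1/5) * T + of_int \<beta> / 5) / ?J (2 * ?v) (of_real (1/5) * T + of_int \<beta> / 5))) 0"
    by simp
  then show ?thesis
  proof (rule cusp_order_cong)
    show "\<forall>\<^sub>F \<tau> in at_ii. nome e * (?J ?v (of_real (1/5) * \<tau> + of_int \<beta> / 5) / ?J (2 * ?v) (of_real (1/5) * \<tau> + of_int \<beta> / 5))
         = rr_cf (moeb a b c d \<tau>)"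
      using eventually_at_ii_gt[of 0]
    proof eventually_elim
      case (elim \<tau>)
      define T where "T = of_real (1/5) * \<tau> + of_int \<beta> / 5"
      have T: "Im T > 0" using elim by (simp add: T_def)
      have T5: "5 * T = \<tau> + of_int \<beta>" by (simp add: T_def algebra_simps)
      obtain C where C: "C \<noteq> 0" "\<And>u. kap u 0 (moeb (5 * a) v c \<delta> T) = C * kap (u * of_int (5 * a)) (u * of_int v) T"
        using kap_modular[OF det' T] by blast
      have "of_int (5 * \<delta>) = (of_int (d - c * \<beta>) :: complex)" unfolding \<delta> by simp
      then have d5: "of_int d = (5 * of_int \<delta> + of_int c * of_int \<beta> :: complex)" by (simp add: algebra_simps)
      have "moeb (5 * a) v c \<delta> T = (5 * (of_int a * (5 * T) + of_int v)) / (of_int c * (5 * T) + 5 * of_int \<delta>)"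
      proof -
        have "of_int c * (5 * T) + 5 * of_int \<delta> = 5 * (of_int c * T + of_int \<delta>)"
          "of_int a * (5 * T) + of_int v = of_int (5 * a) * T + of_int v"
          by (simp_all add: algebra_simps)
        moreover have "(5 * x) / (5 * y) = x / y" for x y :: complex
          by simp
        ultimately show ?thesis by (simp only:)
      qed
      also have "\<dots> = 5 * moeb a b c d \<tau>"
        unfolding T5 d5 v_def by (simp add: algebra_simps)
      finally have eq: "moeb (5 * a) v c \<delta> T = 5 * moeb a b c d \<tau>" .
      have 1: "kap (of_int a) (of_int v / 5) T = nome ((of_int a - of_int a * of_real ?v) / 2) * ?J ?v T"
        using kap_shift[OF T, of 0 a "of_int v / 5" 0] by (simp add: kap_def)
      have 2: "kap (2 * of_int a) (2 * of_int v / 5) T = nome ((2 * of_int a - 2 * of_int a * (2 * of_real ?v)) / 2) * ?J (2 * ?v) T"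
        using kap_shift[OF T, of 0 "2 * a" "2 * of_int v / 5" 0] by (simp add: kap_def)
      have "rr_cf (moeb a b c d \<tau>) = kap (1/5) 0 (5 * moeb a b c d \<tau>) / kap (2/5) 0 (5 * moeb a b c d \<tau>)"
        by (rule rr_cf_eq_kap[OF Im_moebius_pos[OF det elim]])
      also have "\<dots> = kap (of_int a) (of_int v / 5) T / kap (2 * of_int a) (2 * of_int v / 5) T"
        unfolding eq[symmetric] C using C(1) by simp
      also have "\<dots> = nome e * (?J ?v T / ?J (2 * ?v) T)"
        unfolding 1 2 e_def nome_diff by simp
      finally show ?case by (simp only: T_def)
    qed
  qed
qed

text \<open>Five times the order of r at the cusp a/c. For 5 | c and a prime to 5 it is the Legendre
  symbol of a mod 5.\<close>

definition rr_sign :: "int \<Rightarrow> int \<Rightarrow> int" where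
  "rr_sign a c = (if 5 dvd c then if a mod 5 \<in> {1, 4} then 1 else - 1 else 0)"

lemma not_dvd_first_column:
  fixes a b c d p :: int
  assumes "a * d - b * c = 1" "p dvd c" "\<not> is_unit p"
  shows "\<not> p dvd a"
proof
  assume "p dvd a"
  then have "p dvd a * d - b * c" using assms(2) by auto
  with assms show False by simp
qed

lemma rr_cf_moeb_order:
  fixes a b c d :: int
  assumes det: "a * d - b * c = 1"
  shows "cusp_order (\<lambda>\<tau>. rr_cf (moeb a b c d \<tau>)) (of_int (rr_sign a c) / 5)"
proof (cases "5 dvd c")
  case False
  then show ?thesis using rr_cf_cusp_order_not_dvd[OF det] by (simp add: rr_sign_def)
next
  case True
  have "\<not> 5 dvd a" using not_dvd_first_column[OF det True] by simp
  \<comment> \<open>The offset 2 makes s the residue of least absolute value.\<close>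
  define m where "m = (a + 2) div 5"
  define s where "s = (a + 2) mod 5 - 2"
  have a: "a = 5 * m + s" unfolding m_def s_def by presburger
  note tr = rr_cf_Gamma0_5[OF det True _ a]
  define \<zeta> :: complex where "\<zeta> = nome ((of_int m + of_int b + of_int m * of_int b) / 2 - 3 * of_int s * of_int b / 10)"
  consider "s \<in> {1, -1}" "a mod 5 \<in> {1, 4}" | "s \<in> {2, -2}" "a mod 5 \<notin> {1, 4}"
  proof -
    have "s \<in> {1, -1} \<and> a mod 5 \<in> {1, 4} \<or> s \<in> {2, -2} \<and> a mod 5 \<notin> {1, 4}"
      using \<open>\<not> 5 dvd a\<close> unfolding s_def insert_iff empty_iff by presburger
    then show thesis using that by blast
  qed
  then show ?thesis
  proof cases
    case 1
    have "cusp_order (\<lambda>\<tau>. \<zeta> * rr_cf \<tau>) (0 + 1/5)"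
      by (intro cusp_order_mult cusp_order_const rr_cf_cusp_order) (simp add: \<zeta>_def)
    moreover have "\<forall>\<^sub>F \<tau> in at_ii. \<zeta> * rr_cf \<tau> = rr_cf (moeb a b c d \<tau>)"
      using eventually_at_ii_gt[of 0] by eventually_elim (simp add: tr(1)[OF _ 1(1)] \<zeta>_def)
    ultimately show ?thesis
      using 1 True by (auto simp: rr_sign_def intro: cusp_order_cong)
  next
    case 2
    have "cusp_order (\<lambda>\<tau>. \<zeta> / rr_cf \<tau>) (0 - 1/5)"
      by (intro cusp_order_divide cusp_order_const rr_cf_cusp_order) (simp add: \<zeta>_def)
    moreover have "\<forall>\<^sub>F \<tau> in at_ii. \<zeta> / rr_cf \<tau> = rr_cf (moeb a b c d \<tau>)"
      using eventually_at_ii_gt[of 0] by eventually_elim (simp add: tr(2)[OF _ 2(1)] \<zeta>_def)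
    ultimately show ?thesis
      using 2 True by (auto simp: rr_sign_def intro: cusp_order_cong)
  qed
qed

lemma double_moeb_even:
  "2 * moeb a b (2 * c) d \<tau> = moeb a (2 * b) c d (2 * \<tau>)"
  by (simp add: algebra_simps)

text \<open>For even c the doubled point is an SL2(Z) image of 2 \<tau>, which doubles the order.
  For odd c it is an image of (\<tau> + d)/2, which halves it, and the first column starts with 2a;
  since 2 is a non-residue mod 5, the sign flips.\<close>

lemma rr_cf_double_moeb_order:
  fixes a b c d :: int
  assumes det: "a * d - b * c = 1"
  defines "s \<equiv> real_of_int (rr_sign a c)"
  shows "cusp_order (\<lambda>\<tau>. rr_cf (2 * moeb a b c d \<tau>)) (if even c then 2 * s / 5 else - s / 10)"
proof (cases "even c")
  case True
  then obtain c' where c: "c = 2 * c'" by blast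
  have det': "a * d - (2 * b) * c' = 1" using det c by simp
  have "cusp_order (\<lambda>\<tau>. rr_cf (moeb a (2 * b) c' d (of_real 2 * \<tau> + 0))) (2 * (of_int (rr_sign a c') / 5))"
    by (rule cusp_order_affine[OF rr_cf_moeb_order[OF det']]) simp
  moreover have "rr_sign a c' = rr_sign a c"
  proof -
    have "5 dvd 2 * c' \<longleftrightarrow> 5 dvd c'" by presburger
    then show ?thesis by (simp add: rr_sign_def c)
  qed
  ultimately show ?thesis
    using True unfolding c double_moeb_even by (simp add: s_def c)
next
  case False
  then obtain e where c: "c = 2 * e + 1" by (rule oddE)
  \<comment> \<open>These entries come from (2 0; 0 1) A = (2a b-ad; c -de) (1 d; 0 2).\<close>
  have det': "(2 * a) * (- d * e) - (b - a * d) * c = 1"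
  proof -
    have "(2 * a) * (- d * e) - (b - a * d) * c = a * d - b * c" by (simp add: c algebra_simps)
    with det show ?thesis by simp
  qed
  have "2 * moeb a b c d \<tau> = moeb (2 * a) (b - a * d) c (- d * e) (of_real (1/2) * \<tau> + of_int d / 2)" for \<tau>
  proof -
    have 1: "of_int (2 * a) * (of_real (1/2) * \<tau> + of_int d / 2) + of_int (b - a * d) = of_int a * \<tau> + of_int b"
      by (simp add: field_simps)
    have 2: "of_int c * (of_real (1/2) * \<tau> + of_int d / 2) + of_int (- d * e) = (of_int c * \<tau> + of_int d) / 2"
      by (simp add: c field_simps)
    show ?thesis unfolding 1 2 by simp
  qed
  moreover have "cusp_order (\<lambda>\<tau>. rr_cf (moeb (2 * a) (b - a * d) c (- d * e) (of_real (1/2) * \<tau> + of_int d / 2)))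
      (1/2 * (of_int (rr_sign (2 * a) c) / 5))"
    by (rule cusp_order_affine[OF rr_cf_moeb_order[OF det']]) simp
  moreover have "rr_sign (2 * a) c = - rr_sign a c"
  proof (cases "5 dvd c")
    case True
    then have "\<not> 5 dvd a" using not_dvd_first_column[OF det True] by simp
    then have "(2 * a) mod 5 \<in> {1, 4} \<longleftrightarrow> a mod 5 \<notin> {1, 4}"
      unfolding insert_iff empty_iff by presburger
    then show ?thesis using True by (simp add: rr_sign_def)
  qed (simp add: rr_sign_def)
  ultimately show ?thesis using False by (simp add: s_def)
qed

text \<open>One family containing F, k, l and their reciprocals, so that holomorphy, invariance and
  cusp orders need a single proof.\<close>

definition rr_mono :: "int \<Rightarrow> int \<Rightarrow> complex \<Rightarrow> complex" where
  "rr_mono m n \<tau> = rr_cf \<tau> powi m * rr_cf (2 * \<tau>) powi n"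

lemma rr_k_eq_mono: "rr_k = rr_mono 1 2"
  by (auto simp: rr_k_def rr_mono_def)

lemma rr_l_eq_mono: "rr_l = rr_mono (- 2) 1"
  by (auto simp: rr_l_def rr_mono_def power_int_minus field_simps)

lemma rr_mono_nonzero: "Im \<tau> > 0 \<Longrightarrow> rr_mono m n \<tau> \<noteq> 0"
  by (simp add: rr_mono_def rr_cf_nonzero)

lemma rr_mono_holomorphic: "rr_mono m n holomorphic_on upper_half_plane"
proof -
  have 1: "(\<lambda>\<tau>. rr_cf (2 * \<tau>)) holomorphic_on upper_half_plane"
    by (rule holomorphic_on_compose_gen[OF _ rr_cf_holomorphic, of "\<lambda>\<tau>. 2 * \<tau>", unfolded o_def])
       (auto simp: upper_half_plane_def intro!: holomorphic_intros)
  show ?thesis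
    unfolding rr_mono_def
    by (intro holomorphic_intros rr_cf_holomorphic 1) (auto simp: upper_half_plane_def rr_cf_nonzero)
qed

text \<open>The integers m + 2n and n - 2m are five times the exponents of k and l. So k contributes
  only at cusps with even c, and l only at cusps with odd c.\<close>

lemma rr_mono_cusp_order:
  fixes a b c d :: int
  assumes det: "a * d - b * c = 1"
  defines "s \<equiv> real_of_int (rr_sign a c)"
  shows "cusp_order (\<lambda>\<tau>. rr_mono m n (moeb a b c d \<tau>))
           (if even c then of_int (m + 2 * n) * s / 5 else of_int (2 * m - n) * s / 10)"
proof -
  have "cusp_order (\<lambda>\<tau>. rr_mono m n (moeb a b c d \<tau>)) (of_int m * (s / 5) + of_int n * (if even c then 2 * s / 5 else - s / 10))"
    unfolding rr_mono_def s_def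
    by (intro cusp_order_mult cusp_order_powi rr_cf_moeb_order rr_cf_double_moeb_order det)
  also have "of_int m * (s / 5) + of_int n * (if even c then 2 * s / 5 else - s / 10)
      = (if even c then (m + 2 * n) * s / 5 else (2 * m - n) * s / 10)"
    by (auto simp: field_simps)
  finally show ?thesis .
qed

text \<open>For a = 1 mod 10 the multiplier of r(\<tau>) is \<open>nome (b / 5)\<close>, and that of
  r(2 \<tau>), whose matrix has 2b instead of b, is its square. Together they give
  \<open>nome\<close> of (m + 2n) b / 5, an integer.\<close>

lemma rr_mono_moeb_Gamma1:
  fixes a b c d :: int
  assumes det: "a * d - b * c = 1" and "10 dvd c" "a mod 10 = 1" and \<tau>: "Im \<tau> > 0" and "5 dvd m + 2 * n"
  shows "rr_mono m n (moeb a b c d \<tau>) = rr_mono m n \<tau>"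
proof -
  obtain c' where c: "c = 10 * c'" using \<open>10 dvd c\<close> by (rule dvdE)
  define t where "t = a div 10"
  have a: "a = 5 * (2 * t) + 1" using \<open>a mod 10 = 1\<close> unfolding t_def by presburger
  have r: "rr_cf (moeb a b c d \<tau>') = nome (of_int b / 5) * rr_cf \<tau>'"
    if det: "a * d - b * c = 1" and "5 dvd c" and \<tau>: "Im \<tau>' > 0" for b c :: int and \<tau>'
  proof -
    have e: "(of_int (2 * t) + of_int b + of_int (2 * t) * of_int b) / 2 - 3 * of_int 1 * of_int b / 10
        = of_int (t + t * b) + (of_int b / 5 :: complex)" by (simp add: field_simps)
    show ?thesis
      using rr_cf_Gamma0_5(1)[OF that a] unfolding e by (simp add: nome_add[of "of_int _"] del: of_int_add of_int_mult)
  qed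
  have det2: "a * d - (2 * b) * (5 * c') = 1" using det c by simp
  have 1: "rr_cf (moeb a b c d \<tau>) = nome (of_int b / 5) * rr_cf \<tau>"
    using \<open>10 dvd c\<close> by (intro r det \<tau>) auto
  have "2 * moeb a b c d \<tau> = moeb a (2 * b) (5 * c') d (2 * \<tau>)"
    using double_moeb_even[where a = a and b = b and c = "5 * c'" and d = d and \<tau> = \<tau>] by (simp add: c)
  then have 2: "rr_cf (2 * moeb a b c d \<tau>) = nome (of_int (2 * b) / 5) * rr_cf (2 * \<tau>)"
    using r[OF det2, of "2 * \<tau>"] \<tau> by simp
  obtain k where k: "m + 2 * n = 5 * k" using \<open>5 dvd m + 2 * n\<close> by (rule dvdE)
  have powi: "nome z powi i = nome (of_int i * z)" for z i
    by (simp add: nome_def exp_power_int algebra_simps)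
  have "nome (of_int b / 5) powi m * nome (of_int (2 * b) / 5) powi n = nome (of_int ((m + 2 * n) * b) / 5)"
    unfolding powi nome_add[symmetric] by (rule arg_cong[of _ _ nome]) (simp add: field_simps)
  also have "of_int ((m + 2 * n) * b) / 5 = (of_int (k * b) :: complex)"
    unfolding k by simp
  finally have "nome (of_int b / 5) powi m * nome (of_int (2 * b) / 5) powi n = 1" 
    by (simp only: nome_of_int)
  then have "rr_cf \<tau> powi m * rr_cf (2 * \<tau>) powi n * (nome (of_int b / 5) powi m * nome (of_int (2 * b) / 5) powi n)
      = rr_cf \<tau> powi m * rr_cf (2 * \<tau>) powi n" by (simp only: mult_1_right)
  then show ?thesis
    unfolding rr_mono_def 1 2 power_int_mult_distrib by (simp only: mult_ac)
qed

text \<open>The matrix is in Gamma0(10) with 3 = -2 mod 5, so it inverts r(\<tau>) and r(2 \<tau>).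
  The exponents 37/10 + 2 * 69/10 and 69/10 - 2 * 37/10 are both half-integers, whence the sign -1.
  This symmetry later fixes the constants in the relation between k and l.\<close>

lemma rr_kl_diamond:
  assumes \<tau>: "Im \<tau> > 0"
  shows "rr_k (moeb 3 2 10 7 \<tau>) = - 1 / rr_k \<tau>" "rr_l (moeb 3 2 10 7 \<tau>) = - 1 / rr_l \<tau>"
proof -
  have 1: "rr_cf (moeb 3 2 10 7 \<tau>) = nome (37/10) / rr_cf \<tau>"
  proof -
    have e: "(of_int 1 + of_int 2 + of_int 1 * of_int 2) / 2 - 3 * of_int (- 2) * of_int 2 / 10 = (37/10 :: complex)"
      by simp
    show ?thesis
      by (rule rr_cf_Gamma0_5(2)[where m = 1 and s = "- 2" and b = 2, unfolded e]) (use \<tau> in auto)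
  qed
  have eq: "2 * moeb 3 2 10 7 \<tau> = moeb 3 4 5 7 (2 * \<tau>)"
    using double_moeb_even[where a = 3 and b = 2 and c = 5 and d = 7 and \<tau> = \<tau>] by simp
  have 2: "rr_cf (2 * moeb 3 2 10 7 \<tau>) = nome (69/10) / rr_cf (2 * \<tau>)"
  proof -
    have e: "(of_int 1 + of_int 4 + of_int 1 * of_int 4) / 2 - 3 * of_int (- 2) * of_int 4 / 10 = (69/10 :: complex)"
      by simp
    have "rr_cf (moeb 3 4 5 7 (2 * \<tau>)) = nome (69/10) / rr_cf (2 * \<tau>)"
      by (rule rr_cf_Gamma0_5(2)[where m = 1 and s = "- 2" and b = 4, unfolded e]) (use \<tau> in auto)
    with eq show ?thesis by simp
  qed
  have "nome (37/10) * nome (69/10) ^ 2 = nome (of_int 17 + 1/2)"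
    unfolding nome_power nome_add[symmetric] by simp
  then have k: "nome (37/10) * nome (69/10) ^ 2 = - 1"
    by (simp only: nome_add nome_of_int nome_half mult_1_left)
  have "nome (69/10) / nome (37/10) ^ 2 = nome (of_int (-1) + 1/2)"
    unfolding nome_power nome_diff[symmetric] by simp
  then have l: "nome (69/10) / nome (37/10) ^ 2 = - 1"
    by (simp only: nome_add nome_of_int nome_half mult_1_left)
  have "rr_k (moeb 3 2 10 7 \<tau>) = (nome (37/10) * nome (69/10) ^ 2) / rr_k \<tau>"
    unfolding rr_k_def 1 2 by (simp only: power_divide times_divide_times_eq)
  then show "rr_k (moeb 3 2 10 7 \<tau>) = - 1 / rr_k \<tau>" unfolding k .
  have "rr_l (moeb 3 2 10 7 \<tau>) = (nome (69/10) / nome (37/10) ^ 2) / rr_l \<tau>"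
    unfolding rr_l_def 1 2 by (simp add: power_divide)
  then show "rr_l (moeb 3 2 10 7 \<tau>) = - 1 / rr_l \<tau>" unfolding l .
qed

section \<open>The modular group\<close>

definition mat2 :: "int \<Rightarrow> int \<Rightarrow> int \<Rightarrow> int \<Rightarrow> int ^ 2 ^ 2" where
  "mat2 a b c d = vector [vector [a, b], vector [c, d]]"

lemma mat2_sel [simp]:
  "mat2 a b c d $ 1 $ 1 = a" "mat2 a b c d $ 1 $ 2 = b" "mat2 a b c d $ 2 $ 1 = c" "mat2 a b c d $ 2 $ 2 = d"
  by (simp_all add: mat2_def)

lemma mat_mult_sel [simp]:
  fixes A B :: "int ^ 2 ^ 2"
  shows "(A ** B) $ i $ j = A $ i $ 1 * B $ 1 $ j + A $ i $ 2 * B $ 2 $ j"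
  by (simp add: matrix_matrix_mult_def sum_2)

text \<open>The adjugate, which on \<open>SL2Z\<close> is the inverse.\<close>

definition adj2 :: "int ^ 2 ^ 2 \<Rightarrow> int ^ 2 ^ 2" where
  "adj2 A = mat2 (A $ 2 $ 2) (- A $ 1 $ 2) (- A $ 2 $ 1) (A $ 1 $ 1)"

lemma adj2_sel [simp]:
  "adj2 A $ 1 $ 1 = A $ 2 $ 2" "adj2 A $ 1 $ 2 = - A $ 1 $ 2" "adj2 A $ 2 $ 1 = - A $ 2 $ 1" "adj2 A $ 2 $ 2 = A $ 1 $ 1"
  by (simp_all add: adj2_def)

lemma SL2Z_iff: "A \<in> SL2Z \<longleftrightarrow> A $ 1 $ 1 * A $ 2 $ 2 - A $ 1 $ 2 * A $ 2 $ 1 = 1"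
  by (simp add: SL2Z_def det_2)

lemma SL2Z_mult: "A \<in> SL2Z \<Longrightarrow> B \<in> SL2Z \<Longrightarrow> A ** B \<in> SL2Z"
  by (simp add: SL2Z_def det_mul)

lemma SL2Z_adj2: "A \<in> SL2Z \<Longrightarrow> adj2 A \<in> SL2Z"
  by (simp add: SL2Z_iff mult.commute)

lemma Im_mobius_pos: "A \<in> SL2Z \<Longrightarrow> Im \<tau> > 0 \<Longrightarrow> Im (mobius A \<tau>) > 0"
  unfolding mobius_def SL2Z_iff by (rule Im_moebius_pos)

lemma mobius_in_H: "A \<in> SL2Z \<Longrightarrow> \<tau> \<in> upper_half_plane \<Longrightarrow> mobius A \<tau> \<in> upper_half_plane"
  by (simp add: upper_half_plane_def Im_mobius_pos)

lemma mobius_mult: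
  assumes "B \<in> SL2Z" "Im \<tau> > 0"
  shows "mobius (A ** B) \<tau> = mobius A (mobius B \<tau>)"
proof -
  define j where "j = of_int (B $ 2 $ 1) * \<tau> + of_int (B $ 2 $ 2)"
  define N where "N = of_int (B $ 1 $ 1) * \<tau> + of_int (B $ 1 $ 2)"
  have j: "j \<noteq> 0" using moebius_denom_nonzero[OF _ assms(2)] assms(1) unfolding SL2Z_iff j_def by blast
  have "mobius (A ** B) \<tau> = (of_int (A $ 1 $ 1) * N + of_int (A $ 1 $ 2) * j) / (of_int (A $ 2 $ 1) * N + of_int (A $ 2 $ 2) * j)"
    by (simp add: mobius_def N_def j_def algebra_simps)
  also have "\<dots> = (of_int (A $ 1 $ 1) * (N / j) + of_int (A $ 1 $ 2)) / (of_int (A $ 2 $ 1) * (N / j) + of_int (A $ 2 $ 2))"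
  proof -
    have "of_int x * N + of_int y * j = j * (of_int x * (N / j) + of_int y)" for x y
      using j by (simp add: field_simps)
    then show ?thesis using j by simp
  qed
  finally show ?thesis by (simp add: mobius_def N_def j_def)
qed

lemma mobius_adj2:
  assumes "A \<in> SL2Z" "Im \<tau> > 0"
  shows "mobius (adj2 A) (mobius A \<tau>) = \<tau>" "mobius A (mobius (adj2 A) \<tau>) = \<tau>"
proof -
  have 1: "mobius B \<tau> = \<tau>" if "B $ 1 $ 1 = 1" "B $ 1 $ 2 = 0" "B $ 2 $ 1 = 0" "B $ 2 $ 2 = 1" for B :: "int ^ 2 ^ 2"
    using that by (simp add: mobius_def)
  show "mobius (adj2 A) (mobius A \<tau>) = \<tau>"
    unfolding mobius_mult[OF assms, symmetric]
    by (rule 1) (use assms in \<open>auto simp: SL2Z_iff algebra_simps\<close>)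
  show "mobius A (mobius (adj2 A) \<tau>) = \<tau>"
    unfolding mobius_mult[OF SL2Z_adj2[OF assms(1)] assms(2), symmetric]
    by (rule 1) (use assms in \<open>auto simp: SL2Z_iff algebra_simps\<close>)
qed

lemma mobius_holomorphic: "A \<in> SL2Z \<Longrightarrow> mobius A holomorphic_on upper_half_plane"
  unfolding mobius_def SL2Z_iff
  by (intro holomorphic_intros) (auto simp: upper_half_plane_def dest: moebius_denom_nonzero)

lemma holomorphic_on_mobius:
  assumes "f holomorphic_on upper_half_plane" "A \<in> SL2Z"
  shows "(\<lambda>\<tau>. f (mobius A \<tau>)) holomorphic_on upper_half_plane"
  using holomorphic_on_compose_gen[OF mobius_holomorphic[OF assms(2)] assms(1)] mobius_in_H[OF assms(2)]
  by (auto simp: o_def)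

text \<open>Only a lower bound for the height is needed. A bottom row (c, d) minimising |c \<tau> +
  d| exists, since rows with value at most 1 form a finite set containing (0, 1). After a
  translation to |Re| \<le> 1/2, minimality gives absolute value at least 1.\<close>

lemma reduction_theory:
  assumes "Im \<tau> > 0"
  obtains A \<tau>' where "A \<in> SL2Z" "Im \<tau>' \<ge> 1/2" "\<tau> = mobius A \<tau>'"
proof -
  define N where "N = (\<lambda>(c::int, d::int). norm (of_int c * \<tau> + of_int d))"
  define S where "S = {p. N p \<le> 1 \<and> (\<exists>A\<in>SL2Z. p = (A $ 2 $ 1, A $ 2 $ 2))}"
  have "finite S"
  proof (rule finite_subset)
    define M where "M = \<lceil>1 / Im \<tau>\<rceil>"
    define K where "K = \<lceil>1 + of_int M * norm \<tau>\<rceil>"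
    show "finite ({- M..M} \<times> {- K..K})" by simp
    show "S \<subseteq> {- M..M} \<times> {- K..K}"
    proof
      fix p assume "p \<in> S"
      then obtain c d where p: "p = (c, d)" and le: "norm (of_int c * \<tau> + of_int d) \<le> 1"
        by (auto simp: S_def N_def)
      have "\<bar>of_int c * Im \<tau>\<bar> \<le> 1"
        using abs_Im_le_cmod[of "of_int c * \<tau> + of_int d"] le by simp
      then have "\<bar>of_int c\<bar> \<le> 1 / Im \<tau>"
        using assms by (simp add: abs_mult field_simps)
      then have c: "\<bar>c\<bar> \<le> M" unfolding M_def by linarith
      have "norm (of_int d :: complex) \<le> norm (of_int c * \<tau> + of_int d) + norm (of_int c * \<tau>)"
        by (metis add.commute add_diff_cancel_left' norm_triangle_ineq4)
      also have "\<dots> \<le> 1 + of_int \<bar>c\<bar> * norm \<tau>"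
        using le by (simp add: norm_mult)
      also have "\<dots> \<le> 1 + of_int M * norm \<tau>"
        using c by (intro add_left_mono mult_right_mono) auto
      finally have "\<bar>d\<bar> \<le> K" unfolding K_def by simp linarith
      with c show "p \<in> {- M..M} \<times> {- K..K}" unfolding p by auto
    qed
  qed
  have id: "mat2 1 0 0 1 \<in> SL2Z" by (simp add: SL2Z_iff)
  have "(0, 1) \<in> S" unfolding S_def N_def using id by (auto intro!: bexI[of _ "mat2 1 0 0 1"])
  then obtain p where p: "p \<in> S" "\<And>p'. p' \<in> S \<Longrightarrow> N p \<le> N p'"
    using arg_min_if_finite[OF \<open>finite S\<close>, of N] by (metis empty_iff not_le_imp_less)
  then obtain A :: "int ^ 2 ^ 2" where A: "A \<in> SL2Z" "p = (A $ 2 $ 1, A $ 2 $ 2)" "N p \<le> 1" by (auto simp: S_def)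
  have min: "N p \<le> N (B $ 2 $ 1, B $ 2 $ 2)" if "B \<in> SL2Z" for B :: "int ^ 2 ^ 2"
  proof (cases "N (B $ 2 $ 1, B $ 2 $ 2) \<le> 1")
    case True
    then show ?thesis using that by (intro p(2)) (auto simp: S_def)
  qed (use A(3) in auto)
  define n where "n = \<lfloor>Re (mobius A \<tau>) + 1/2\<rfloor>"
  define B where "B = mat2 1 (- n) 0 1 ** A"
  have B: "B \<in> SL2Z" unfolding B_def by (rule SL2Z_mult) (auto simp: SL2Z_iff A[unfolded SL2Z_iff])
  have mB: "mobius B \<tau> = mobius A \<tau> - of_int n"
    unfolding B_def mobius_mult[OF A(1) assms] by (simp add: mobius_def)
  have re: "\<bar>Re (mobius B \<tau>)\<bar> \<le> 1/2" 
  proof -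
    have "of_int n \<le> Re (mobius A \<tau>) + 1/2" "Re (mobius A \<tau>) + 1/2 < of_int n + 1"
      unfolding n_def by linarith+
    moreover have "Re (mobius B \<tau>) = Re (mobius A \<tau>) - of_int n"
      by (simp add: mB)
    ultimately show ?thesis by linarith
  qed
  have Bp: "(B $ 2 $ 1, B $ 2 $ 2) = p" by (simp add: B_def A(2))
  define j where "j = of_int (B $ 2 $ 1) * \<tau> + of_int (B $ 2 $ 2)"
  have j: "j \<noteq> 0" using moebius_denom_nonzero[OF _ assms] B unfolding SL2Z_iff j_def by blast
  have "norm j \<le> norm (of_int (B $ 1 $ 1) * \<tau> + of_int (B $ 1 $ 2))"
  proof -
    \<comment> \<open>The bottom row of this product is the top row of B, so minimality compares
      numerator and denominator of \<open>mobius B \<tau>\<close>.\<close>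
    have "mat2 0 (-1) 1 0 ** B \<in> SL2Z" using B by (intro SL2Z_mult) (auto simp: SL2Z_iff)
    from min[OF this] show ?thesis unfolding Bp[symmetric] by (simp add: N_def j_def)
  qed
  then have "norm (mobius B \<tau>) \<ge> 1"
    using j by (simp add: mobius_def norm_divide j_def)
  then have "1 \<le> (Re (mobius B \<tau>))\<^sup>2 + (Im (mobius B \<tau>))\<^sup>2"
    by (metis cmod_power2 one_le_power)
  moreover have "(Re (mobius B \<tau>))\<^sup>2 \<le> (1/2)\<^sup>2"
    using re by (metis abs_ge_zero power2_abs power_mono)
  ultimately have "(1/2)\<^sup>2 \<le> (Im (mobius B \<tau>))\<^sup>2" by (simp add: power2_eq_square)
  then have "1/2 \<le> Im (mobius B \<tau>)"
    using Im_mobius_pos[OF B assms] by (simp add: power2_le_iff_abs_le)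
  then show thesis
    using that[OF SL2Z_adj2[OF B], of "mobius B \<tau>"] mobius_adj2[OF B assms] by simp
qed

section \<open>Functions invariant under the level 10 group\<close>

definition inv10 :: "(complex \<Rightarrow> complex) \<Rightarrow> bool" where
  "inv10 f \<longleftrightarrow> (\<forall>A\<in>Gamma1 10. \<forall>\<tau>\<in>upper_half_plane. f (mobius A \<tau>) = f \<tau>)"

text \<open>Reduction mod 10. Equal keys make A B^(-1) congruent to the identity. This is finer than
  the cosets of \<open>Gamma1 10\<close>, but finiteness is immediate and the key is unchanged by
  translations by multiples of 10.\<close>

definition key10 :: "int ^ 2 ^ 2 \<Rightarrow> int \<times> int \<times> int \<times> int" where
  "key10 A = (A $ 1 $ 1 mod 10, A $ 1 $ 2 mod 10, A $ 2 $ 1 mod 10, A $ 2 $ 2 mod 10)"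

text \<open>For A in \<open>SL2Z\<close>, membership in \<open>Gamma1 10\<close> up to sign, read
  off from the first column: the cusp A(infinity) is equivalent to i infinity.\<close>

definition pm_Gamma1 :: "int ^ 2 ^ 2 \<Rightarrow> bool" where
  "pm_Gamma1 A \<longleftrightarrow> 10 dvd A $ 2 $ 1 \<and> A $ 1 $ 1 mod 10 \<in> {1, 9}"

lemma Gamma1_10_iff:
  "A \<in> Gamma1 10 \<longleftrightarrow> A \<in> SL2Z \<and> A $ 1 $ 1 mod 10 = 1 \<and> A $ 2 $ 2 mod 10 = 1 \<and> 10 dvd A $ 2 $ 1"
  by (auto simp: Gamma1_def cong_def)

lemma inv10D: "inv10 f \<Longrightarrow> A \<in> Gamma1 10 \<Longrightarrow> Im \<tau> > 0 \<Longrightarrow> f (mobius A \<tau>) = f \<tau>"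
  by (auto simp: inv10_def upper_half_plane_def)

lemma Gamma1_10_quotient:
  assumes A: "A \<in> SL2Z" and B: "B \<in> SL2Z" and eq: "key10 A = key10 B"
  shows "A ** adj2 B \<in> Gamma1 10"
proof -
  define G where "G = A ** adj2 B"
  have c: "[A $ 1 $ 1 = B $ 1 $ 1] (mod 10)" "[A $ 1 $ 2 = B $ 1 $ 2] (mod 10)"
    "[A $ 2 $ 1 = B $ 2 $ 1] (mod 10)" "[A $ 2 $ 2 = B $ 2 $ 2] (mod 10)"
    using eq by (auto simp: key10_def cong_def)
  have detB: "B $ 1 $ 1 * B $ 2 $ 2 - B $ 1 $ 2 * B $ 2 $ 1 = 1"
    using B by (simp add: SL2Z_iff)
  have "[A $ 1 $ 1 * B $ 2 $ 2 - A $ 1 $ 2 * B $ 2 $ 1 = B $ 1 $ 1 * B $ 2 $ 2 - B $ 1 $ 2 * B $ 2 $ 1] (mod 10)"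
    by (intro cong_diff cong_mult c cong_refl)
  then have 1: "[G $ 1 $ 1 = 1] (mod 10)" using detB by (simp add: G_def)
  have "[A $ 2 $ 2 * B $ 1 $ 1 - A $ 2 $ 1 * B $ 1 $ 2 = B $ 2 $ 2 * B $ 1 $ 1 - B $ 2 $ 1 * B $ 1 $ 2] (mod 10)"
    by (intro cong_diff cong_mult c cong_refl)
  then have 2: "[G $ 2 $ 2 = 1] (mod 10)" using detB by (simp add: G_def mult.commute)
  have "[A $ 2 $ 1 * B $ 2 $ 2 - A $ 2 $ 2 * B $ 2 $ 1 = B $ 2 $ 1 * B $ 2 $ 2 - B $ 2 $ 2 * B $ 2 $ 1] (mod 10)"
    by (intro cong_diff cong_mult c cong_refl)
  then have 3: "[G $ 2 $ 1 = 0] (mod 10)" by (simp add: G_def mult.commute)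
  show ?thesis
    using 1 2 3 A B unfolding G_def[symmetric] by (simp add: Gamma1_def) (simp add: G_def SL2Z_mult SL2Z_adj2)
qed

lemma mobius_quotient:
  assumes "B \<in> SL2Z" "Im \<tau> > 0"
  shows "mobius (A ** adj2 B) (mobius B \<tau>) = mobius A \<tau>"
  unfolding mobius_mult[OF SL2Z_adj2[OF assms(1)] Im_mobius_pos[OF assms]] mobius_adj2[OF assms] ..

lemma inv10_key10:
  assumes f: "inv10 f" and A: "A \<in> SL2Z" and B: "B \<in> SL2Z" and eq: "key10 A = key10 B" and \<tau>: "Im \<tau> > 0"
  shows "f (mobius A \<tau>) = f (mobius B \<tau>)"
  using inv10D[OF f Gamma1_10_quotient[OF A B eq] Im_mobius_pos[OF B \<tau>]] mobius_quotient[OF B \<tau>] by simp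

lemma key10_translate: "key10 (A ** mat2 1 (10 * n) 0 1) = key10 A"
proof -
  have "(x * (10 * n) + y) mod 10 = y mod 10" for x y :: int
  proof -
    have "x * (10 * n) + y = y + 10 * (x * n)" by simp
    then show ?thesis by (simp only: mod_mult_self2)
  qed
  then show ?thesis by (simp add: key10_def)
qed

lemma mobius_translate:
  assumes "Im \<tau> > 0"
  shows "mobius (A ** mat2 1 n 0 1) \<tau> = mobius A (\<tau> + of_int n)"
proof -
  have "mat2 1 n 0 1 \<in> SL2Z" by (simp add: SL2Z_iff)
  from mobius_mult[OF this assms] show ?thesis by (simp add: mobius_def)
qed

lemma translate_SL2Z: "A \<in> SL2Z \<Longrightarrow> A ** mat2 1 n 0 1 \<in> SL2Z"
  by (rule SL2Z_mult) (simp_all add: SL2Z_iff)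

lemma inv10_periodic:
  assumes "inv10 f" "A \<in> SL2Z" "Im \<tau> > 0"
  shows "f (mobius A (\<tau> + of_int (10 * n))) = f (mobius A \<tau>)"
proof -
  note key10_translate[of A n]
  then have "f (mobius (A ** mat2 1 (10 * n) 0 1) \<tau>) = f (mobius A \<tau>)"
    using assms by (intro inv10_key10 translate_SL2Z)
  then show ?thesis using mobius_translate[OF assms(3)] by simp
qed

text \<open>The determinant forces the lower right entry mod 10, and A and -A act in the same
  way.\<close>

lemma inv10_pm_Gamma1:
  assumes f: "inv10 f" and A: "A \<in> SL2Z" and pm: "pm_Gamma1 A" and \<tau>: "Im \<tau> > 0"
  shows "f (mobius A \<tau>) = f \<tau>"
proof -
  have pos: "f (mobius B \<tau>) = f \<tau>" if B: "B \<in> SL2Z" "10 dvd B $ 2 $ 1" "B $ 1 $ 1 mod 10 = 1" for B :: "int ^ 2 ^ 2"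
  proof -
    have "[B $ 1 $ 1 * B $ 2 $ 2 - B $ 1 $ 2 * B $ 2 $ 1 = 1 * B $ 2 $ 2 - B $ 1 $ 2 * 0] (mod 10)"
      using B by (intro cong_diff cong_mult cong_refl) (auto simp: cong_def)
    then have "[1 = B $ 2 $ 2] (mod 10)" using B(1) by (simp add: SL2Z_iff)
    then have "B \<in> Gamma1 10" using B by (simp add: Gamma1_10_iff cong_def)
    then show ?thesis using inv10D[OF f] \<tau> by simp
  qed
  show ?thesis
  proof (cases "A $ 1 $ 1 mod 10 = 1")
    case True
    then show ?thesis using pos[OF A] pm by (simp add: pm_Gamma1_def)
  next
    case False
    define B where "B = mat2 (- A $ 1 $ 1) (- A $ 1 $ 2) (- A $ 2 $ 1) (- A $ 2 $ 2)"
    have "A $ 1 $ 1 mod 10 = 9" using False pm by (simp add: pm_Gamma1_def)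
    then have "(- A $ 1 $ 1) mod 10 = 1" by presburger
    then have "f (mobius B \<tau>) = f \<tau>"
      using A pm by (intro pos) (auto simp: B_def SL2Z_iff pm_Gamma1_def)
    moreover have "mobius B \<tau> = mobius A \<tau>"
    proof -
      have "mobius B \<tau> = (- (of_int (A $ 1 $ 1) * \<tau> + of_int (A $ 1 $ 2))) / (- (of_int (A $ 2 $ 1) * \<tau> + of_int (A $ 2 $ 2)))"
        by (simp add: mobius_def B_def)
      also have "\<dots> = mobius A \<tau>" unfolding minus_divide_divide mobius_def ..
      finally show ?thesis .
    qed
    ultimately show ?thesis by simp
  qed
qed

lemma coset_representatives:
  obtains R where "finite R" "R \<subseteq> SL2Z" "\<And>A. A \<in> SL2Z \<Longrightarrow> \<exists>B\<in>R. key10 A = key10 B"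
proof -
  define R where "R = inv_into SL2Z key10 ` (key10 ` SL2Z)"
  have "finite (key10 ` SL2Z)"
    by (rule finite_subset[of _ "{0..<10} \<times> {0..<10} \<times> {0..<10} \<times> {0..<10}"]) (auto simp: key10_def)
  then have "finite R" by (simp add: R_def)
  moreover have "R \<subseteq> SL2Z" by (auto simp: R_def intro: inv_into_into)
  moreover have "\<exists>B\<in>R. key10 A = key10 B" if "A \<in> SL2Z" for A
    using that by (auto simp: R_def f_inv_into_f)
  ultimately show thesis by (rule that)
qed

section \<open>Expansions at the cusps\<close>

text \<open>A right inverse of \<tau> -> \<open>nome (\<tau> / h)\<close> on the punctured plane.
  The jump of the principal logarithm changes it by the period h, which h-periodic functions do not
  see.\<close>

definition tau_of :: "nat \<Rightarrow> complex \<Rightarrow> complex" where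
  "tau_of h t = of_nat h * Ln t / (2 * of_real pi * \<i>)"

lemma nome_tau_of: "t \<noteq> 0 \<Longrightarrow> h > 0 \<Longrightarrow> nome (tau_of h t / of_nat h) = t"
  by (simp add: nome_def tau_of_def)

lemma Im_gt_iff_norm_nome:
  assumes "h > (0::nat)"
  shows "Im \<tau> > Y \<longleftrightarrow> norm (nome (\<tau> / of_nat h)) < exp (- (2 * pi * Y / of_nat h))"
  using assms by (simp add: norm_nome Im_divide_of_nat field_simps)

lemma Im_tau_of_pos: "t \<noteq> 0 \<Longrightarrow> norm t < 1 \<Longrightarrow> h > 0 \<Longrightarrow> Im (tau_of h t) > 0"
  using Im_gt_iff_norm_nome[of h 0 "tau_of h t"] by (simp add: nome_tau_of)

lemma filterlim_tau_of:
  assumes "h > 0"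
  shows "filterlim (tau_of h) at_ii (at 0)"
  unfolding filterlim_def le_filter_def eventually_filtermap eventually_at_ii
proof safe
  fix P Y assume P: "\<forall>\<tau>. Y < Im \<tau> \<longrightarrow> P \<tau>"
  show "\<forall>\<^sub>F t in at 0. P (tau_of h t)"
    unfolding eventually_at
  proof (intro exI[of _ "exp (- (2 * pi * Y / of_nat h))"] conjI ballI impI)
    fix t :: complex assume "t \<noteq> 0 \<and> dist t 0 < exp (- (2 * pi * Y / of_nat h))"
    then show "P (tau_of h t)"
      using P assms by (simp add: Im_gt_iff_norm_nome[OF assms] nome_tau_of)
  qed simp
qed

text \<open>Near each t0 the branch cut is avoided by composing f with another local inverse of the
  covering, given by Ln(t / t0). The third conclusion exposes g as f after \<open>tau_of\<close>, so
  that bounds at i infinity transfer to t = 0.\<close>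

lemma periodic_factor:
  assumes hol: "f holomorphic_on upper_half_plane" and h: "h > (0::nat)"
    and per: "\<And>\<tau>. Im \<tau> > 0 \<Longrightarrow> f (\<tau> + of_nat h) = f \<tau>"
  obtains g where "g holomorphic_on ball 0 1 - {0}" "\<And>\<tau>. Im \<tau> > 0 \<Longrightarrow> f \<tau> = g (nome (\<tau> / of_nat h))"
    "\<And>t. g t = f (tau_of h t)"
proof -
  define g where "g = (\<lambda>t. f (tau_of h t))"
  have per': "f (\<tau> + of_int n * of_nat h) = f \<tau>" if "Im \<tau> > 0" for \<tau> n
  proof (induction n rule: int_induct[where k = 0])
    case (step1 i)
    then show ?case using per[of "\<tau> + of_int i * of_nat h"] that by (simp add: algebra_simps)
  next
    case (step2 i)
    then show ?case using per[of "\<tau> + of_int (i - 1) * of_nat h"] that by (simp add: algebra_simps)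
  qed auto
  have g: "f \<tau> = g (nome (\<tau> / of_nat h))" if \<tau>: "Im \<tau> > 0" for \<tau>
  proof -
    have "nome (tau_of h (nome (\<tau> / of_nat h)) / of_nat h) = nome (\<tau> / of_nat h)"
      using h by (intro nome_tau_of) auto
    then obtain n where "tau_of h (nome (\<tau> / of_nat h)) / of_nat h = \<tau> / of_nat h + of_int n"
      by (auto simp: nome_eq_iff)
    then have "tau_of h (nome (\<tau> / of_nat h)) = \<tau> + of_int n * of_nat h"
      using h by (simp add: field_simps)
    then show ?thesis using per'[OF \<tau>] by (simp add: g_def)
  qed
  have "g field_differentiable at t0" if t0: "t0 \<in> ball 0 1 - {0}" for t0
  proof -
    \<comment> \<open>The bound |t0| keeps t / t0 in the right half-plane, where Ln is holomorphic;
      the bound 1 - |t0| keeps t in the unit disc.\<close>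
    define r where "r = min (norm t0) (1 - norm t0)"
    have r: "r > 0" using t0 by (auto simp: r_def)
    define L where "L = (\<lambda>t. tau_of h t0 + of_nat h / (2 * of_real pi * \<i>) * Ln (t / t0))"
    have pos: "Re (t / t0) > 0" if "t \<in> ball t0 r" for t
    proof -
      have "norm (t / t0 - 1) < 1"
      proof -
        have "norm (t / t0 - 1) = norm (t - t0) / norm t0"
          using t0 by (simp add: norm_divide[symmetric] diff_divide_distrib)
        also have "\<dots> < 1" using that t0 by (simp add: r_def dist_norm norm_minus_commute)
        finally show ?thesis .
      qed
      moreover have "\<bar>Re (t / t0 - 1)\<bar> \<le> norm (t / t0 - 1)" by (rule abs_Re_le_cmod)
      moreover have "Re (t / t0 - 1) = Re (t / t0) - 1" by simp
      ultimately show ?thesis by linarith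
    qed
    have nomeL: "nome (L t / of_nat h) = t" if "t \<in> ball t0 r" for t
    proof -
      have "t / t0 \<noteq> 0" using pos[OF that] by auto
      have "nome (L t / of_nat h) = nome (tau_of h t0 / of_nat h) * nome (Ln (t / t0) / (2 * of_real pi * \<i>))"
        unfolding nome_add[symmetric] L_def using h by (simp add: add_divide_distrib)
      also have "nome (Ln (t / t0) / (2 * of_real pi * \<i>)) = t / t0"
        using \<open>t / t0 \<noteq> 0\<close> by (simp add: nome_def)
      finally show ?thesis using t0 h by (simp add: nome_tau_of)
    qed
    have ImL: "Im (L t) > 0" if "t \<in> ball t0 r" for t
    proof -
      have "norm t \<le> norm t0 + dist t0 t"
        using norm_triangle_ineq2[of t t0] by (simp add: dist_norm norm_minus_commute)
      also have "\<dots> < 1" using that by (simp add: r_def)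
      finally show ?thesis using Im_gt_iff_norm_nome[OF h, of 0 "L t"] nomeL[OF that] by simp
    qed
    have "L holomorphic_on ball t0 r"
      unfolding L_def using pos t0
      by (intro holomorphic_intros) (auto simp: complex_nonpos_Reals_iff dest!: pos simp flip: not_less)
    then have "(f \<circ> L) holomorphic_on ball t0 r"
      using ImL by (intro holomorphic_on_compose_gen[OF _ hol]) (auto simp: upper_half_plane_def)
    also have "?this \<longleftrightarrow> g holomorphic_on ball t0 r"
      using g ImL nomeL by (intro holomorphic_cong) auto
    finally show ?thesis using r by (auto intro: holomorphic_on_imp_differentiable_at)
  qed
  then have "g holomorphic_on ball 0 1 - {0}"
    unfolding holomorphic_on_def using field_differentiable_at_within by blast
  with g show thesis using that g_def by blast
qed

lemma periodic_factor_bounded: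
  assumes hol: "f holomorphic_on upper_half_plane" and h: "h > (0::nat)"
    and per: "\<And>\<tau>. Im \<tau> > 0 \<Longrightarrow> f (\<tau> + of_nat h) = f \<tau>" and bdd: "f \<in> O[at_ii](\<lambda>_. 1)"
  obtains g where "g holomorphic_on ball 0 1" "\<And>\<tau>. Im \<tau> > 0 \<Longrightarrow> f \<tau> = g (nome (\<tau> / of_nat h))"
proof -
  obtain g where g: "g holomorphic_on ball 0 1 - {0}" "\<And>\<tau>. Im \<tau> > 0 \<Longrightarrow> f \<tau> = g (nome (\<tau> / of_nat h))"
    "\<And>t. g t = f (tau_of h t)"
    using periodic_factor[OF hol h per] by blast
  obtain c where "\<forall>\<^sub>F \<tau> in at_ii. norm (f \<tau>) \<le> c * norm (1::complex)"
    using bdd by (elim landau_o.bigE)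
  then have "\<forall>\<^sub>F t in at 0. norm (g t) \<le> c"
    unfolding g(3) using eventually_compose_filterlim[OF _ filterlim_tau_of[OF h]] by simp
  then obtain g' where g': "g' holomorphic_on ball 0 1" "\<forall>t\<in>ball 0 1 - {0}. g' t = g t"
    using holomorphic_on_extend_bounded[OF g(1)] by auto
  have "f \<tau> = g' (nome (\<tau> / of_nat h))" if "Im \<tau> > 0" for \<tau>
    using that g(2) g'(2) Im_gt_iff_norm_nome[OF h, of 0 \<tau>] by simp
  with g'(1) show thesis by (rule that)
qed

text \<open>Each f(B \<tau>) extends to a function g B on the unit disc, for finitely many B. By
  reduction all values of f occur on closed discs of a fixed radius \<rho> < 1, so some g B0 attains
  the overall maximum in the interior of its disc and is constant.\<close>

lemma inv10_bounded_imp_const: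
  assumes hol: "f holomorphic_on upper_half_plane" and inv: "inv10 f"
    and bdd: "\<And>A. A \<in> SL2Z \<Longrightarrow> (\<lambda>\<tau>. f (mobius A \<tau>)) \<in> O[at_ii](\<lambda>_. 1)"
  obtains c where "\<And>\<tau>. Im \<tau> > 0 \<Longrightarrow> f \<tau> = c"
proof -
  obtain R where R: "finite R" "R \<subseteq> SL2Z" "\<And>A. A \<in> SL2Z \<Longrightarrow> \<exists>B\<in>R. key10 A = key10 B"
    using coset_representatives by blast
  have "mat2 1 0 0 1 \<in> SL2Z" by (simp add: SL2Z_iff)
  with R(3) have "R \<noteq> {}" by blast
  have "\<exists>g. g holomorphic_on ball 0 1 \<and> (\<forall>\<tau>. Im \<tau> > 0 \<longrightarrow> f (mobius B \<tau>) = g (nome (\<tau> / of_nat 10)))"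
    if "B \<in> R" for B
  proof -
    have B: "B \<in> SL2Z" using R that by auto
    show ?thesis
      using periodic_factor_bounded[OF holomorphic_on_mobius[OF hol B], of 10] inv10_periodic[OF inv B, of _ 1] bdd[OF B]
      by (metis (no_types, lifting) mult.right_neutral of_int_numeral of_nat_numeral zero_less_numeral)
  qed
  then obtain g where g: "\<And>B. B \<in> R \<Longrightarrow> g B holomorphic_on ball 0 1"
    "\<And>B \<tau>. B \<in> R \<Longrightarrow> Im \<tau> > 0 \<Longrightarrow> f (mobius B \<tau>) = g B (nome (\<tau> / of_nat 10))"
    by metis
  \<comment> \<open>The absolute value of \<open>nome (\<tau> / 10)\<close> on the line Im \<tau> =
    1/2 supplied by \<open>reduction_theory\<close>.\<close>
  define \<rho> where "\<rho> = exp (- (2 * pi * (1/2) / of_nat 10))"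
  have \<rho>: "0 < \<rho>" "\<rho> < 1" by (simp_all add: \<rho>_def)
  have "\<exists>t\<in>cball 0 \<rho>. \<forall>s\<in>cball 0 \<rho>. norm (g B s) \<le> norm (g B t)" if "B \<in> R" for B
  proof (rule continuous_attains_sup)
    have "continuous_on (ball 0 1) (g B)"
      using g(1)[OF that] by (rule holomorphic_on_imp_continuous_on)
    then have "continuous_on (cball 0 \<rho>) (g B)"
      by (rule continuous_on_subset) (use \<rho> in auto)
    then show "continuous_on (cball 0 \<rho>) (\<lambda>t. norm (g B t))"
      by (rule continuous_on_norm)
  qed (use \<rho> in auto)
  then obtain t where t: "\<And>B. B \<in> R \<Longrightarrow> t B \<in> cball 0 \<rho>"
    "\<And>B s. B \<in> R \<Longrightarrow> s \<in> cball 0 \<rho> \<Longrightarrow> norm (g B s) \<le> norm (g B (t B))"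
    by metis
  obtain B0 where B0: "B0 \<in> R" "\<And>B. B \<in> R \<Longrightarrow> norm (g B (t B)) \<le> norm (g B0 (t B0))"
  proof -
    have fin: "finite ((\<lambda>B. norm (g B (t B))) ` R)" "(\<lambda>B. norm (g B (t B))) ` R \<noteq> {}"
      using R(1) \<open>R \<noteq> {}\<close> by auto
    obtain B0 where "B0 \<in> R" "Max ((\<lambda>B. norm (g B (t B))) ` R) = norm (g B0 (t B0))"
      using Max_in[OF fin] by auto
    then show thesis using that[of B0] Max_ge[OF fin(1)] by (metis image_eqI)
  qed
  have B0': "B0 \<in> SL2Z" using B0 R by auto
  have le: "norm (f \<tau>) \<le> norm (g B0 (t B0))" if \<tau>: "Im \<tau> > 0" for \<tau>
  proof -
    obtain A \<tau>' where A: "A \<in> SL2Z" "Im \<tau>' \<ge> 1/2" "\<tau> = mobius A \<tau>'"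
      using reduction_theory[OF \<tau>] by blast
    obtain B where B: "B \<in> R" "key10 A = key10 B" using R(3)[OF A(1)] by blast
    have "f \<tau> = f (mobius B \<tau>')"
      unfolding A(3) using A B R by (intro inv10_key10[OF inv]) auto
    also have "\<dots> = g B (nome (\<tau>' / of_nat 10))" using A by (intro g(2)[OF B(1)]) auto
    finally have eq: "f \<tau> = g B (nome (\<tau>' / of_nat 10))" .
    have "norm (nome (\<tau>' / of_nat 10)) \<le> \<rho>"
      using A(2) unfolding \<rho>_def norm_nome by simp
    then have "norm (g B (nome (\<tau>' / of_nat 10))) \<le> norm (g B (t B))" by (intro t(2) B) auto
    with B0(2)[OF B(1)] eq show ?thesis by simp
  qed
  have "g B0 constant_on ball 0 1"
  proof (rule maximum_modulus_principle[OF g(1)[OF B0(1)], of "ball 0 1"])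
    show "t B0 \<in> ball 0 1" using t(1)[OF B0(1)] \<rho> by auto
    fix z :: complex assume z: "z \<in> ball 0 1"
    show "norm (g B0 z) \<le> norm (g B0 (t B0))"
    proof (cases "z = 0")
      case True
      then show ?thesis using \<rho> by (intro t(2) B0) auto
    next
      case False
      have "Im (tau_of 10 z) > 0" using False z by (intro Im_tau_of_pos) auto
      from le[OF Im_mobius_pos[OF B0' this]] g(2)[OF B0(1) this] show ?thesis
        using nome_tau_of[OF False, of 10] by simp
    qed
  qed auto
  then obtain c where c: "\<And>z. z \<in> ball 0 1 \<Longrightarrow> g B0 z = c" by (auto simp: constant_on_def)
  show thesis
  proof (rule that)
    fix \<tau> assume \<tau>: "Im \<tau> > 0"
    have p: "Im (mobius (adj2 B0) \<tau>) > 0" by (intro Im_mobius_pos SL2Z_adj2 B0' \<tau>)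
    have "f \<tau> = f (mobius B0 (mobius (adj2 B0) \<tau>))" using mobius_adj2[OF B0' \<tau>] by simp
    also have "\<dots> = g B0 (nome (mobius (adj2 B0) \<tau> / of_nat 10))" by (rule g(2)[OF B0(1) p])
    also have "\<dots> = c" using p by (intro c) (simp add: norm_nome_less_1 Im_divide_of_nat)
    finally show "f \<tau> = c" .
  qed
qed

text \<open>Order at least e. Unlike \<open>cusp_order\<close> this survives sums and cancellation,
  and it admits functions vanishing near the cusp.\<close>

definition cusp_ge :: "(complex \<Rightarrow> complex) \<Rightarrow> real \<Rightarrow> bool" where
  "cusp_ge f e \<longleftrightarrow> f \<in> O[at_ii](\<lambda>\<tau>. nome (of_real e * \<tau>))"

lemma cusp_ge_0_iff: "cusp_ge f 0 \<longleftrightarrow> f \<in> O[at_ii](\<lambda>_. 1)"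
  by (simp add: cusp_ge_def)

lemma cusp_ge_mono:
  assumes "cusp_ge f e" "e' \<le> e"
  shows "cusp_ge f e'"
proof -
  have "cusp_order (\<lambda>\<tau>. nome (of_real e * \<tau>)) e"
    by (auto simp: cusp_order_def intro!: exI[of _ 1])
  from cusp_order_bigo[OF this assms(2)] assms(1) show ?thesis
    unfolding cusp_ge_def by (rule landau_o.big_trans[rotated])
qed

lemma cusp_order_imp_ge: "cusp_order f e \<Longrightarrow> e' \<le> e \<Longrightarrow> cusp_ge f e'"
  unfolding cusp_ge_def by (rule cusp_order_bigo)

lemma cusp_ge_cong: "cusp_ge f e \<Longrightarrow> eventually (\<lambda>\<tau>. f \<tau> = g \<tau>) at_ii \<Longrightarrow> cusp_ge g e"
  unfolding cusp_ge_def by (subst (asm) landau_o.big.in_cong)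

lemma cusp_ge_mult:
  assumes "cusp_ge f e" "cusp_ge g e'"
  shows "cusp_ge (\<lambda>\<tau>. f \<tau> * g \<tau>) (e + e')"
proof -
  have "(\<lambda>\<tau>. f \<tau> * g \<tau>) \<in> O[at_ii](\<lambda>\<tau>. nome (of_real e * \<tau>) * nome (of_real e' * \<tau>))"
    using assms unfolding cusp_ge_def by (rule landau_o.big_mult)
  then show ?thesis unfolding cusp_ge_def by (simp add: ring_distribs nome_add)
qed

lemma cusp_ge_add: "cusp_ge f e \<Longrightarrow> cusp_ge g e \<Longrightarrow> cusp_ge (\<lambda>\<tau>. f \<tau> + g \<tau>) e"
  unfolding cusp_ge_def by (rule sum_in_bigo)

lemma cusp_ge_diff: "cusp_ge f e \<Longrightarrow> cusp_ge g e \<Longrightarrow> cusp_ge (\<lambda>\<tau>. f \<tau> - g \<tau>) e"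
  unfolding cusp_ge_def by (rule sum_in_bigo)

lemma cusp_ge_const: "e \<le> 0 \<Longrightarrow> cusp_ge (\<lambda>_. c) e"
  by (rule cusp_ge_mono[of _ 0]) (simp_all add: cusp_ge_0_iff)

lemma cusp_ge_power: "cusp_ge f e \<Longrightarrow> cusp_ge (\<lambda>\<tau>. f \<tau> ^ n) (of_nat n * e)"
proof (induction n)
  case (Suc n)
  then show ?case using cusp_ge_mult[of f e "\<lambda>\<tau>. f \<tau> ^ n" "of_nat n * e"] by (simp add: algebra_simps)
qed (simp add: cusp_ge_const)

lemma cusp_ge_nome: "cusp_ge (\<lambda>\<tau>. nome (of_real e * \<tau>)) e"
  by (simp add: cusp_ge_def)

lemma cusp_ge_0_poly:
  assumes "cusp_ge f 0"
  shows "cusp_ge (\<lambda>\<tau>. poly p (f \<tau>)) 0"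
proof (induction p)
  case (pCons a p)
  have "cusp_ge (\<lambda>\<tau>. a + f \<tau> * poly p (f \<tau>)) 0"
    using cusp_ge_mult[OF assms pCons(2)] by (intro cusp_ge_add cusp_ge_const) auto
  then show ?case by simp
qed (simp add: cusp_ge_const)

lemma cusp_ge_poly:
  assumes "cusp_ge f e"
  shows "\<exists>e'. cusp_ge (\<lambda>\<tau>. poly p (f \<tau>)) e'"
proof (induction p)
  case (pCons a p)
  then obtain e' where e': "cusp_ge (\<lambda>\<tau>. poly p (f \<tau>)) e'" by blast
  have "cusp_ge (\<lambda>\<tau>. f \<tau> * poly p (f \<tau>)) (min 0 (e + e'))"
    by (rule cusp_ge_mono[OF cusp_ge_mult[OF assms e']]) simp
  then have "cusp_ge (\<lambda>\<tau>. a + f \<tau> * poly p (f \<tau>)) (min 0 (e + e'))"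
    by (intro cusp_ge_add cusp_ge_const) auto
  then show ?case by auto
qed (auto intro: cusp_ge_const[of 0])

lemma filterlim_nome_at_0:
  assumes "h > (0::nat)"
  shows "filterlim (\<lambda>\<tau>. nome (\<tau> / of_nat h)) (at 0) at_ii"
  using nome_scaled_tendsto_0[of "1 / of_nat h"] assms
  by (intro filterlim_atI) (auto simp: field_simps)

text \<open>A zero of the expansion at t = 0 is worth one step 1/h in the order; this is how
  subtracting a leading term improves the bound.\<close>

lemma cusp_ge_factor:
  assumes "g holomorphic_on ball 0 1" "g 0 = 0" "h > 0"
  shows "cusp_ge (\<lambda>\<tau>. g (nome (\<tau> / of_nat h))) (1 / of_nat h)"
proof -
  obtain D where "(g has_field_derivative D) (at 0)"
    using assms(1) by (metis centre_in_ball holomorphic_on_open open_ball zero_less_one)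
  then have "((\<lambda>t. g t / t) \<longlongrightarrow> D) (at 0)"
    using assms(2) by (simp add: has_field_derivative_iff)
  from filterlim_compose[OF this filterlim_nome_at_0[OF assms(3)]]
  have "(\<lambda>\<tau>. g (nome (\<tau> / of_nat h))) \<in> O[at_ii](\<lambda>\<tau>. nome (\<tau> / of_nat h))"
    by (rule bigoI_tendsto) auto
  then show ?thesis by (simp add: cusp_ge_def field_simps)
qed

lemma inv10_translate:
  assumes "inv10 f" "Im \<tau> > 0"
  shows "f (\<tau> + 1) = f \<tau>"
  using inv10_pm_Gamma1[OF assms(1), of "mat2 1 1 0 1" \<tau>] assms(2)
  by (simp add: SL2Z_iff pm_Gamma1_def mobius_def)

lemma cusp_ge_pm_Gamma1:
  assumes "inv10 f" "A \<in> SL2Z" "pm_Gamma1 A" "cusp_ge f e"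
  shows "cusp_ge (\<lambda>\<tau>. f (mobius A \<tau>)) e"
  using assms(4)
  by (rule cusp_ge_cong)
     (use eventually_at_ii_gt[of 0] in eventually_elim, simp add: inv10_pm_Gamma1[OF assms(1-3)])

section \<open>Modular functions as rational functions of a Hauptmodul\<close>

text \<open>Up to equivalence x has one pole on the compactified quotient, a simple one at i
  infinity. The leading coefficient 1 lets leading terms be subtracted without division.\<close>

locale hauptmodul10 =
  fixes x :: "complex \<Rightarrow> complex"
  assumes x_hol: "x holomorphic_on upper_half_plane"
    and x_inv: "inv10 x"
    and x_lim: "((\<lambda>\<tau>. x \<tau> * nome \<tau>) \<longlongrightarrow> 1) at_ii"
    and x_bdd: "\<And>A. A \<in> SL2Z \<Longrightarrow> \<not> pm_Gamma1 A \<Longrightarrow> cusp_ge (\<lambda>\<tau>. x (mobius A \<tau>)) 0"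
begin

lemma x_nome_factor:
  obtains X where "X holomorphic_on ball 0 1" "X 0 = 1" "\<And>\<tau>. Im \<tau> > 0 \<Longrightarrow> x \<tau> * nome \<tau> = X (nome \<tau>)"
proof -
  have hol: "(\<lambda>\<tau>. x \<tau> * nome \<tau>) holomorphic_on upper_half_plane"
    by (intro holomorphic_intros x_hol)
  have per: "x (\<tau> + of_nat 1) * nome (\<tau> + of_nat 1) = x \<tau> * nome \<tau>" if "Im \<tau> > 0" for \<tau>
    using inv10_translate[OF x_inv that] by (simp add: nome_add)
  have bdd: "(\<lambda>\<tau>. x \<tau> * nome \<tau>) \<in> O[at_ii](\<lambda>_. 1)"
    by (rule bigoI_tendsto[of _ _ 1]) (use x_lim in simp_all)
  obtain X where X: "X holomorphic_on ball 0 1" "\<And>\<tau>. Im \<tau> > 0 \<Longrightarrow> x \<tau> * nome \<tau> = X (nome (\<tau> / of_nat 1))"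
    using periodic_factor_bounded[OF hol _ per bdd] by auto
  have "isCont X 0"
    using X(1) by (intro holomorphic_on_imp_continuous_on[THEN continuous_on_interior]) auto
  from isCont_tendsto_compose[OF this nome_tendsto_0] have "((\<lambda>\<tau>. X (nome \<tau>)) \<longlongrightarrow> X 0) at_ii" .
  moreover have "\<forall>\<^sub>F \<tau> in at_ii. X (nome \<tau>) = x \<tau> * nome \<tau>"
    using eventually_at_ii_gt[of 0] by eventually_elim (simp add: X)
  ultimately have "((\<lambda>\<tau>. x \<tau> * nome \<tau>) \<longlongrightarrow> X 0) at_ii"
    by (rule Lim_transform_eventually)
  with x_lim have "X 0 = 1" by (intro tendsto_unique[of at_ii]) auto
  with X show thesis by (intro that) auto
qed

lemma cusp_ge_x: "cusp_ge x (- 1)"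
  unfolding cusp_ge_def
  by (rule bigoI_tendsto[of _ _ 1]) (use x_lim in \<open>simp_all add: nome_uminus field_simps\<close>)

text \<open>Subtracting L x^m, with L the leading coefficient of f, lowers the pole at i infinity
  and keeps f bounded at the other cusps; without a pole f is constant. The degree bound is what
  later makes the relation for l linear fractional.\<close>

lemma polynomial_in_x:
  assumes "f holomorphic_on upper_half_plane" "inv10 f"
    and "\<And>A. A \<in> SL2Z \<Longrightarrow> \<not> pm_Gamma1 A \<Longrightarrow> cusp_ge (\<lambda>\<tau>. f (mobius A \<tau>)) 0"
    and "cusp_ge f (- of_nat n)"
  shows "\<exists>p. degree p \<le> n \<and> (\<forall>\<tau>. Im \<tau> > 0 \<longrightarrow> f \<tau> = poly p (x \<tau>))"
  using assms
proof (induction n arbitrary: f)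
  case 0
  have "cusp_ge (\<lambda>\<tau>. f (mobius A \<tau>)) 0" if "A \<in> SL2Z" for A
    using 0 that cusp_ge_pm_Gamma1[of f A 0] by (cases "pm_Gamma1 A") auto
  then obtain c where "\<And>\<tau>. Im \<tau> > 0 \<Longrightarrow> f \<tau> = c"
    using inv10_bounded_imp_const[OF 0(1,2)] unfolding cusp_ge_0_iff by blast
  then show ?case by (intro exI[of _ "[:c:]"]) auto
next
  case (Suc n)
  obtain X where X: "X holomorphic_on ball 0 1" "X 0 = 1" "\<And>\<tau>. Im \<tau> > 0 \<Longrightarrow> x \<tau> * nome \<tau> = X (nome \<tau>)"
    using x_nome_factor by blast
  define m where "m = Suc n"
  have hol: "(\<lambda>\<tau>. f \<tau> * nome (of_nat m * \<tau>)) holomorphic_on upper_half_plane"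
    by (intro holomorphic_intros Suc.prems)
  have per: "f (\<tau> + of_nat 1) * nome (of_nat m * (\<tau> + of_nat 1)) = f \<tau> * nome (of_nat m * \<tau>)" if "Im \<tau> > 0" for \<tau>
    using inv10_translate[OF Suc.prems(2) that] nome_of_int[of "int m"] by (simp add: ring_distribs nome_add)
  have "cusp_ge (\<lambda>\<tau>. f \<tau> * nome (of_real (of_nat m) * \<tau>)) (- of_nat m + of_nat m)"
    using Suc.prems(4) unfolding m_def by (intro cusp_ge_mult cusp_ge_nome)
  then have bdd: "(\<lambda>\<tau>. f \<tau> * nome (of_nat m * \<tau>)) \<in> O[at_ii](\<lambda>_. 1)"
    by (simp add: cusp_ge_0_iff)
  obtain G where G: "G holomorphic_on ball 0 1" "\<And>\<tau>. Im \<tau> > 0 \<Longrightarrow> f \<tau> * nome (of_nat m * \<tau>) = G (nome (\<tau> / of_nat 1))"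
    using periodic_factor_bounded[OF hol _ per bdd] by auto
  define L where "L = G 0"
  define f' where "f' = (\<lambda>\<tau>. f \<tau> - L * x \<tau> ^ m)"
  have hol': "f' holomorphic_on upper_half_plane"
    unfolding f'_def by (intro holomorphic_intros Suc.prems x_hol)
  have inv': "inv10 f'"
    using Suc.prems(2) x_inv by (simp add: inv10_def f'_def)
  have bdd': "cusp_ge (\<lambda>\<tau>. f' (mobius A \<tau>)) 0" if "A \<in> SL2Z" "\<not> pm_Gamma1 A" for A
    unfolding f'_def using Suc.prems(3)[OF that] cusp_ge_mult[OF cusp_ge_const[of 0 L] cusp_ge_power[OF x_bdd[OF that], of m]]
    by (intro cusp_ge_diff) auto
  have "cusp_ge f' (- of_nat n)"
  proof -
    \<comment> \<open>X 0 = 1, so this difference vanishes at t = 0. The period is 1, hence the gain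
      is a full order.\<close>
    have "cusp_ge (\<lambda>\<tau>. G (nome (\<tau> / of_nat 1)) - L * X (nome (\<tau> / of_nat 1)) ^ m) (1 / of_nat 1)"
      by (rule cusp_ge_factor) (auto intro!: holomorphic_intros G X simp: L_def X(2))
    moreover have "\<forall>\<^sub>F \<tau> in at_ii. G (nome (\<tau> / of_nat 1)) - L * X (nome (\<tau> / of_nat 1)) ^ m = f' \<tau> * nome (of_nat m * \<tau>)"
      using eventually_at_ii_gt[of 0]
    proof eventually_elim
      case (elim \<tau>)
      then show ?case
        using G(2)[OF elim] X(3)[OF elim, symmetric]
        by (simp add: f'_def algebra_simps power_mult_distrib nome_power)
    qed
    ultimately have "cusp_ge (\<lambda>\<tau>. f' \<tau> * nome (of_nat m * \<tau>)) 1"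
      by (auto intro: cusp_ge_cong)
    from cusp_ge_mult[OF this cusp_ge_nome[of "- of_nat m"]]
    have "cusp_ge (\<lambda>\<tau>. f' \<tau> * (nome (of_nat m * \<tau>) * nome (- of_nat m * \<tau>))) (- of_nat n)"
      by (simp add: m_def mult.assoc)
    then show ?thesis by (simp add: nome_uminus)
  qed
  then obtain p where p: "degree p \<le> n" "\<And>\<tau>. Im \<tau> > 0 \<Longrightarrow> f' \<tau> = poly p (x \<tau>)"
    using Suc.IH[OF hol' inv' bdd'] by blast
  show ?case
  proof (intro exI[of _ "p + monom L m"] conjI allI impI)
    show "degree (p + monom L m) \<le> Suc n"
      using p(1) degree_monom_le[of L m] unfolding m_def by (intro degree_add_le) auto
    show "f \<tau> = poly (p + monom L m) (x \<tau>)" if "Im \<tau> > 0" for \<tau>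
      using p(2)[OF that] by (simp add: f'_def poly_monom algebra_simps)
  qed
qed

lemma x_filterlim: "filterlim x at_infinity at_ii"
proof -
  have "((\<lambda>\<tau>. nome \<tau> / (x \<tau> * nome \<tau>)) \<longlongrightarrow> 0 / 1) at_ii"
    by (intro tendsto_divide nome_tendsto_0 x_lim) auto
  moreover have "nome \<tau> / (x \<tau> * nome \<tau>) = inverse (x \<tau>)" for \<tau>
    by (cases "x \<tau> = 0") (auto simp: field_simps)
  ultimately have lim: "((\<lambda>\<tau>. inverse (x \<tau>)) \<longlongrightarrow> 0) at_ii"
    by simp
  moreover have "\<forall>\<^sub>F \<tau> in at_ii. x \<tau> * nome \<tau> \<noteq> 0"
    by (rule tendsto_imp_eventually_ne[OF x_lim]) simp
  then have "\<forall>\<^sub>F \<tau> in at_ii. inverse (x \<tau>) \<noteq> 0" by eventually_elim auto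
  ultimately have "filterlim (\<lambda>\<tau>. inverse (x \<tau>)) (at 0) at_ii"
    by (simp add: filterlim_at)
  from filterlim_compose[OF filterlim_inverse_at_infinity this] show ?thesis by simp
qed

text \<open>A nonzero polynomial has bounded roots while x tends to infinity at i infinity, so p(x)
  is not identically 0 and its zeros are sparse.\<close>

lemma poly_x_nonzero:
  assumes "p \<noteq> 0"
  shows "\<forall>\<^sub>\<approx>\<tau>\<in>upper_half_plane. poly p (x \<tau>) \<noteq> 0"
proof -
  have hol: "(\<lambda>\<tau>. poly p (x \<tau>)) holomorphic_on upper_half_plane"
    by (intro poly_holomorphic_on x_hol)
  have "(\<forall>\<tau>\<in>upper_half_plane. poly p (x \<tau>) = 0) \<or> (\<forall>\<^sub>\<approx>\<tau>\<in>upper_half_plane. poly p (x \<tau>) \<noteq> 0)"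
  proof (rule nicely_meromorphic_imp_constant_or_avoid)
    show "(\<lambda>\<tau>. poly p (x \<tau>)) nicely_meromorphic_on upper_half_plane"
      using hol open_upper_half_plane by (intro analytic_on_imp_nicely_meromorphic_on) (simp add: analytic_on_open)
  qed (rule open_upper_half_plane connected_upper_half_plane)+
  moreover have "\<not> (\<forall>\<tau>\<in>upper_half_plane. poly p (x \<tau>) = 0)"
  proof
    assume 0: "\<forall>\<tau>\<in>upper_half_plane. poly p (x \<tau>) = 0"
    have fin: "finite {y. poly p y = 0}" using assms by (rule poly_roots_finite)
    then obtain M where M: "\<And>y. poly p y = 0 \<Longrightarrow> norm y \<le> M"
      using finite_imp_bounded[OF fin] by (auto simp: bounded_iff)
    have "\<forall>\<^sub>F \<tau> in at_ii. norm (x \<tau>) \<ge> M + 1"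
      using x_filterlim unfolding filterlim_at_infinity[OF order_refl]
      by (auto elim!: allE[of _ "max 1 (M + 1)"] eventually_mono)
    with eventually_at_ii_gt[of 0] have "\<forall>\<^sub>F \<tau> in at_ii. False"
    proof eventually_elim
      case (elim \<tau>)
      then show ?case using 0 M[of "x \<tau>"] by (auto simp: upper_half_plane_def)
    qed
    then show False by simp
  qed
  ultimately show ?thesis by blast
qed

end

section \<open>Poles on the upper half-plane and near the cusps\<close>

lemma bounded_near_imp_analytic:
  assumes g: "g meromorphic_on {p}" and bdd: "g \<in> O[at p](\<lambda>_. 1)"
  shows "remove_sings g analytic_on {p}"
proof -
  have iso: "isolated_singularity_at g p" and ess: "not_essential g p"
    using g by (auto simp: meromorphic_at_iff)
  obtain C where C: "\<forall>\<^sub>F w in at p. norm (g w) \<le> C * norm (1::complex)"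
    using bdd by (elim landau_o.bigE)
  have "\<not> is_pole g p"
  proof
    assume "is_pole g p"
    then have "\<forall>\<^sub>F w in at p. norm (g w) \<ge> max 1 (C + 1)"
      unfolding is_pole_def filterlim_at_infinity[OF order_refl]
      by (elim allE[of _ "max 1 (C + 1)"]) linarith
    with C have "\<forall>\<^sub>F w in at p. False" by eventually_elim auto
    then show False by simp
  qed
  then obtain c where "g \<midarrow>p\<rightarrow> c" using ess by (auto simp: not_essential_def)
  then show ?thesis by (rule remove_sings_analytic_at[OF iso])
qed

lemma meromorphic_times_power_bounded:
  assumes "g meromorphic_on {p}"
  obtains N :: nat where "(\<lambda>w. g w * (w - p) ^ N) \<in> O[at p](\<lambda>_. 1)"
proof -
  obtain F where F: "(\<lambda>w. g (p + w)) has_laurent_expansion F"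
    using assms by (auto simp: meromorphic_on_def)
  define N where "N = nat (- fls_subdegree F)"
  have "(\<lambda>w. g (p + w) * w ^ N) has_laurent_expansion F * fls_X_intpow (int N)"
    by (intro laurent_expansion_intros F)
  then have L: "(\<lambda>w. g (p + w) * (p + w - p) ^ N) has_laurent_expansion F * fls_X_intpow (int N)"
    by simp
  have "fls_subdegree (F * fls_X_intpow (int N)) \<ge> 0"
  proof (cases "F = 0")
    case False
    then show ?thesis by (subst fls_subdegree_mult) (auto simp: N_def)
  qed auto
  from has_laurent_expansion_imp_tendsto[OF L this]
  have "(\<lambda>w. g w * (w - p) ^ N) \<in> O[at p](\<lambda>_. 1)"
    by (intro bigoI_tendsto) auto
  then show thesis by (rule that)
qed

lemma mobius_analytic: "A \<in> SL2Z \<Longrightarrow> mobius A analytic_on upper_half_plane"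
  using mobius_holomorphic open_upper_half_plane by (simp add: analytic_on_open)

lemma meromorphic_mobius:
  assumes "f meromorphic_on upper_half_plane" "A \<in> SL2Z"
  shows "(\<lambda>\<tau>. f (mobius A \<tau>)) meromorphic_on upper_half_plane"
  using meromorphic_on_compose[OF assms(1) mobius_analytic[OF assms(2)]] mobius_in_H[OF assms(2)] by blast

lemma eventually_in_H: "Im \<tau> > 0 \<Longrightarrow> \<forall>\<^sub>F w in nhds \<tau>. Im w > 0"
  using eventually_nhds_in_open[OF open_upper_half_plane, of \<tau>] by (simp add: upper_half_plane_def)

lemma analytic_mobius:
  assumes "A \<in> SL2Z" "Im \<tau> > 0" "f analytic_on {mobius A \<tau>}"
  shows "(\<lambda>\<tau>. f (mobius A \<tau>)) analytic_on {\<tau>}"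
proof -
  have "mobius A analytic_on {\<tau>}"
    using assms by (intro analytic_on_subset[OF mobius_analytic]) (auto simp: upper_half_plane_def)
  then have "(f \<circ> mobius A) analytic_on {\<tau>}"
    using assms(3) by (intro analytic_on_compose) auto
  then show ?thesis by (simp add: o_def)
qed

lemma analytic_mobius_cancel:
  assumes A: "A \<in> SL2Z" and \<tau>: "Im \<tau> > 0" and an: "(\<lambda>\<tau>. f (mobius A \<tau>)) analytic_on {\<tau>}"
  shows "f analytic_on {mobius A \<tau>}"
proof -
  have "(\<lambda>w. f (mobius A (mobius (adj2 A) w))) analytic_on {mobius A \<tau>}"
    using analytic_mobius[OF SL2Z_adj2[OF A] Im_mobius_pos[OF A \<tau>], of "\<lambda>\<tau>. f (mobius A \<tau>)"] an
      mobius_adj2[OF A \<tau>] by simp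
  also have "?this \<longleftrightarrow> ?thesis"
    using eventually_in_H[OF Im_mobius_pos[OF A \<tau>]]
    by (intro analytic_at_cong) (auto elim!: eventually_mono simp: mobius_adj2[OF A])
  finally show ?thesis .
qed

lemma filterlim_mobius_at:
  assumes A: "A \<in> SL2Z" and \<tau>: "Im \<tau> > 0"
  shows "filterlim (mobius A) (at (mobius A \<tau>)) (at \<tau>)"
proof (rule filterlim_atI)
  have "isCont (mobius A) \<tau>"
    using \<tau> by (intro analytic_at_imp_isCont analytic_on_subset[OF mobius_analytic[OF A]])
      (auto simp: upper_half_plane_def)
  then show "(mobius A \<longlongrightarrow> mobius A \<tau>) (at \<tau>)" by (simp add: isCont_def)
  have "\<forall>\<^sub>F w in at \<tau>. Im w > 0"
    using eventually_in_H[OF \<tau>] by (simp add: eventually_nhds_conv_at)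
  moreover have "\<forall>\<^sub>F w in at \<tau>. w \<noteq> \<tau>" by (simp add: eventually_at_filter)
  ultimately show "\<forall>\<^sub>F w in at \<tau>. mobius A w \<noteq> mobius A \<tau>"
    by eventually_elim (metis mobius_adj2(1)[OF A] \<tau>)
qed

text \<open>A pole of g at 0 of order at most N gives the bound e = -N/h. As the singularity is
  isolated, g is analytic in a punctured disc, so f(A \<tau>) has no poles high up.\<close>

lemma meromorphic_at_cuspsD:
  assumes "meromorphic_at_cusps f" "A \<in> SL2Z"
  shows "\<exists>e. cusp_ge (\<lambda>\<tau>. f (mobius A \<tau>)) e"
    and "\<exists>Y. \<forall>\<tau>. Im \<tau> > Y \<longrightarrow> (\<lambda>\<tau>. f (mobius A \<tau>)) analytic_on {\<tau>}"
proof -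
  obtain h g y where h: "h > (0::nat)" and g: "g meromorphic_on {0}"
    and eq: "\<And>\<tau>. Im \<tau> > y \<Longrightarrow> f (mobius A \<tau>) = g (nome (\<tau> / of_nat h))"
    using assms unfolding meromorphic_at_cusps_def by blast
  have ev: "\<forall>\<^sub>F \<tau> in at_ii. g (nome (\<tau> / of_nat h)) = f (mobius A \<tau>)"
    using eventually_at_ii_gt[of y] by eventually_elim (simp add: eq)
  obtain N :: nat where "(\<lambda>w. g w * (w - 0) ^ N) \<in> O[at 0](\<lambda>_. 1)"
    using meromorphic_times_power_bounded[OF g] by blast
  from landau_o.big.compose[OF this filterlim_nome_at_0[OF h]]
  have "cusp_ge (\<lambda>\<tau>. g (nome (\<tau> / of_nat h)) * nome (\<tau> / of_nat h) ^ N) 0"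
    by (simp add: cusp_ge_0_iff)
  from cusp_ge_mult[OF this cusp_ge_nome[of "- (of_nat N / of_nat h)"]]
  have "cusp_ge (\<lambda>\<tau>. g (nome (\<tau> / of_nat h)) * (nome (\<tau> / of_nat h) ^ N * nome (of_real (- (of_nat N / of_nat h)) * \<tau>)))
      (- (of_nat N / of_nat h))"
    by (simp add: mult.assoc)
  also have "(\<lambda>\<tau>. g (nome (\<tau> / of_nat h)) * (nome (\<tau> / of_nat h) ^ N * nome (of_real (- (of_nat N / of_nat h)) * \<tau>)))
      = (\<lambda>\<tau>. g (nome (\<tau> / of_nat h)))"
    unfolding nome_power nome_add[symmetric] by simp
  finally show "\<exists>e. cusp_ge (\<lambda>\<tau>. f (mobius A \<tau>)) e"
    using ev by (blast intro: cusp_ge_cong)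
  obtain r where r: "r > 0" "g analytic_on ball 0 r - {0}"
    using g by (auto simp: meromorphic_at_iff isolated_singularity_at_def)
  have "\<forall>\<^sub>F t in at 0. t \<in> ball 0 r - {0}"
    using r by (intro eventually_at_in_open) auto
  from eventually_compose_filterlim[OF this filterlim_nome_at_0[OF h]]
  obtain Y where Y: "\<And>\<tau>. Im \<tau> > Y \<Longrightarrow> nome (\<tau> / of_nat h) \<in> ball 0 r - {0}"
    by (auto simp: eventually_at_ii)
  let ?S = "{\<tau>. Im \<tau> > max y Y}"
  have "(g \<circ> (\<lambda>\<tau>. nome (\<tau> / of_nat h))) holomorphic_on ?S"
    using r(2) Y by (intro holomorphic_on_compose_gen[OF _ analytic_imp_holomorphic[OF r(2)]] holomorphic_intros) auto
  also have "?this \<longleftrightarrow> (\<lambda>\<tau>. f (mobius A \<tau>)) holomorphic_on ?S"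
    by (intro holomorphic_cong) (auto simp: eq)
  finally have "(\<lambda>\<tau>. f (mobius A \<tau>)) analytic_on ?S"
    by (subst analytic_on_open) (simp_all only: open_halfspace_Im_gt)
  then show "\<exists>Y. \<forall>\<tau>. Im \<tau> > Y \<longrightarrow> (\<lambda>\<tau>. f (mobius A \<tau>)) analytic_on {\<tau>}"
    by (intro exI[of _ "max y Y"]) (auto intro: analytic_on_subset)
qed

text \<open>The fundamental domain meets only finitely many poles, by compactness away from the cusps.\<close>

lemma finite_pole_representatives:
  assumes mero: "f meromorphic_on upper_half_plane" and inv: "inv10 f" and cusps: "meromorphic_at_cusps f"
  obtains Z where "finite Z" "Z \<subseteq> upper_half_plane"
    "\<And>p. Im p > 0 \<Longrightarrow> \<not> f analytic_on {p} \<Longrightarrow> \<exists>z\<in>Z. \<exists>G\<in>Gamma1 10. p = mobius G z"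
proof -
  obtain R where R: "finite R" "R \<subseteq> SL2Z" "\<And>A. A \<in> SL2Z \<Longrightarrow> \<exists>B\<in>R. key10 A = key10 B"
    using coset_representatives by blast
  have "\<forall>B\<in>R. \<exists>Y. \<forall>\<tau>. Im \<tau> > Y \<longrightarrow> (\<lambda>\<tau>. f (mobius B \<tau>)) analytic_on {\<tau>}"
    using meromorphic_at_cuspsD(2)[OF cusps] R by blast
  then obtain Y where Y: "\<And>B \<tau>. B \<in> R \<Longrightarrow> Im \<tau> > Y B \<Longrightarrow> (\<lambda>\<tau>. f (mobius B \<tau>)) analytic_on {\<tau>}"
    by metis
  \<comment> \<open>Width 10 is the period of f(B \<tau>), height 1/2 comes from
    \<open>reduction_theory\<close>, and above Y B there are no poles.\<close>
  define K where "K = (\<lambda>B. cbox (Complex 0 (1/2)) (Complex 10 (Y B)))"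
  have K: "K B \<subseteq> upper_half_plane" for B
    by (auto simp: K_def in_cbox_complex_iff upper_half_plane_def)
  define S where "S = (\<lambda>B. K B \<inter> {\<tau>. \<not> (\<lambda>\<tau>. f (mobius B \<tau>)) analytic_on {\<tau>}})"
  have fin: "finite (S B)" if "B \<in> R" for B
    unfolding S_def
  proof (rule sparse_in_compact_finite)
    show "compact (K B)" by (simp add: K_def)
    have "(\<lambda>\<tau>. f (mobius B \<tau>)) meromorphic_on K B"
      using meromorphic_mobius[OF mero, of B] that R K by (blast intro: meromorphic_on_subset)
    then show "{\<tau>. \<not> (\<lambda>\<tau>. f (mobius B \<tau>)) analytic_on {\<tau>}} sparse_in K B"
      by (rule meromorphic_on_imp_sparse_singularities)
  qed
  define Z where "Z = (\<Union>B\<in>R. mobius B ` S B)"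
  show thesis
  proof (rule that)
    show "finite Z" unfolding Z_def using fin R(1) by blast
    show "Z \<subseteq> upper_half_plane"
      using K R(2) unfolding Z_def S_def by (auto intro!: mobius_in_H)
    fix p assume p: "Im p > 0" "\<not> f analytic_on {p}"
    obtain A \<tau> where A: "A \<in> SL2Z" "Im \<tau> \<ge> 1/2" "p = mobius A \<tau>"
      using reduction_theory[OF p(1)] by blast
    obtain B where B: "B \<in> R" "key10 A = key10 B" using R(3)[OF A(1)] by blast
    have B': "B \<in> SL2Z" using B R by auto
    \<comment> \<open>Translation by a multiple of 10 brings the real part into [0, 10] without
      changing the key of A.\<close>
    define n where "n = \<lfloor>Re \<tau> / 10\<rfloor>"
    define \<tau>' where "\<tau>' = \<tau> - of_int (10 * n)"
    have \<tau>': "Im \<tau>' \<ge> 1/2" "Im \<tau>' > 0" using A(2) by (auto simp: \<tau>'_def)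
    have re: "0 \<le> Re \<tau>'" "Re \<tau>' \<le> 10"
    proof -
      have "of_int n \<le> Re \<tau> / 10" "Re \<tau> / 10 < of_int n + 1" unfolding n_def by linarith+
      then show "0 \<le> Re \<tau>'" "Re \<tau>' \<le> 10" by (simp_all add: \<tau>'_def)
    qed
    define G where "G = (A ** mat2 1 (10 * n) 0 1) ** adj2 B"
    have G: "G \<in> Gamma1 10"
      unfolding G_def using A B B' by (intro Gamma1_10_quotient translate_SL2Z) (simp_all add: key10_translate)
    have pG: "p = mobius G (mobius B \<tau>')"
      unfolding G_def mobius_quotient[OF B' \<tau>'(2)] mobius_translate[OF \<tau>'(2)] A(3) by (simp add: \<tau>'_def)
    have "\<not> (\<lambda>\<tau>. f (mobius B \<tau>)) analytic_on {\<tau>'}"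
    proof
      assume "(\<lambda>\<tau>. f (mobius B \<tau>)) analytic_on {\<tau>'}"
      then have 1: "f analytic_on {mobius B \<tau>'}" by (rule analytic_mobius_cancel[OF B' \<tau>'(2)])
      have H: "Im (mobius B \<tau>') > 0" by (rule Im_mobius_pos[OF B' \<tau>'(2)])
      have "(\<lambda>\<tau>. f (mobius G \<tau>)) analytic_on {mobius B \<tau>'} \<longleftrightarrow> f analytic_on {mobius B \<tau>'}"
        using eventually_in_H[OF H]
        by (intro analytic_at_cong) (auto elim!: eventually_mono simp: inv10D[OF inv G])
      with 1 have "f analytic_on {mobius G (mobius B \<tau>')}"
        using G H by (intro analytic_mobius_cancel[of G "mobius B \<tau>'"]) (auto simp: Gamma1_10_iff)
      with p(2) pG show False by simp
    qed
    moreover from this have "Im \<tau>' \<le> Y B" using Y[OF B(1), of \<tau>'] by (meson not_le)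
    ultimately have "\<tau>' \<in> S B" using re \<tau>' by (auto simp: S_def K_def in_cbox_complex_iff)
    then show "\<exists>z\<in>Z. \<exists>G\<in>Gamma1 10. p = mobius G z"
      unfolding Z_def using B(1) G pG by blast
  qed
qed

lemma pm_Gamma1_key10: "key10 A = key10 B \<Longrightarrow> pm_Gamma1 A \<longleftrightarrow> pm_Gamma1 B"
  by (auto simp: key10_def pm_Gamma1_def dvd_eq_mod_eq_0)

context hauptmodul10
begin

text \<open>x - x(z) vanishes at z at least to first order, so its powers absorb the pole of
  f.\<close>

lemma x_minus_value_pole:
  assumes "f meromorphic_on {z}" "Im z > 0"
  obtains N :: nat where "(\<lambda>w. f w * (x w - x z) ^ N) \<in> O[at z](\<lambda>_. 1)"
proof -
  obtain N :: nat where N: "(\<lambda>w. f w * (w - z) ^ N) \<in> O[at z](\<lambda>_. 1)"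
    using meromorphic_times_power_bounded[OF assms(1)] by blast
  obtain D where "(x has_field_derivative D) (at z)"
    using x_hol assms(2) open_upper_half_plane by (auto simp: holomorphic_on_open upper_half_plane_def)
  then have "((\<lambda>w. (x w - x z) / (w - z)) \<longlongrightarrow> D) (at z)"
    by (simp add: has_field_derivative_iff)
  then have "(\<lambda>w. (x w - x z) / (w - z)) \<in> O[at z](\<lambda>_. 1)"
    by (intro bigoI_tendsto) auto
  from landau_o.big_mult[OF N landau_o.big_power[OF this, of N]]
  have "(\<lambda>w. f w * (w - z) ^ N * ((x w - x z) / (w - z)) ^ N) \<in> O[at z](\<lambda>_. 1)" by simp
  also have "?this \<longleftrightarrow> (\<lambda>w. f w * (x w - x z) ^ N) \<in> O[at z](\<lambda>_. 1)"
    by (intro landau_o.big.in_cong) (auto simp: eventually_at_filter power_divide)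
  finally show thesis by (rule that)
qed

text \<open>At a cusp not equivalent to i infinity x has a finite value, and the difference from it
  has order at least 1/10 because 10 is a period. So N \<ge> 10 |e| factors suffice.\<close>

lemma x_minus_value_cusp:
  assumes B: "B \<in> SL2Z" "\<not> pm_Gamma1 B" and f: "cusp_ge (\<lambda>\<tau>. f (mobius B \<tau>)) e"
  shows "\<exists>c. \<exists>N::nat. cusp_ge (\<lambda>\<tau>. f (mobius B \<tau>) * (x (mobius B \<tau>) - c) ^ N) 0"
proof -
  have per: "x (mobius B (\<tau> + of_nat 10)) = x (mobius B \<tau>)" if "Im \<tau> > 0" for \<tau>
    using inv10_periodic[OF x_inv B(1) that, of 1] by simp
  obtain X where X: "X holomorphic_on ball 0 1" "\<And>\<tau>. Im \<tau> > 0 \<Longrightarrow> x (mobius B \<tau>) = X (nome (\<tau> / of_nat 10))"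
    using periodic_factor_bounded[OF holomorphic_on_mobius[OF x_hol B(1)] _ per] x_bdd[OF B]
    unfolding cusp_ge_0_iff by auto
  have "cusp_ge (\<lambda>\<tau>. X (nome (\<tau> / of_nat 10)) - X 0) (1 / of_nat 10)"
    by (rule cusp_ge_factor) (auto intro!: holomorphic_intros X)
  then have "cusp_ge (\<lambda>\<tau>. x (mobius B \<tau>) - X 0) (1 / of_nat 10)"
    by (rule cusp_ge_cong) (use eventually_at_ii_gt[of 0] in eventually_elim, simp add: X)
  then have 1: "cusp_ge (\<lambda>\<tau>. (x (mobius B \<tau>) - X 0) ^ N) (of_nat N * (1 / of_nat 10))" for N
    by (rule cusp_ge_power)
  define N where "N = nat \<lceil>10 * \<bar>e\<bar>\<rceil>"
  have "of_nat N \<ge> 10 * \<bar>e\<bar>" unfolding N_def by linarith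
  then have "0 \<le> e + of_nat N * (1 / of_nat 10)" by simp
  from cusp_ge_mono[OF cusp_ge_mult[OF f 1[of N]] this] show ?thesis by blast
qed

text \<open>Finitely many factors x - x(z) and x - c B multiply to a polynomial q(x) clearing every
  pole of f in the upper half-plane and every pole at cusps other than i infinity. What remains is a
  polynomial in x.\<close>

theorem modular_function_rational:
  assumes "f \<in> modular_functions (Gamma1 10)"
  obtains p q where "q \<noteq> 0" "\<forall>\<^sub>\<approx>\<tau>\<in>upper_half_plane. poly q (x \<tau>) \<noteq> 0 \<and> f \<tau> = poly p (x \<tau>) / poly q (x \<tau>)"
proof -
  have mero: "f meromorphic_on upper_half_plane" and inv: "inv10 f" and cusps: "meromorphic_at_cusps f"
    using assms by (auto simp: modular_functions_def nicely_meromorphic_on_def inv10_def)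
  obtain R where R: "finite R" "R \<subseteq> SL2Z" "\<And>A. A \<in> SL2Z \<Longrightarrow> \<exists>B\<in>R. key10 A = key10 B"
    using coset_representatives by blast
  obtain Z where Z: "finite Z" "Z \<subseteq> upper_half_plane"
    "\<And>p. Im p > 0 \<Longrightarrow> \<not> f analytic_on {p} \<Longrightarrow> \<exists>z\<in>Z. \<exists>G\<in>Gamma1 10. p = mobius G z"
    using finite_pole_representatives[OF mero inv cusps] by blast
  have "\<exists>N::nat. (\<lambda>w. f w * (x w - x z) ^ N) \<in> O[at z](\<lambda>_. 1)" if "z \<in> Z" for z
  proof -
    have "f meromorphic_on {z}" "Im z > 0"
      using Z(2) that by (auto simp: upper_half_plane_def intro!: meromorphic_on_subset[OF mero])
    then show ?thesis by (metis x_minus_value_pole)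
  qed
  then obtain N where N: "\<And>z. z \<in> Z \<Longrightarrow> (\<lambda>w. f w * (x w - x z) ^ N z) \<in> O[at z](\<lambda>_. 1)"
    by metis
  define R' where "R' = {B\<in>R. \<not> pm_Gamma1 B}"
  have "\<exists>c. \<exists>M::nat. cusp_ge (\<lambda>\<tau>. f (mobius B \<tau>) * (x (mobius B \<tau>) - c) ^ M) 0" if "B \<in> R'" for B
    using x_minus_value_cusp[of B f] meromorphic_at_cuspsD(1)[OF cusps, of B] that R(2) unfolding R'_def by blast
  then obtain c M where M: "\<And>B. B \<in> R' \<Longrightarrow> cusp_ge (\<lambda>\<tau>. f (mobius B \<tau>) * (x (mobius B \<tau>) - c B) ^ M B) 0"
    by metis
  \<comment> \<open>Equal factors coincide in this set and enter q once. This is enough, since each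
    bound needs only that its own factor divides q.\<close>
  define S where "S = (\<lambda>z. [:- x z, 1:] ^ N z) ` Z \<union> (\<lambda>B. [:- c B, 1:] ^ M B) ` R'"
  define q where "q = (\<Prod>s\<in>S. s)"
  have S: "finite S" "0 \<notin> S" using Z(1) R(1) by (auto simp: S_def R'_def)
  then have q0: "q \<noteq> 0" by (simp add: q_def)
  have dvd: "s dvd q" if "s \<in> S" for s
    unfolding q_def by (rule dvd_prodI[OF S(1) that])
  define g where "g = (\<lambda>\<tau>. f \<tau> * poly q (x \<tau>))"
  have g_inv: "inv10 g" using inv x_inv by (simp add: g_def inv10_def)
  have qx: "(\<lambda>\<tau>. poly p (x \<tau>)) analytic_on upper_half_plane" for p
    using open_upper_half_plane by (simp add: analytic_on_open poly_holomorphic_on x_hol)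
  have qx_O: "(\<lambda>\<tau>. poly p (x \<tau>)) \<in> O[at z](\<lambda>_. 1)" if "Im z > 0" for p z
  proof -
    have "isCont (\<lambda>\<tau>. poly p (x \<tau>)) z"
      using that by (intro analytic_at_imp_isCont analytic_on_subset[OF qx]) (auto simp: upper_half_plane_def)
    then show ?thesis by (intro bigoI_tendsto) (auto simp: isCont_def)
  qed
  have g_mero: "g meromorphic_on upper_half_plane"
    unfolding g_def by (intro meromorphic_intros mero analytic_on_imp_meromorphic_on qx)
  have bdd_Z: "g \<in> O[at z](\<lambda>_. 1)" if "z \<in> Z" for z
  proof -
    have "[:- x z, 1:] ^ N z \<in> S" using that by (simp add: S_def)
    then obtain q' where q': "q = [:- x z, 1:] ^ N z * q'"
      using dvd by (blast elim: dvdE)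
    have "Im z > 0" using that Z(2) by (auto simp: upper_half_plane_def)
    from landau_o.big_mult[OF N[OF that] qx_O[OF this, of q']]
    show ?thesis by (simp add: g_def q' mult.assoc)
  qed
  have bdd: "g \<in> O[at p](\<lambda>_. 1)" if p: "Im p > 0" for p
  proof (cases "f analytic_on {p}")
    case True
    have "isCont f p" using True by (rule analytic_at_imp_isCont)
    then have "f \<in> O[at p](\<lambda>_. 1)" by (intro bigoI_tendsto) (auto simp: isCont_def)
    from landau_o.big_mult[OF this qx_O[OF p, of q]] show ?thesis by (simp add: g_def)
  next
    case False
    then obtain z G where z: "z \<in> Z" "G \<in> Gamma1 10" "p = mobius G z" using Z(3) p by blast
    have Imz: "Im z > 0" using z Z(2) by (auto simp: upper_half_plane_def)
    have G: "G \<in> SL2Z" using z by (simp add: Gamma1_10_iff)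
    have "mobius (adj2 G) p = z" using mobius_adj2[OF G Imz] z by simp
    then have "filterlim (mobius (adj2 G)) (at z) (at p)"
      using filterlim_mobius_at[OF SL2Z_adj2[OF G] p] by simp
    from landau_o.big.compose[OF bdd_Z[OF z(1)] this]
    have "(\<lambda>w. g (mobius (adj2 G) w)) \<in> O[at p](\<lambda>_. 1)" .
    also have "?this \<longleftrightarrow> ?thesis"
    proof (intro landau_o.big.in_cong)
      have "\<forall>\<^sub>F w in at p. Im w > 0"
        using eventually_in_H[OF p] by (simp add: eventually_nhds_conv_at)
      then show "\<forall>\<^sub>F w in at p. g (mobius (adj2 G) w) = g w"
      proof eventually_elim
        case (elim w)
        from inv10D[OF g_inv z(2) Im_mobius_pos[OF SL2Z_adj2[OF G] elim]] show ?case
          by (simp add: mobius_adj2[OF G elim])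
      qed
    qed
    finally show ?thesis .
  qed
  \<comment> \<open>g is bounded near every point but may have wrong values at former poles of f;
    removing the singularities makes it holomorphic.\<close>
  define f1 where "f1 = remove_sings g"
  have f1_an: "f1 analytic_on {p}" if "Im p > 0" for p
    unfolding f1_def using that bdd[OF that]
    by (intro bounded_near_imp_analytic meromorphic_on_subset[OF g_mero]) (auto simp: upper_half_plane_def)
  then have f1_hol: "f1 holomorphic_on upper_half_plane"
    by (intro analytic_imp_holomorphic) (subst analytic_on_analytic_at, auto simp: upper_half_plane_def)
  have f1_at: "\<forall>\<^sub>F w in at p. f1 w = g w" if "Im p > 0" for p
    unfolding f1_def
    using that
    by (intro eventually_remove_sings_eq_at meromorphic_on_isolated_singularity meromorphic_on_subset[OF g_mero])
       (auto simp: upper_half_plane_def)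
  have f1_inv: "inv10 f1"
    unfolding inv10_def
  proof (intro ballI)
    fix G \<tau> assume G: "G \<in> Gamma1 10" and "\<tau> \<in> upper_half_plane"
    then have \<tau>: "Im \<tau> > 0" by (simp add: upper_half_plane_def)
    have G': "G \<in> SL2Z" using G by (simp add: Gamma1_10_iff)
    have lim: "filterlim (mobius G) (at (mobius G \<tau>)) (at \<tau>)" by (rule filterlim_mobius_at[OF G' \<tau>])
    have "isCont f1 (mobius G \<tau>)" "isCont f1 \<tau>"
      by (intro analytic_at_imp_isCont f1_an Im_mobius_pos G' \<tau>)+
    then have l1: "f1 \<midarrow>mobius G \<tau>\<rightarrow> f1 (mobius G \<tau>)" and l2: "f1 \<midarrow>\<tau>\<rightarrow> f1 \<tau>"
      by (simp_all add: isCont_def)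
    have "\<forall>\<^sub>F w in at \<tau>. f1 (mobius G w) = g (mobius G w)"
      by (rule eventually_compose_filterlim[OF f1_at lim]) (intro Im_mobius_pos G' \<tau>)
    moreover have "\<forall>\<^sub>F w in at \<tau>. Im w > 0"
      using eventually_in_H[OF \<tau>] by (simp add: eventually_nhds_conv_at)
    ultimately have "\<forall>\<^sub>F w in at \<tau>. f1 (mobius G w) = f1 w"
      using f1_at[OF \<tau>] by eventually_elim (simp add: inv10D[OF g_inv G])
    with filterlim_compose[OF l1 lim] have "f1 \<midarrow>\<tau>\<rightarrow> f1 (mobius G \<tau>)"
      by (rule Lim_transform_eventually)
    with l2 show "f1 (mobius G \<tau>) = f1 \<tau>" by (intro tendsto_unique[of "at \<tau>"]) auto
  qed
  \<comment> \<open>High up f(A \<tau>) is analytic, so no value of g was changed there and the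
    growth bounds carry over to f1.\<close>
  have f1_cusp: "\<forall>\<^sub>F \<tau> in at_ii. g (mobius A \<tau>) = f1 (mobius A \<tau>)" if A: "A \<in> SL2Z" for A
  proof -
    obtain Y where Y: "\<And>\<tau>. Im \<tau> > Y \<Longrightarrow> (\<lambda>\<tau>. f (mobius A \<tau>)) analytic_on {\<tau>}"
      using meromorphic_at_cuspsD(2)[OF cusps A] by blast
    show ?thesis
      using eventually_at_ii_gt[of Y] eventually_at_ii_gt[of 0]
    proof eventually_elim
      case (elim \<tau>)
      have "f analytic_on {mobius A \<tau>}" using Y elim by (intro analytic_mobius_cancel A) auto
      moreover have "(\<lambda>\<tau>. poly q (x \<tau>)) analytic_on {mobius A \<tau>}"
        using Im_mobius_pos[OF A elim(2)] by (intro analytic_on_subset[OF qx]) (auto simp: upper_half_plane_def)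
      ultimately have "g analytic_on {mobius A \<tau>}" unfolding g_def by (intro analytic_intros)
      then show ?case by (simp add: f1_def)
    qed
  qed
  have f1_bdd: "cusp_ge (\<lambda>\<tau>. f1 (mobius A \<tau>)) 0" if A: "A \<in> SL2Z" "\<not> pm_Gamma1 A" for A
  proof -
    obtain B where B: "B \<in> R" "key10 A = key10 B" using R(3)[OF A(1)] by blast
    have B': "B \<in> SL2Z" "B \<in> R'" using B R(2) A pm_Gamma1_key10[OF B(2)] by (auto simp: R'_def)
    have "[:- c B, 1:] ^ M B \<in> S" using B' by (simp add: S_def)
    then obtain q' where q': "q = [:- c B, 1:] ^ M B * q'"
      using dvd by (blast elim: dvdE)
    have "cusp_ge (\<lambda>\<tau>. f (mobius B \<tau>) * (x (mobius B \<tau>) - c B) ^ M B * poly q' (x (mobius B \<tau>))) (0 + 0)"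
      using B' by (intro cusp_ge_mult M cusp_ge_0_poly x_bdd) (auto simp: R'_def)
    then have "cusp_ge (\<lambda>\<tau>. g (mobius B \<tau>)) 0" by (simp add: g_def q' mult.assoc)
    moreover have "\<forall>\<^sub>F \<tau> in at_ii. g (mobius B \<tau>) = f1 (mobius A \<tau>)"
      using f1_cusp[OF A(1)] eventually_at_ii_gt[of 0]
      by eventually_elim (metis inv10_key10[OF g_inv A(1) B'(1) B(2)])
    ultimately show ?thesis by (rule cusp_ge_cong)
  qed
  have "\<exists>e. cusp_ge f1 e"
  proof -
    have 1: "mat2 1 0 0 1 \<in> SL2Z" by (simp add: SL2Z_iff)
    have m1: "mobius (mat2 1 0 0 1) \<tau> = \<tau>" for \<tau> by (simp add: mobius_def)
    obtain e where e: "cusp_ge f e" using meromorphic_at_cuspsD(1)[OF cusps 1] by (auto simp: m1)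
    obtain e' where e': "cusp_ge (\<lambda>\<tau>. poly q (x \<tau>)) e'" using cusp_ge_poly[OF cusp_ge_x] by blast
    have "cusp_ge g (e + e')" unfolding g_def by (intro cusp_ge_mult e e')
    then show ?thesis using f1_cusp[OF 1] by (auto simp: m1 intro: cusp_ge_cong)
  qed
  then obtain e where "cusp_ge f1 e" ..
  then have "cusp_ge f1 (- of_nat (nat \<lceil>\<bar>e\<bar>\<rceil>))" by (rule cusp_ge_mono) linarith
  then obtain p where p: "\<And>\<tau>. Im \<tau> > 0 \<Longrightarrow> f1 \<tau> = poly p (x \<tau>)"
    using polynomial_in_x[OF f1_hol f1_inv f1_bdd] by blast
  have "\<forall>\<^sub>\<approx>\<tau>\<in>upper_half_plane. f1 \<tau> = g \<tau>"
    unfolding f1_def using g_mero by (rule eventually_remove_sings_eq)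
  moreover have "\<forall>\<^sub>\<approx>\<tau>\<in>upper_half_plane. \<tau> \<in> upper_half_plane"
    by (intro eventually_in_cosparse open_upper_half_plane order_refl)
  ultimately have "\<forall>\<^sub>\<approx>\<tau>\<in>upper_half_plane. poly q (x \<tau>) \<noteq> 0 \<and> f \<tau> = poly p (x \<tau>) / poly q (x \<tau>)"
    using poly_x_nonzero[OF q0]
    by eventually_elim (auto simp: g_def upper_half_plane_def p field_simps)
  with q0 show thesis by (rule that)
qed

end

section \<open>Modular functions built from the continued fraction\<close>

text \<open>With period 10 at every cusp, multiplying by q^(N/10) makes the function bounded for
  large N. It then extends over t = 0, and division by t^N gives a meromorphic expansion.\<close>

lemma meromorphic_at_cuspsI:
  assumes hol: "f holomorphic_on upper_half_plane" and inv: "inv10 f"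
    and ge: "\<And>A. A \<in> SL2Z \<Longrightarrow> \<exists>e. cusp_ge (\<lambda>\<tau>. f (mobius A \<tau>)) e"
  shows "meromorphic_at_cusps f"
  unfolding meromorphic_at_cusps_def
proof
  fix A assume A: "A \<in> SL2Z"
  obtain e where e: "cusp_ge (\<lambda>\<tau>. f (mobius A \<tau>)) e" using ge[OF A] by blast
  define N where "N = nat \<lceil>10 * \<bar>e\<bar>\<rceil>"
  have "of_nat N \<ge> 10 * \<bar>e\<bar>" unfolding N_def by linarith
  then have N: "0 \<le> e + of_nat N / 10" by simp
  have hol': "(\<lambda>\<tau>. f (mobius A \<tau>) * nome (of_real (of_nat N / 10) * \<tau>)) holomorphic_on upper_half_plane"
    by (intro holomorphic_intros holomorphic_on_mobius[OF hol A])
  have per: "f (mobius A (\<tau> + of_nat 10)) * nome (of_real (of_nat N / 10) * (\<tau> + of_nat 10))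
      = f (mobius A \<tau>) * nome (of_real (of_nat N / 10) * \<tau>)" if "Im \<tau> > 0" for \<tau>
    using inv10_periodic[OF inv A that, of 1] nome_of_int[of "int N"] by (simp add: ring_distribs nome_add)
  have bdd: "(\<lambda>\<tau>. f (mobius A \<tau>) * nome (of_real (of_nat N / 10) * \<tau>)) \<in> O[at_ii](\<lambda>_. 1)"
    using cusp_ge_mono[OF cusp_ge_mult[OF e cusp_ge_nome] N] by (simp add: cusp_ge_0_iff)
  obtain g where g: "g holomorphic_on ball 0 1"
    "\<And>\<tau>. Im \<tau> > 0 \<Longrightarrow> f (mobius A \<tau>) * nome (of_real (of_nat N / 10) * \<tau>) = g (nome (\<tau> / of_nat 10))"
    using periodic_factor_bounded[OF hol' _ per bdd] by auto
  have "g analytic_on {0}" using g(1) by (meson analytic_at centre_in_ball open_ball zero_less_one)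
  then have mero: "(\<lambda>t. g t / t ^ N) meromorphic_on {0}"
    by (intro meromorphic_intros analytic_on_imp_meromorphic_on)
  have eq: "f (mobius A \<tau>) = g (nome (\<tau> / of_nat 10)) / nome (\<tau> / of_nat 10) ^ N" if "Im \<tau> > 1" for \<tau>
  proof -
    have "nome (of_real (of_nat N / 10) * \<tau>) = nome (\<tau> / of_nat 10) ^ N"
      by (simp add: nome_power)
    then show ?thesis using g(2)[of \<tau>] that by (simp add: field_simps)
  qed
  show "\<exists>h>0. \<exists>g. g meromorphic_on {0} \<and>
      (\<exists>y>0. \<forall>\<tau>. y < Im \<tau> \<longrightarrow> f (mobius A \<tau>) = g (nome (\<tau> / of_nat h)))"
    using mero eq by (intro exI[of _ "10::nat"] conjI exI[of _ "\<lambda>t. g t / t ^ N"] exI[of _ "1::real"]) auto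
qed

lemma inv10_rr_mono: "5 dvd m + 2 * n \<Longrightarrow> inv10 (rr_mono m n)"
  unfolding inv10_def mobius_def
  by (intro ballI rr_mono_moeb_Gamma1) (auto simp: Gamma1_10_iff SL2Z_iff upper_half_plane_def)

lemma rr_mono_mobius_order:
  assumes "A \<in> SL2Z"
  defines "s \<equiv> real_of_int (rr_sign (A $ 1 $ 1) (A $ 2 $ 1))"
  shows "cusp_order (\<lambda>\<tau>. rr_mono m n (mobius A \<tau>))
           (if even (A $ 2 $ 1) then of_int (m + 2 * n) * s / 5 else of_int (2 * m - n) * s / 10)"
  unfolding mobius_def s_def using assms(1) unfolding SL2Z_iff by (rule rr_mono_cusp_order)

lemma rr_mono_modular:
  assumes "5 dvd m + 2 * n"
  shows "rr_mono m n \<in> modular_functions (Gamma1 10)"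
proof -
  have "rr_mono m n nicely_meromorphic_on upper_half_plane"
    using rr_mono_holomorphic[of m n] open_upper_half_plane
    by (intro analytic_on_imp_nicely_meromorphic_on) (simp add: analytic_on_open)
  moreover have "meromorphic_at_cusps (rr_mono m n)"
    using rr_mono_mobius_order cusp_order_imp_ge[OF _ order_refl]
    by (intro meromorphic_at_cuspsI rr_mono_holomorphic inv10_rr_mono assms) blast
  ultimately show ?thesis
    using inv10_rr_mono[OF assms] by (simp add: modular_functions_def inv10_def)
qed

text \<open>In normal form a value is either the limit or 0 at a pole, so it is determined by the
  nearby values. This turns identities off a discrete set into pointwise ones.\<close>

lemma nicely_meromorphic_eqI:
  assumes f: "f nicely_meromorphic_on {z}" and g: "g nicely_meromorphic_on {z}"
    and eq: "\<forall>\<^sub>F w in at z. f w = g w"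
  shows "f z = g z"
proof (cases "is_pole f z")
  case True
  then have "is_pole g z" using eq by (simp add: is_pole_cong[OF eq refl])
  with True f g show ?thesis
    by (auto simp: nicely_meromorphic_on_def dest: not_tendsto_and_filterlim_at_infinity[rotated 2] simp: is_pole_def)
next
  case False
  then have "\<not> is_pole g z" using eq by (simp add: is_pole_cong[OF eq refl])
  with False f g have "f \<midarrow>z\<rightarrow> f z" "g \<midarrow>z\<rightarrow> g z" by (auto simp: nicely_meromorphic_on_def)
  from Lim_transform_eventually[OF this(1) eq] this(2) show ?thesis
    by (intro tendsto_unique[of "at z"]) auto
qed

lemma nicely_meromorphic_mobius:
  assumes f: "f nicely_meromorphic_on upper_half_plane" and A: "A \<in> SL2Z" and \<tau>: "Im \<tau> > 0"
  shows "(\<lambda>\<tau>. f (mobius A \<tau>)) nicely_meromorphic_on {\<tau>}"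
proof -
  have "(\<lambda>\<tau>. f (mobius A \<tau>)) meromorphic_on {\<tau>}"
    using meromorphic_mobius[of f A] f A \<tau>
    by (auto simp: nicely_meromorphic_on_def upper_half_plane_def intro: meromorphic_on_subset)
  moreover have "(is_pole f (mobius A \<tau>) \<and> f (mobius A \<tau>) = 0) \<or> f \<midarrow>mobius A \<tau>\<rightarrow> f (mobius A \<tau>)"
    using f Im_mobius_pos[OF A \<tau>] by (auto simp: nicely_meromorphic_on_def upper_half_plane_def)
  then have "(is_pole (\<lambda>\<tau>. f (mobius A \<tau>)) \<tau> \<and> f (mobius A \<tau>) = 0) \<or> (\<lambda>\<tau>. f (mobius A \<tau>)) \<midarrow>\<tau>\<rightarrow> f (mobius A \<tau>)"
    unfolding is_pole_def using filterlim_compose[OF _ filterlim_mobius_at[OF A \<tau>]] by blast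
  ultimately show ?thesis by (simp add: nicely_meromorphic_on_def)
qed

lemma meromorphic_on_poly:
  assumes "g meromorphic_on S"
  shows "(\<lambda>t. poly p (g t)) meromorphic_on S"
proof (induction p)
  case (pCons a p)
  then show ?case using assms by (simp) (intro meromorphic_intros)
qed (simp add: meromorphic_intros)

text \<open>Invariance and expansions are inherited from F near every point, and
  \<open>nicely_meromorphic_eqI\<close> makes them pointwise. At a cusp the expansion is p(g)/q(g),
  with g the expansion of F.\<close>

lemma rational_functions_in_subset:
  assumes F: "F \<in> modular_functions (Gamma1 10)"
  shows "rational_functions_in F \<subseteq> modular_functions (Gamma1 10)"
proof
  fix f assume "f \<in> rational_functions_in F"
  then obtain p q where f: "f nicely_meromorphic_on upper_half_plane"
    and co: "\<forall>\<^sub>\<approx>\<tau>\<in>upper_half_plane. poly q (F \<tau>) \<noteq> 0 \<and> f \<tau> = poly p (F \<tau>) / poly q (F \<tau>)"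
    by (auto simp: rational_functions_in_def)
  have eq: "\<forall>\<^sub>F w in at \<tau>. f w = poly p (F w) / poly q (F w)" if "Im \<tau> > 0" for \<tau>
    using eventually_cosparse_imp_eventually_at[OF co, of \<tau> UNIV] that
    by (auto simp: upper_half_plane_def elim: eventually_mono)
  have inv_F: "inv10 F" and cusps_F: "meromorphic_at_cusps F"
    using F by (auto simp: modular_functions_def inv10_def)
  have eqA: "\<forall>\<^sub>F w in at \<tau>. f (mobius A w) = poly p (F (mobius A w)) / poly q (F (mobius A w))"
    if "A \<in> SL2Z" "Im \<tau> > 0" for A \<tau>
    using eventually_compose_filterlim[OF eq filterlim_mobius_at] that Im_mobius_pos by blast
  have pos: "\<forall>\<^sub>F w in at \<tau>. Im w > 0" if "Im \<tau> > 0" for \<tau>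
    using eventually_in_H[OF that] by (simp add: eventually_nhds_conv_at)
  have "f (mobius A \<tau>) = f \<tau>" if A: "A \<in> Gamma1 10" and \<tau>: "Im \<tau> > 0" for A \<tau>
  proof (rule nicely_meromorphic_eqI[of "\<lambda>\<tau>. f (mobius A \<tau>)"])
    have A': "A \<in> SL2Z" using A by (simp add: Gamma1_10_iff)
    show "(\<lambda>\<tau>. f (mobius A \<tau>)) nicely_meromorphic_on {\<tau>}"
      by (rule nicely_meromorphic_mobius[OF f A' \<tau>])
    show "f nicely_meromorphic_on {\<tau>}"
      using \<tau> by (intro nicely_meromorphic_on_subset[OF f]) (auto simp: upper_half_plane_def)
    show "\<forall>\<^sub>F w in at \<tau>. f (mobius A w) = f w"
      using eqA[OF A' \<tau>] eq[OF \<tau>] pos[OF \<tau>] by eventually_elim (simp add: inv10D[OF inv_F A])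
  qed
  moreover have "meromorphic_at_cusps f"
    unfolding meromorphic_at_cusps_def
  proof
    fix A assume A: "A \<in> SL2Z"
    obtain h g y where h: "h > (0::nat)" and g: "g meromorphic_on {0}" and y: "y > 0"
      and Fg: "\<And>\<tau>. Im \<tau> > y \<Longrightarrow> F (mobius A \<tau>) = g (nome (\<tau> / of_nat h))"
      using cusps_F A unfolding meromorphic_at_cusps_def by blast
    define R where "R = (\<lambda>t. poly p (g t) / poly q (g t))"
    have R: "R meromorphic_on {0}" unfolding R_def by (intro meromorphic_intros meromorphic_on_poly g)
    \<comment> \<open>Where R is analytic, its composition with the nome is in normal form, so it
      can be compared with f at each single point.\<close>
    then obtain r where r: "r > 0" "R analytic_on ball 0 r - {0}"
      by (auto simp: meromorphic_at_iff isolated_singularity_at_def)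
    have "\<forall>\<^sub>F t in at 0. t \<in> ball 0 r - {0}"
      using r by (intro eventually_at_in_open) auto
    from eventually_compose_filterlim[OF this filterlim_nome_at_0[OF h]]
    obtain Y where Y: "\<And>\<tau>. Im \<tau> > Y \<Longrightarrow> nome (\<tau> / of_nat h) \<in> ball 0 r - {0}"
      by (auto simp: eventually_at_ii)
    have "f (mobius A \<tau>) = R (nome (\<tau> / of_nat h))" if \<tau>: "Im \<tau> > max y Y" for \<tau>
    proof (rule nicely_meromorphic_eqI[of "\<lambda>\<tau>. f (mobius A \<tau>)"])
      have \<tau>0: "Im \<tau> > 0" using \<tau> y by linarith
      show "(\<lambda>\<tau>. f (mobius A \<tau>)) nicely_meromorphic_on {\<tau>}"
        by (rule nicely_meromorphic_mobius[OF f A \<tau>0])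
      have "(\<lambda>\<tau>. nome (\<tau> / of_nat h)) analytic_on {\<tau>}"
      proof -
        have "(\<lambda>\<tau>. nome (\<tau> / of_nat h)) holomorphic_on UNIV"
          using h by (intro holomorphic_intros) auto
        then show ?thesis by (meson UNIV_I analytic_at open_UNIV)
      qed
      then have "(R \<circ> (\<lambda>\<tau>. nome (\<tau> / of_nat h))) analytic_on {\<tau>}"
        using Y \<tau> by (intro analytic_on_compose analytic_on_subset[OF r(2)]) auto
      then show "(\<lambda>\<tau>. R (nome (\<tau> / of_nat h))) nicely_meromorphic_on {\<tau>}"
        by (intro analytic_on_imp_nicely_meromorphic_on) (simp add: o_def)
      have "\<forall>\<^sub>F w in at \<tau>. w \<in> {w. Im w > y}"
        using \<tau> by (intro eventually_at_in_open' open_halfspace_Im_gt) auto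
      with eqA[OF A \<tau>0] show "\<forall>\<^sub>F w in at \<tau>. f (mobius A w) = R (nome (w / of_nat h))"
        by eventually_elim (simp add: Fg R_def)
    qed
    then show "\<exists>h>0. \<exists>g. g meromorphic_on {0} \<and>
        (\<exists>y>0. \<forall>\<tau>. y < Im \<tau> \<longrightarrow> f (mobius A \<tau>) = g (nome (\<tau> / of_nat h)))"
      using R h y by (intro exI[of _ h] conjI exI[of _ R] exI[of _ "max y Y"]) auto
  qed
  ultimately show "f \<in> modular_functions (Gamma1 10)"
    using f by (simp add: modular_functions_def upper_half_plane_def)
qed

section \<open>Expansions of k and l at i infinity\<close>

lemma rr_prod_nome_double_tendsto: "((\<lambda>\<tau>. rr_prod (nome (2 * \<tau>))) \<longlongrightarrow> 1) at_ii"
  using filterlim_compose[OF rr_prod_nome_tendsto filterlim_affine_at_ii[of 2 0]] by simp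

lemma rr_k_eq:
  assumes "Im \<tau> > 0"
  shows "rr_k \<tau> = nome \<tau> * (rr_prod (nome \<tau>) * rr_prod (nome (2 * \<tau>)) ^ 2)"
proof -
  have "nome (\<tau> / 5) * nome (2 * \<tau> / 5) ^ 2 = nome \<tau>"
    unfolding nome_power nome_add[symmetric] by (rule arg_cong[of _ _ nome]) (simp add: field_simps)
  then show ?thesis using assms by (simp add: rr_k_def rr_cf_eq power_mult_distrib mult_ac)
qed

lemma rr_l_eq:
  assumes "Im \<tau> > 0"
  shows "rr_l \<tau> = rr_prod (nome (2 * \<tau>)) / rr_prod (nome \<tau>) ^ 2"
proof -
  have "nome (\<tau> / 5) ^ 2 = nome (2 * \<tau> / 5)"
    unfolding nome_power by simp
  then show ?thesis using assms by (simp add: rr_l_def rr_cf_eq power_mult_distrib)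
qed

lemma rr_k_nonzero: "Im \<tau> > 0 \<Longrightarrow> rr_k \<tau> \<noteq> 0"
  by (simp add: rr_k_eq_mono rr_mono_nonzero)

lemma rr_l_nonzero: "Im \<tau> > 0 \<Longrightarrow> rr_l \<tau> \<noteq> 0"
  by (simp add: rr_l_eq_mono rr_mono_nonzero)

lemma rr_l_tendsto: "(rr_l \<longlongrightarrow> 1) at_ii"
proof -
  have "((\<lambda>\<tau>. rr_prod (nome (2 * \<tau>)) / rr_prod (nome \<tau>) ^ 2) \<longlongrightarrow> 1 / 1 ^ 2) at_ii"
    by (intro tendsto_intros rr_prod_nome_tendsto rr_prod_nome_double_tendsto) auto
  moreover have "\<forall>\<^sub>F \<tau> in at_ii. rr_prod (nome (2 * \<tau>)) / rr_prod (nome \<tau>) ^ 2 = rr_l \<tau>"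
    using eventually_at_ii_gt[of 0] by eventually_elim (simp add: rr_l_eq)
  ultimately show ?thesis by (auto intro: Lim_transform_eventually)
qed

lemma inverse_rr_k_eq_mono: "(\<lambda>\<tau>. 1 / rr_k \<tau>) = rr_mono (- 1) (- 2)"
  by (auto simp: rr_k_def rr_mono_def power_int_minus field_simps)

lemma inverse_rr_l_eq_mono: "(\<lambda>\<tau>. 1 / rr_l \<tau>) = rr_mono 2 (- 1)"
  by (auto simp: rr_l_def rr_mono_def power_int_minus field_simps)

text \<open>1/k has order -\<open>rr_sign\<close> at cusps with even c and order 0 at those with odd
  c. It remains to see that for even c the sign is positive only in the class of i infinity.\<close>

lemma rr_k_hauptmodul: "hauptmodul10 (\<lambda>\<tau>. 1 / rr_k \<tau>)"
proof
  show "(\<lambda>\<tau>. 1 / rr_k \<tau>) holomorphic_on upper_half_plane"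
    unfolding inverse_rr_k_eq_mono by (rule rr_mono_holomorphic)
  show "inv10 (\<lambda>\<tau>. 1 / rr_k \<tau>)"
    unfolding inverse_rr_k_eq_mono by (rule inv10_rr_mono) simp
  have "((\<lambda>\<tau>. 1 / (rr_prod (nome \<tau>) * rr_prod (nome (2 * \<tau>)) ^ 2)) \<longlongrightarrow> 1 / (1 * 1 ^ 2)) at_ii"
    by (intro tendsto_intros rr_prod_nome_tendsto rr_prod_nome_double_tendsto) auto
  moreover have "\<forall>\<^sub>F \<tau> in at_ii. 1 / (rr_prod (nome \<tau>) * rr_prod (nome (2 * \<tau>)) ^ 2) = 1 / rr_k \<tau> * nome \<tau>"
    using eventually_at_ii_gt[of 0] by eventually_elim (simp add: rr_k_eq)
  ultimately show "((\<lambda>\<tau>. 1 / rr_k \<tau> * nome \<tau>) \<longlongrightarrow> 1) at_ii"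
    by (auto intro: Lim_transform_eventually)
  fix A assume A: "A \<in> SL2Z" "\<not> pm_Gamma1 A"
  let ?a = "A $ 1 $ 1" and ?c = "A $ 2 $ 1"
  \<comment> \<open>An even c divisible by 5 is divisible by 10 and makes a odd; for odd a, being 1
    or 4 mod 5 means being 1 or 9 mod 10.\<close>
  have "rr_sign ?a ?c \<le> 0" if "even ?c"
  proof (cases "5 dvd ?c")
    case True
    with that have 10: "10 dvd ?c" by presburger
    have "odd ?a"
      using not_dvd_first_column[of ?a "A $ 2 $ 2" "A $ 1 $ 2" ?c 2] A that by (simp add: SL2Z_iff)
    moreover have "?a mod 10 \<noteq> 1" "?a mod 10 \<noteq> 9" using A(2) 10 by (auto simp: pm_Gamma1_def)
    ultimately have "?a mod 5 \<noteq> 1 \<and> ?a mod 5 \<noteq> 4" by presburger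
    then show ?thesis by (simp add: rr_sign_def)
  qed (simp add: rr_sign_def)
  then show "cusp_ge (\<lambda>\<tau>. 1 / rr_k (mobius A \<tau>)) 0"
    using cusp_order_imp_ge[OF rr_mono_mobius_order[OF A(1), of "- 1" "- 2"], of 0]
    by (auto simp: inverse_rr_k_eq_mono[THEN fun_cong] split: if_splits)
qed

section \<open>The relation between the two generators\<close>

text \<open>With A = u^(5n+1), denominator minus numerator of the n-th factor is A (1 - u) (1 - u^2)
  > 0, so every factor lies in (0, 1).\<close>

lemma rr_prod_real:
  assumes u: "0 < u" "u < 1"
  obtains y where "rr_prod (of_real u) = of_real y" "0 < y" "y < 1"
proof -
  define t :: "nat \<Rightarrow> real" where "t = (\<lambda>n. ((1 - u ^ (5 * Suc n - 1)) * (1 - u ^ (5 * Suc n - 4))) /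
           ((1 - u ^ (5 * Suc n - 2)) * (1 - u ^ (5 * Suc n - 3))))"
  have t: "0 < t n" "t n < 1" for n
  proof -
    define A where "A = u ^ (5 * n + 1)"
    have "u ^ (5 * n + 1) < 1 ^ (5 * n + 1)" using u by (intro power_strict_mono) auto
    then have A: "0 < A" "A < 1" using u by (simp_all only: A_def zero_less_power power_one)
    have e: "5 * Suc n - 1 = (5 * n + 1) + 3" "5 * Suc n - 4 = 5 * n + 1" "5 * Suc n - 2 = (5 * n + 1) + 2"
      "5 * Suc n - 3 = (5 * n + 1) + 1" by simp_all
    have teq: "t n = ((1 - A * u ^ 3) * (1 - A)) / ((1 - A * u ^ 2) * (1 - A * u))"
      unfolding t_def e power_add A_def by simp
    have lt: "A * u ^ i < 1" for i
    proof -
      have "A * u ^ i \<le> A * 1" using A u by (intro mult_left_mono power_le_one) auto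
      then show ?thesis using A(2) by linarith
    qed
    have pos: "0 < (1 - A * u ^ 3) * (1 - A)" "0 < (1 - A * u ^ 2) * (1 - A * u)"
      using A lt[of 3] lt[of 2] lt[of 1] by (auto intro!: mult_pos_pos)
    have "(1 - A * u ^ 2) * (1 - A * u) - (1 - A * u ^ 3) * (1 - A) = A * ((1 - u) * (1 - u ^ 2))"
      by (simp add: algebra_simps power2_eq_square power3_eq_cube)
    moreover have "0 < A * ((1 - u) * (1 - u ^ 2))"
      using A u by (intro mult_pos_pos) (auto simp: power_less_one_iff)
    ultimately show "0 < t n" "t n < 1" unfolding teq using pos by (auto simp: divide_less_eq)
  qed
  have "(\<lambda>n. complex_of_real (t n)) has_prod rr_prod (of_real u)"
    using rr_prod_has_prod[of "of_real u"] u unfolding t_def by simp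
  from has_prod_imp_tendsto'[OF this]
  have lim: "(\<lambda>N. complex_of_real (\<Prod>n<N. t n)) \<longlonglongrightarrow> rr_prod (of_real u)" by simp
  have Re: "(\<lambda>N. \<Prod>n<N. t n) \<longlonglongrightarrow> Re (rr_prod (of_real u))"
    using tendsto_Re[OF lim] by (simp only: Re_complex_of_real)
  have "(\<lambda>N. 0) \<longlonglongrightarrow> Im (rr_prod (of_real u))"
    using tendsto_Im[OF lim] by (simp only: Im_complex_of_real)
  then have Im: "Im (rr_prod (of_real u)) = 0" by (simp add: LIMSEQ_const_iff)
  have "Re (rr_prod (of_real u)) \<le> t 0"
  proof (rule LIMSEQ_le_const2[OF Re], intro exI[of _ 1] allI impI)
    fix N :: nat assume "1 \<le> N"
    then obtain M where N: "N = Suc M" by (cases N) auto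
    have "(\<Prod>n<M. t (Suc n)) \<le> 1" using t by (intro prod_le_1) (auto intro: less_imp_le)
    then show "(\<Prod>n<N. t n) \<le> t 0"
      unfolding N prod.lessThan_Suc_shift using t[of 0] mult_left_mono[of "\<Prod>n<M. t (Suc n)" 1 "t 0"] by simp
  qed
  moreover have "Re (rr_prod (of_real u)) \<ge> 0"
    by (rule LIMSEQ_le_const[OF Re]) (intro exI[of _ 0] allI impI less_imp_le[OF prod_pos] t)
  moreover have eq: "rr_prod (of_real u) = of_real (Re (rr_prod (of_real u)))"
    using Im by (simp add: complex_eq_iff)
  \<comment> \<open>Positive partial products give only a nonnegative limit; strictness needs that
    the product has no zero.\<close>
  moreover have "rr_prod (of_real u) \<noteq> 0" using u by (intro rr_prod_nonzero) auto
  then have "Re (rr_prod (of_real u)) \<noteq> 0" using eq by (metis of_real_0)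
  ultimately show thesis using t(2)[of 0] by (intro that[of "Re (rr_prod (of_real u))"]) linarith+
qed

text \<open>The cusp at which \<open>l\<close> has its pole.\<close>

definition Cmat :: "int ^ 2 ^ 2" where
  "Cmat = mat2 1 0 5 1"

lemma Cmat_SL2Z: "Cmat \<in> SL2Z"
  by (simp add: Cmat_def SL2Z_iff)

text \<open>The cusp 1/5 has width 2: G is the conjugate of the translation by 2 under
  \<open>Cmat\<close>. The exact width is needed, since the pole of l there is simple only in
  q^(1/2).\<close>

lemma inv10_Cmat_periodic:
  assumes f: "inv10 f" and \<tau>: "Im \<tau> > 0"
  shows "f (mobius Cmat (\<tau> + 2)) = f (mobius Cmat \<tau>)"
proof -
  define G where "G = mat2 (- 9) 2 (- 50) 11"
  have G: "G \<in> Gamma1 10" by (simp add: G_def Gamma1_10_iff SL2Z_iff)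
  have "mobius Cmat (\<tau> + 2) = mobius (Cmat ** mat2 1 2 0 1) \<tau>"
    using mobius_translate[OF \<tau>, of Cmat 2] by simp
  also have "\<dots> = mobius (G ** Cmat) \<tau>"
    by (simp add: mobius_def G_def Cmat_def)
  also have "\<dots> = mobius G (mobius Cmat \<tau>)" by (rule mobius_mult[OF Cmat_SL2Z \<tau>])
  finally show ?thesis using inv10D[OF f G Im_mobius_pos[OF Cmat_SL2Z \<tau>]] by simp
qed

text \<open>With c = 5 c' and j = d - c', the lower left entry of G becomes 5 (c' - d) (1 - c),
  divisible by 10 as c is odd. So these matrices all belong to the cusp class of 1/5.\<close>

lemma inv10_Cmat_class:
  assumes A: "A \<in> SL2Z" and "5 dvd A $ 2 $ 1" "odd (A $ 2 $ 1)" "A $ 1 $ 1 mod 5 \<in> {1, 4}"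
    and f: "inv10 f"
  obtains j :: int where "\<And>\<tau>. Im \<tau> > 0 \<Longrightarrow> f (mobius A \<tau>) = f (mobius Cmat (\<tau> + of_int j))"
proof -
  obtain c' where c: "A $ 2 $ 1 = 5 * c'" using assms(2) by (rule dvdE)
  define j where "j = A $ 2 $ 2 - c'"
  define G where "G = (A ** mat2 1 (- j) 0 1) ** adj2 Cmat"
  have G: "G \<in> SL2Z" unfolding G_def by (intro SL2Z_mult translate_SL2Z A SL2Z_adj2 Cmat_SL2Z)
  have "even ((c' - A $ 2 $ 2) * (1 - A $ 2 $ 1))" using assms(3) by simp
  then obtain w where w: "(c' - A $ 2 $ 2) * (1 - A $ 2 $ 1) = 2 * w" by blast
  have "G $ 2 $ 1 = A $ 2 $ 1 - 5 * (A $ 2 $ 2 - j * A $ 2 $ 1)"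
    by (simp add: G_def Cmat_def algebra_simps)
  also have "\<dots> = 5 * ((c' - A $ 2 $ 2) * (1 - A $ 2 $ 1))"
    by (simp add: j_def c algebra_simps)
  finally have G21: "G $ 2 $ 1 = 10 * w" using w by simp
  have G11: "G $ 1 $ 1 = A $ 1 $ 1 - 5 * (A $ 1 $ 2 - j * A $ 1 $ 1)"
    by (simp add: G_def Cmat_def algebra_simps)
  have "odd (G $ 1 $ 1)"
    using not_dvd_first_column[of "G $ 1 $ 1" "G $ 2 $ 2" "G $ 1 $ 2" "G $ 2 $ 1" 2] G G21 by (simp add: SL2Z_iff)
  moreover have "(y - 5 * z) mod 5 = y mod 5" for y z :: int by presburger
  then have "G $ 1 $ 1 mod 5 \<in> {1, 4}"
    using assms(4) unfolding G11 by metis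
  ultimately have "G $ 1 $ 1 mod 10 \<in> {1, 9}" unfolding insert_iff empty_iff by presburger
  then have pm: "pm_Gamma1 G" by (simp add: pm_Gamma1_def G21)
  show thesis
  proof (rule that[of j])
    fix \<tau> assume \<tau>: "Im \<tau> > 0"
    have \<tau>': "Im (\<tau> + of_int j) > 0" using \<tau> by simp
    have "mobius G (mobius Cmat (\<tau> + of_int j)) = mobius A \<tau>"
      unfolding G_def mobius_quotient[OF Cmat_SL2Z \<tau>'] mobius_translate[OF \<tau>'] by simp
    then show "f (mobius A \<tau>) = f (mobius Cmat (\<tau> + of_int j))"
      using inv10_pm_Gamma1[OF f G pm Im_mobius_pos[OF Cmat_SL2Z \<tau>']] by simp
  qed
qed

text \<open>Multiplying \<open>l\<close> by \<open>1/k - x0\<close>, where \<open>x0\<close> is the value of \<open>1/k\<close> at the pole of \<open>l\<close>,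
  leaves a single simple pole, at infinity.\<close>

lemma rr_l_linear_fractional:
  obtains x0 \<alpha> \<beta> where "\<And>\<tau>. Im \<tau> > 0 \<Longrightarrow> (1 / rr_k \<tau> - x0) * rr_l \<tau> = \<alpha> * (1 / rr_k \<tau>) + \<beta>"
proof -
  define x where "x = (\<lambda>\<tau>. 1 / rr_k \<tau>)"
  interpret hauptmodul10 x unfolding x_def by (rule rr_k_hauptmodul)
  note [simp] = rr_l_eq_mono
  have l_inv: "inv10 rr_l" unfolding rr_l_eq_mono by (rule inv10_rr_mono) simp
  have l_hol: "rr_l holomorphic_on upper_half_plane" unfolding rr_l_eq_mono by (rule rr_mono_holomorphic)
  have C_pm: "\<not> pm_Gamma1 Cmat" by (simp add: pm_Gamma1_def Cmat_def)
  obtain X where X: "X holomorphic_on ball 0 1" "\<And>\<tau>. Im \<tau> > 0 \<Longrightarrow> x (mobius Cmat \<tau>) = X (nome (\<tau> / of_nat 2))"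
    using periodic_factor_bounded[OF holomorphic_on_mobius[OF x_hol Cmat_SL2Z], of 2]
      inv10_Cmat_periodic[OF x_inv] x_bdd[OF Cmat_SL2Z C_pm] unfolding cusp_ge_0_iff by auto
  define x0 where "x0 = X 0"
  have "cusp_ge (\<lambda>\<tau>. X (nome (\<tau> / of_nat 2)) - x0) (1 / of_nat 2)"
    unfolding x0_def by (rule cusp_ge_factor) (auto intro!: holomorphic_intros X)
  then have xC: "cusp_ge (\<lambda>\<tau>. x (mobius Cmat \<tau>) - x0) (1 / of_nat 2)"
    by (rule cusp_ge_cong) (use eventually_at_ii_gt[of 0] in eventually_elim, simp add: X)
  \<comment> \<open>The order is -5/10; it is compensated by the order 1/2 that x - x0 gains in the
    parameter of width 2.\<close>
  have lC: "cusp_ge (\<lambda>\<tau>. rr_l (mobius Cmat \<tau>)) (- 1 / 2)"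
    using cusp_order_imp_ge[OF rr_mono_mobius_order[OF Cmat_SL2Z, of "- 2" 1] order_refl]
    by (simp add: Cmat_def rr_sign_def)
  define g where "g = (\<lambda>\<tau>. (x \<tau> - x0) * rr_l \<tau>)"
  have gC: "cusp_ge (\<lambda>\<tau>. g (mobius Cmat \<tau>)) 0"
    using cusp_ge_mult[OF xC lC] by (simp add: g_def)
  have g_hol: "g holomorphic_on upper_half_plane"
    unfolding g_def by (intro holomorphic_intros x_hol l_hol)
  have g_inv: "inv10 g" using x_inv l_inv by (simp add: g_def inv10_def)
  have g_bdd: "cusp_ge (\<lambda>\<tau>. g (mobius A \<tau>)) 0" if A: "A \<in> SL2Z" "\<not> pm_Gamma1 A" for A
  proof (cases "5 dvd A $ 2 $ 1 \<and> odd (A $ 2 $ 1) \<and> A $ 1 $ 1 mod 5 \<in> {1, 4}")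
    case True
    then have c: "5 dvd A $ 2 $ 1" "odd (A $ 2 $ 1)" "A $ 1 $ 1 mod 5 \<in> {1, 4}" by blast+
    obtain j :: int where j: "\<And>\<tau>. Im \<tau> > 0 \<Longrightarrow> g (mobius A \<tau>) = g (mobius Cmat (\<tau> + of_int j))"
      using inv10_Cmat_class[OF A(1) c g_inv] by blast
    have "cusp_ge (\<lambda>\<tau>. g (mobius Cmat (of_real 1 * \<tau> + of_int j))) 0"
      using landau_o.big.compose[OF gC[unfolded cusp_ge_0_iff] filterlim_affine_at_ii[of 1 "of_int j"]]
      by (simp add: cusp_ge_0_iff)
    then show ?thesis
      by (rule cusp_ge_cong) (use eventually_at_ii_gt[of 0] in eventually_elim, simp add: j)
  next
    case False
    \<comment> \<open>l has order 0 for even c and -\<open>rr_sign\<close> / 2 for odd c, negative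
      only in the class of \<open>Cmat\<close>.\<close>
    then have "cusp_ge (\<lambda>\<tau>. rr_l (mobius A \<tau>)) 0"
      using cusp_order_imp_ge[OF rr_mono_mobius_order[OF A(1), of "- 2" 1], of 0]
      by (auto simp: rr_sign_def split: if_splits)
    moreover have "cusp_ge (\<lambda>\<tau>. x (mobius A \<tau>) - x0) 0"
      by (intro cusp_ge_diff x_bdd A cusp_ge_const) simp
    ultimately have "cusp_ge (\<lambda>\<tau>. (x (mobius A \<tau>) - x0) * rr_l (mobius A \<tau>)) (0 + 0)"
      by (intro cusp_ge_mult)
    then show ?thesis by (simp add: g_def)
  qed
  have "cusp_ge rr_l 0"
    unfolding cusp_ge_0_iff by (rule bigoI_tendsto[of _ _ 1]) (use rr_l_tendsto in simp_all)
  moreover have "cusp_ge (\<lambda>\<tau>. x \<tau> - x0) (- 1)"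
    by (intro cusp_ge_diff cusp_ge_x cusp_ge_const) simp
  ultimately have "cusp_ge g (- 1 + 0)" unfolding g_def by (intro cusp_ge_mult)
  then have "cusp_ge g (- of_nat 1)" by simp
  then obtain p where p: "degree p \<le> 1" "\<And>\<tau>. Im \<tau> > 0 \<Longrightarrow> g \<tau> = poly p (x \<tau>)"
    using polynomial_in_x[OF g_hol g_inv g_bdd] by blast
  have "poly p y = coeff p 0 + coeff p 1 * y" for y
  proof -
    have "poly p y = (\<Sum>i\<le>1. coeff p i * y ^ i)"
      unfolding poly_altdef using p(1) by (intro sum.mono_neutral_left) (auto simp: coeff_eq_0)
    then show ?thesis by simp
  qed
  with p(2) show thesis by (intro that[of x0 "coeff p 1" "coeff p 0"]) (auto simp: g_def x_def algebra_simps)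
qed

text \<open>Three conditions fix the constants up to sign: the limit l -> 1 at i infinity, the same
  limit in the relation transformed by (3 2; 10 7), and consistency of both relations.\<close>

lemma rr_kl_relation_sign:
  obtains \<beta> where "\<beta> = 1 \<or> \<beta> = - 1"
    "\<And>\<tau>. Im \<tau> > 0 \<Longrightarrow> (1 / rr_k \<tau> - \<beta>) * rr_l \<tau> = 1 / rr_k \<tau> + \<beta>"
proof -
  define x where "x = (\<lambda>\<tau>. 1 / rr_k \<tau>)"
  interpret hauptmodul10 x unfolding x_def by (rule rr_k_hauptmodul)
  obtain x0 \<alpha> \<beta> where rel: "\<And>\<tau>. Im \<tau> > 0 \<Longrightarrow> (x \<tau> - x0) * rr_l \<tau> = \<alpha> * x \<tau> + \<beta>"
    using rr_l_linear_fractional unfolding x_def by blast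
  have inv_x: "((\<lambda>\<tau>. inverse (x \<tau>)) \<longlongrightarrow> 0) at_ii"
    using x_filterlim filterlim_compose[OF tendsto_inverse_0] by blast
  have x_nz: "x \<tau> \<noteq> 0" if "Im \<tau> > 0" for \<tau> using rr_k_nonzero[OF that] by (simp add: x_def)
  have "((\<lambda>\<tau>. (1 - x0 * inverse (x \<tau>)) * rr_l \<tau>) \<longlongrightarrow> (1 - x0 * 0) * 1) at_ii"
    by (intro tendsto_intros inv_x rr_l_tendsto)
  moreover have "\<forall>\<^sub>F \<tau> in at_ii. (1 - x0 * inverse (x \<tau>)) * rr_l \<tau> = \<alpha> + \<beta> * inverse (x \<tau>)"
    using eventually_at_ii_gt[of 0]
    by eventually_elim (use rel x_nz in \<open>auto simp: field_simps\<close>)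
  ultimately have "((\<lambda>\<tau>. \<alpha> + \<beta> * inverse (x \<tau>)) \<longlongrightarrow> 1) at_ii"
    by (auto intro: Lim_transform_eventually)
  moreover have "((\<lambda>\<tau>. \<alpha> + \<beta> * inverse (x \<tau>)) \<longlongrightarrow> \<alpha> + \<beta> * 0) at_ii"
    by (intro tendsto_intros inv_x)
  ultimately have \<alpha>: "\<alpha> = 1" using tendsto_unique[of at_ii] by fastforce
  \<comment> \<open>The relation at (3 2; 10 7) applied to \<tau>, with x and l replaced by their
    negative reciprocals and denominators cleared.\<close>
  have rel2: "1 + x0 * x \<tau> = rr_l \<tau> * (\<beta> * x \<tau> - 1)" if \<tau>: "Im \<tau> > 0" for \<tau>
  proof -
    have H: "Im (moeb 3 2 10 7 \<tau>) > 0" by (rule Im_moebius_pos[OF _ \<tau>]) simp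
    have "x (moeb 3 2 10 7 \<tau>) = - 1 / x \<tau>" "rr_l (moeb 3 2 10 7 \<tau>) = - 1 / rr_l \<tau>"
      using rr_kl_diamond[OF \<tau>] by (simp_all add: x_def)
    then have "(- 1 / x \<tau> - x0) * (- 1 / rr_l \<tau>) = - 1 / x \<tau> + \<beta>"
      using rel[OF H] \<alpha> by simp
    then have "(- 1 / x \<tau> - x0) * (- 1 / rr_l \<tau>) * (x \<tau> * rr_l \<tau>) = (- 1 / x \<tau> + \<beta>) * (x \<tau> * rr_l \<tau>)"
      by simp
    moreover have "(- 1 / x \<tau> - x0) * (- 1 / rr_l \<tau>) * (x \<tau> * rr_l \<tau>) = 1 + x0 * x \<tau>"
      using x_nz[OF \<tau>] rr_l_nonzero[OF \<tau>] by (simp add: field_simps)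
    moreover have "(- 1 / x \<tau> + \<beta>) * (x \<tau> * rr_l \<tau>) = rr_l \<tau> * (\<beta> * x \<tau> - 1)"
      using x_nz[OF \<tau>] by (simp add: field_simps)
    ultimately show ?thesis by simp
  qed
  have "((\<lambda>\<tau>. rr_l \<tau> * (\<beta> - inverse (x \<tau>))) \<longlongrightarrow> 1 * (\<beta> - 0)) at_ii"
    by (intro tendsto_intros inv_x rr_l_tendsto)
  moreover have "\<forall>\<^sub>F \<tau> in at_ii. rr_l \<tau> * (\<beta> - inverse (x \<tau>)) = inverse (x \<tau>) + x0"
    using eventually_at_ii_gt[of 0]
    by eventually_elim (use rel2 x_nz in \<open>auto simp: field_simps\<close>)
  ultimately have "((\<lambda>\<tau>. inverse (x \<tau>) + x0) \<longlongrightarrow> \<beta>) at_ii"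
    by (auto intro: Lim_transform_eventually)
  moreover have "((\<lambda>\<tau>. inverse (x \<tau>) + x0) \<longlongrightarrow> 0 + x0) at_ii"
    by (intro tendsto_intros inv_x)
  ultimately have x0: "x0 = \<beta>" using tendsto_unique[of at_ii] by fastforce
  \<comment> \<open>Eliminating l between the two relations leaves 2 x (1 - \<beta>^2) = 0, and x
    has no zero; any point of the upper half-plane would do.\<close>
  have "\<beta>\<^sup>2 = 1"
  proof -
    have \<i>: "Im \<i> > 0" by simp
    have "(x \<i> - \<beta>) * (1 + \<beta> * x \<i>) = (x \<i> - \<beta>) * rr_l \<i> * (\<beta> * x \<i> - 1)"
      using rel2[OF \<i>] x0 by simp
    also have "\<dots> = (x \<i> + \<beta>) * (\<beta> * x \<i> - 1)"
      using rel[OF \<i>] x0 \<alpha> by simp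
    finally have "2 * x \<i> * (1 - \<beta>\<^sup>2) = 0" by (simp add: algebra_simps power2_eq_square)
    then show ?thesis using x_nz[OF \<i>] by simp
  qed
  then have "\<beta> = 1 \<or> \<beta> = - 1" by (rule power2_eq_1_iff[THEN iffD1])
  moreover have "(1 / rr_k \<tau> - \<beta>) * rr_l \<tau> = 1 / rr_k \<tau> + \<beta>" if "Im \<tau> > 0" for \<tau>
    using rel[OF that] x0 \<alpha> by (simp add: x_def)
  ultimately show thesis by (rule that)
qed

lemma rr_kl_relation:
  assumes "Im \<tau> > 0"
  shows "rr_l \<tau> * (1 - rr_k \<tau>) = 1 + rr_k \<tau>"
proof -
  obtain \<beta> where \<beta>: "\<beta> = 1 \<or> \<beta> = - 1"
    and rel: "\<And>\<tau>. Im \<tau> > 0 \<Longrightarrow> (1 / rr_k \<tau> - \<beta>) * rr_l \<tau> = 1 / rr_k \<tau> + \<beta>"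
    using rr_kl_relation_sign by blast
  have "\<beta> \<noteq> - 1"
  proof
    \<comment> \<open>Then \<open>l < 1\<close> on the imaginary axis, so \<open>\<phi> = rr_prod\<close> satisfies \<open>\<phi>(q\<^sup>2) < \<phi>(q)\<^sup>2 < \<phi>(q)\<close>,
      contradicting \<open>\<phi>(q) \<rightarrow> 1\<close> as \<open>q \<rightarrow> 0\<close>.\<close>
    assume "\<beta> = - 1"
    define \<phi> where "\<phi> = (\<lambda>u. Re (rr_prod (of_real u)))"
    have \<phi>: "rr_prod (of_real u) = of_real (\<phi> u)" "0 < \<phi> u" "\<phi> u < 1" if "0 < u" "u < 1" for u
      using rr_prod_real[OF that] unfolding \<phi>_def by (metis Re_complex_of_real)+
    have step: "\<phi> (u ^ 2) < \<phi> u" if u: "0 < u" "u < 1" for u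
    proof -
      define \<tau> where "\<tau> = \<i> * of_real (- ln u / (2 * pi))"
      have \<tau>: "Im \<tau> > 0" using u by (simp add: \<tau>_def field_simps)
      have nome: "nome \<tau> = of_real u"
        using u by (simp add: nome_def \<tau>_def exp_of_real)
      have nome2: "nome (2 * \<tau>) = of_real (u ^ 2)"
        using nome_power[of \<tau> 2] nome by simp
      have u2: "0 < u ^ 2" "u ^ 2 < 1" using u by (auto simp: power_less_one_iff)
      define K where "K = u * (\<phi> u * \<phi> (u ^ 2) ^ 2)"
      have K: "K > 0" using u \<phi>[OF u] \<phi>[OF u2] by (simp add: K_def)
      have k: "rr_k \<tau> = of_real K"
        unfolding rr_k_eq[OF \<tau>] nome nome2 \<phi>(1)[OF u] \<phi>(1)[OF u2] K_def by simp
      have l: "rr_l \<tau> = of_real (\<phi> (u ^ 2) / \<phi> u ^ 2)"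
        unfolding rr_l_eq[OF \<tau>] nome nome2 \<phi>(1)[OF u] \<phi>(1)[OF u2] by simp
      have "complex_of_real ((1 / K + 1) * (\<phi> (u ^ 2) / \<phi> u ^ 2)) = of_real (1 / K - 1)"
        using rel[OF \<tau>] \<open>\<beta> = - 1\<close> unfolding k l by simp
      then have "(1 / K + 1) * (\<phi> (u ^ 2) / \<phi> u ^ 2) = 1 / K - 1" by (simp only: of_real_eq_iff)
      also have "\<dots> < (1 / K + 1) * 1" by simp
      finally have "\<phi> (u ^ 2) / \<phi> u ^ 2 < 1"
        using K by (subst (asm) mult_less_cancel_left_pos) (auto intro: add_pos_pos)
      then have "\<phi> (u ^ 2) < \<phi> u ^ 2" using \<phi>[OF u] by (simp add: divide_less_eq)
      also have "\<phi> u ^ 2 < \<phi> u" using \<phi>[OF u] by (simp add: power2_eq_square)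
      finally show ?thesis .
    qed
    \<comment> \<open>Repeated squaring of 1/2: v tends to 0 while \<phi> cannot increase along it,
      so \<phi> (v n) would stay below \<phi> (v 0) < 1.\<close>
    define v :: "nat \<Rightarrow> real" where "v = (\<lambda>n. (1/2) ^ (2 ^ n))"
    have v: "0 < v n" "v n < 1" for n by (simp_all add: v_def power_less_one_iff)
    have vS: "v (Suc n) = v n ^ 2" for n by (simp add: v_def power_mult[symmetric] mult.commute)
    have le: "\<phi> (v n) \<le> \<phi> (v 0)" for n
    proof (induction n)
      case (Suc n)
      then show ?case using step[OF v, of n] by (simp add: vS)
    qed simp
    have "v \<longlonglongrightarrow> 0"
    proof -
      have "(\<lambda>n. (1/2::real) ^ n) \<longlonglongrightarrow> 0" by (rule LIMSEQ_realpow_zero) auto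
      moreover have "filterlim (\<lambda>n::nat. (2::nat) ^ n) at_top sequentially"
        by (rule filterlim_at_top_mono[OF filterlim_ident]) (auto intro!: always_eventually less_imp_le less_exp)
      ultimately show ?thesis unfolding v_def by (rule filterlim_compose)
    qed
    then have "(\<lambda>n. complex_of_real (v n)) \<longlonglongrightarrow> 0" using tendsto_of_real by fastforce
    then have "(\<lambda>n. rr_prod (of_real (v n))) \<longlonglongrightarrow> rr_prod 0"
      by (rule isCont_tendsto_compose[OF isCont_rr_prod_0])
    from tendsto_Re[OF this] have "(\<lambda>n. \<phi> (v n)) \<longlonglongrightarrow> 1" by (simp add: \<phi>_def)
    then have "1 \<le> \<phi> (v 0)" by (rule LIMSEQ_le_const2) (use le in blast)
    with \<phi>(3)[OF v, of 0] show False by simp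
  qed
  with \<beta> have "\<beta> = 1" by blast
  with rel[OF assms] rr_k_nonzero[OF assms] show ?thesis by (simp add: field_simps)
qed

section \<open>Generators of the function field\<close>

text \<open>Homogenisation. Allowing any N above the degree lets two polynomials share one power of
  the denominator, which then cancels in their quotient.\<close>

lemma poly_linear_fractional:
  fixes p :: "complex poly"
  assumes "degree p \<le> N"
  obtains p' where "\<And>y. \<gamma> * y + \<delta> \<noteq> 0 \<Longrightarrow>
    poly p ((\<alpha> * y + \<beta>) / (\<gamma> * y + \<delta>)) * (\<gamma> * y + \<delta>) ^ N = poly p' y"
proof
  fix y assume nz: "\<gamma> * y + \<delta> \<noteq> 0"
  let ?n = "\<alpha> * y + \<beta>" and ?d = "\<gamma> * y + \<delta>"
  have "poly p (?n / ?d) = (\<Sum>i\<le>N. coeff p i * (?n / ?d) ^ i)"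
    unfolding poly_altdef using assms by (intro sum.mono_neutral_left) (auto simp: coeff_eq_0)
  then have "poly p (?n / ?d) * ?d ^ N = (\<Sum>i\<le>N. coeff p i * (?n / ?d) ^ i * ?d ^ N)"
    by (simp add: sum_distrib_right)
  also have "\<dots> = (\<Sum>i\<le>N. coeff p i * (?n ^ i * ?d ^ (N - i)))"
  proof (rule sum.cong)
    fix i assume "i \<in> {..N}"
    then have "?d ^ N = ?d ^ i * ?d ^ (N - i)" by (simp flip: power_add)
    then show "coeff p i * (?n / ?d) ^ i * ?d ^ N = coeff p i * (?n ^ i * ?d ^ (N - i))"
      using nz by (simp add: power_divide)
  qed simp
  also have "\<dots> = poly (\<Sum>i\<le>N. smult (coeff p i) ([:\<beta>, \<alpha>:] ^ i * [:\<delta>, \<gamma>:] ^ (N - i))) y"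
    by (simp add: poly_sum mult.commute add.commute)
  finally show "poly p (?n / ?d) * ?d ^ N = poly (\<Sum>i\<le>N. smult (coeff p i) ([:\<beta>, \<alpha>:] ^ i * [:\<delta>, \<gamma>:] ^ (N - i))) y" .
qed

text \<open>It is enough to express 1/k by a linear fractional map in F; substituting it into p and
  q keeps the quotient rational.\<close>

lemma modular_in_rational_functions:
  assumes f: "f \<in> modular_functions (Gamma1 10)"
    and F: "\<And>\<tau>. Im \<tau> > 0 \<Longrightarrow> \<gamma> * F \<tau> + \<delta> \<noteq> 0 \<and> 1 / rr_k \<tau> = (\<alpha> * F \<tau> + \<beta>) / (\<gamma> * F \<tau> + \<delta>)"
  shows "f \<in> rational_functions_in F"
proof -
  interpret hauptmodul10 "\<lambda>\<tau>. 1 / rr_k \<tau>" by (rule rr_k_hauptmodul)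
  obtain p q where pq: "\<forall>\<^sub>\<approx>\<tau>\<in>upper_half_plane. poly q (1 / rr_k \<tau>) \<noteq> 0 \<and> f \<tau> = poly p (1 / rr_k \<tau>) / poly q (1 / rr_k \<tau>)"
    using modular_function_rational[OF f] by blast
  define N where "N = max (degree p) (degree q)"
  obtain p' where p': "\<And>y. \<gamma> * y + \<delta> \<noteq> 0 \<Longrightarrow> poly p ((\<alpha> * y + \<beta>) / (\<gamma> * y + \<delta>)) * (\<gamma> * y + \<delta>) ^ N = poly p' y"
    using poly_linear_fractional[of p N \<gamma> \<delta> \<alpha> \<beta>] by (auto simp: N_def)
  obtain q' where q': "\<And>y. \<gamma> * y + \<delta> \<noteq> 0 \<Longrightarrow> poly q ((\<alpha> * y + \<beta>) / (\<gamma> * y + \<delta>)) * (\<gamma> * y + \<delta>) ^ N = poly q' y"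
    using poly_linear_fractional[of q N \<gamma> \<delta> \<alpha> \<beta>] by (auto simp: N_def)
  have "\<forall>\<^sub>\<approx>\<tau>\<in>upper_half_plane. \<tau> \<in> upper_half_plane"
    by (intro eventually_in_cosparse open_upper_half_plane order_refl)
  with pq have "\<forall>\<^sub>\<approx>\<tau>\<in>upper_half_plane. poly q' (F \<tau>) \<noteq> 0 \<and> f \<tau> = poly p' (F \<tau>) / poly q' (F \<tau>)"
  proof eventually_elim
    case (elim \<tau>)
    then have "Im \<tau> > 0" by (simp add: upper_half_plane_def)
    note F = F[OF this]
    have "poly p' (F \<tau>) = poly p (1 / rr_k \<tau>) * (\<gamma> * F \<tau> + \<delta>) ^ N"
      "poly q' (F \<tau>) = poly q (1 / rr_k \<tau>) * (\<gamma> * F \<tau> + \<delta>) ^ N"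
      using p'[of "F \<tau>"] q'[of "F \<tau>"] F by simp_all
    with elim F show ?case by simp
  qed
  then show ?thesis
    using f by (auto simp: rational_functions_in_def modular_functions_def)
qed

section \<open>Local order of a function with a rational left inverse\<close>

lemma powi_tendsto_imp_0:
  assumes "((\<lambda>y::complex. y powi e) \<longlongrightarrow> L) (at 0)" "L \<noteq> 0"
  shows "e = 0"
proof -
  have pos: "((\<lambda>y::complex. y powi i) \<longlongrightarrow> 0) (at 0)" if "i > 0" for i
  proof -
    have "((\<lambda>y::complex. y ^ nat i) \<longlongrightarrow> 0 ^ nat i) (at 0)" by (intro tendsto_intros)
    then show ?thesis using that by (simp add: power_int_def power_0_left)
  qed
  consider "e > 0" | "e = 0" | "- e > 0" by linarith
  then show ?thesis
  proof cases
    case 1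
    then show ?thesis using tendsto_unique[OF _ assms(1) pos[OF 1]] assms(2) by simp
  next
    case 3
    have "((\<lambda>y. y powi e * y powi (- e)) \<longlongrightarrow> L * 0) (at 0)"
      by (intro tendsto_mult assms pos 3)
    moreover have "\<forall>\<^sub>F y in at (0::complex). y powi e * y powi (- e) = 1"
      by (auto simp: eventually_at_filter power_int_minus)
    ultimately have "((\<lambda>y::complex. 1) \<longlongrightarrow> (0::complex)) (at 0)"
      by (auto intro: Lim_transform_eventually)
    then show ?thesis by (simp add: tendsto_const_iff)
  qed
qed

text \<open>If \<open>y = p(S y) / q(S y)\<close> then comparing orders of vanishing at \<open>0\<close> shows that the order
  of \<open>S\<close> divides \<open>1\<close>.\<close>

lemma left_inverse_order_pos:
  fixes S :: "complex \<Rightarrow> complex"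
  assumes m: "m > 0" and lim: "((\<lambda>y. S y / y ^ m) \<longlongrightarrow> c) (at 0)" "c \<noteq> 0"
    and ev: "\<forall>\<^sub>F y in at 0. y * poly q (S y) = poly p (S y)" and q: "q \<noteq> 0"
  shows "m = 1"
proof -
  define T where "T = (\<lambda>y. S y / y ^ m)"
  have nz: "\<forall>\<^sub>F y in at 0. (y::complex) \<noteq> 0" by (simp add: eventually_at_filter)
  have S: "\<forall>\<^sub>F y in at 0. S y = T y * y ^ m"
    using nz by eventually_elim (simp add: T_def)
  have T: "(T \<longlongrightarrow> c) (at 0)" using lim by (simp add: T_def)
  have T_nz: "\<forall>\<^sub>F y in at 0. T y \<noteq> 0" using tendsto_imp_eventually_ne[OF T lim(2)] .
  have "((\<lambda>y. T y * y ^ m) \<longlongrightarrow> c * 0 ^ m) (at 0)" by (intro tendsto_intros T)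
  moreover have "\<forall>\<^sub>F y in at 0. T y * y ^ m = S y" using S by eventually_elim simp
  ultimately have "(S \<longlongrightarrow> c * 0 ^ m) (at 0)" by (rule Lim_transform_eventually)
  then have S0: "(S \<longlongrightarrow> 0) (at 0)" using m by (simp add: power_0_left)
  obtain q1 where q1: "q = [:- 0, 1:] ^ order 0 q * q1" "\<not> [:- 0, 1:] dvd q1"
    using order_decomp[OF q, of 0] by blast
  define j where "j = order 0 q"
  have q1_0: "poly q1 0 \<noteq> 0" using q1(2) by (simp add: poly_eq_0_iff_dvd)
  have q_eq: "poly q z = z ^ j * poly q1 z" for z by (subst q1(1)) (simp add: j_def)
  have q1_lim: "((\<lambda>y. poly q1 (S y)) \<longlongrightarrow> poly q1 0) (at 0)" by (intro tendsto_intros S0)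
  have q1_nz: "\<forall>\<^sub>F y in at 0. poly q1 (S y) \<noteq> 0" using tendsto_imp_eventually_ne[OF q1_lim q1_0] .
  have "p \<noteq> 0"
  proof
    assume "p = 0"
    have "\<forall>\<^sub>F y in at (0::complex). False"
      using ev nz S T_nz q1_nz by eventually_elim (auto simp: q_eq \<open>p = 0\<close>)
    then show False by simp
  qed
  then obtain p1 where p1: "p = [:- 0, 1:] ^ order 0 p * p1" "\<not> [:- 0, 1:] dvd p1"
    using order_decomp[of p 0] by blast
  define i where "i = order 0 p"
  have p1_0: "poly p1 0 \<noteq> 0" using p1(2) by (simp add: poly_eq_0_iff_dvd)
  have p_eq: "poly p z = z ^ i * poly p1 z" for z by (subst p1(1)) (simp add: i_def)
  have p1_lim: "((\<lambda>y. poly p1 (S y)) \<longlongrightarrow> poly p1 0) (at 0)" by (intro tendsto_intros S0)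
  \<comment> \<open>With p = z^i p1, q = z^j q1 and S = T y^m, the equation equates y^e with a
    function having a nonzero limit. So e = 0, that is m (i - j) = 1.\<close>
  define e where "e = 1 + int (m * j) - int (m * i)"
  have "((\<lambda>y. (T y ^ i * poly p1 (S y)) / (T y ^ j * poly q1 (S y))) \<longlongrightarrow>
      (c ^ i * poly p1 0) / (c ^ j * poly q1 0)) (at 0)"
    using lim(2) q1_0 by (intro tendsto_intros T p1_lim q1_lim) auto
  moreover have "\<forall>\<^sub>F y in at 0. (T y ^ i * poly p1 (S y)) / (T y ^ j * poly q1 (S y)) = y powi e"
    using ev nz S T_nz q1_nz
  proof eventually_elim
    case (elim y)
    have "y * ((T y * y ^ m) ^ j * poly q1 (S y)) = (T y * y ^ m) ^ i * poly p1 (S y)"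
      using elim(1) unfolding q_eq p_eq by (simp only: elim(3)[symmetric])
    then have "(y * y ^ (m * j)) * (T y ^ j * poly q1 (S y)) = y ^ (m * i) * (T y ^ i * poly p1 (S y))"
      by (simp add: power_mult_distrib mult_ac flip: power_mult)
    moreover have "y powi e = (y * y ^ (m * j)) / y ^ (m * i)"
    proof -
      have "y powi (1 + int u - int v) = y * y ^ u / y ^ v" for u v
        using elim(2) by (simp add: power_int_diff power_int_add)
      then show ?thesis unfolding e_def .
    qed
    moreover have "A / B = r" if "u * B = v * A" "r = u / v" "v \<noteq> 0" "B \<noteq> 0" for A B u v r :: complex
      unfolding that(2) using that(1,3,4) by (simp add: frac_eq_eq mult.commute)
    ultimately show ?case by (metis elim(2,4,5) mult_eq_0_iff power_not_zero)
  qed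
  ultimately have "((\<lambda>y. y powi e) \<longlongrightarrow> (c ^ i * poly p1 0) / (c ^ j * poly q1 0)) (at 0)"
    by (rule Lim_transform_eventually)
  then have "e = 0" by (rule powi_tendsto_imp_0) (use lim(2) p1_0 q1_0 in auto)
  then have "int m * (int i - int j) = 1" by (simp add: e_def algebra_simps)
  then show ?thesis using m by (simp add: zmult_eq_1_iff)
qed

text \<open>For a pole of S pass to 1/S, replacing p and q by their reversals of common degree bound
  N.\<close>

lemma left_inverse_order:
  fixes S :: "complex \<Rightarrow> complex"
  assumes m: "m \<noteq> 0" and lim: "((\<lambda>y. S y / y powi m) \<longlongrightarrow> c) (at 0)" "c \<noteq> 0"
    and ev: "\<forall>\<^sub>F y in at 0. y * poly q (S y) = poly p (S y)" and q: "q \<noteq> 0"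
  shows "\<bar>m\<bar> = 1"
proof (cases "m > 0")
  case True
  then have "nat m = 1"
    using lim by (intro left_inverse_order_pos[OF _ _ lim(2) ev q]) (auto simp: power_int_def)
  then show ?thesis using True by simp
next
  case False
  define N where "N = max (degree p) (degree q)"
  obtain p' where p': "\<And>z. z \<noteq> 0 \<Longrightarrow> poly p (1 / z) * z ^ N = poly p' z"
    using poly_linear_fractional[of p N 1 0 0 1] by (auto simp: N_def)
  obtain q' where q': "\<And>z. z \<noteq> 0 \<Longrightarrow> poly q (1 / z) * z ^ N = poly q' z"
    using poly_linear_fractional[of q N 1 0 0 1] by (auto simp: N_def)
  have "q' \<noteq> 0"
  proof
    assume "q' = 0"
    have "poly q y = 0" if "y \<noteq> 0" for y using q'[of "1 / y"] that \<open>q' = 0\<close> by simp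
    then have "UNIV \<subseteq> insert 0 {y. poly q y = 0}" by auto
    moreover have "finite (insert 0 {y. poly q y = 0})" using poly_roots_finite[OF q] by simp
    ultimately show False using infinite_UNIV_char_0 finite_subset by blast
  qed
  have "\<forall>\<^sub>F y in at 0. S y / y powi m \<noteq> 0" using tendsto_imp_eventually_ne[OF lim] .
  with ev have ev': "\<forall>\<^sub>F y in at 0. y * poly q' (1 / S y) = poly p' (1 / S y)"
  proof eventually_elim
    case (elim y)
    then have "S y \<noteq> 0" by auto
    then show ?case using elim(1) p'[of "1 / S y"] q'[of "1 / S y"] by (simp add: field_simps)
  qed
  have "((\<lambda>y. 1 / (S y / y powi m)) \<longlongrightarrow> 1 / c) (at 0)"
    by (intro tendsto_intros lim)
  moreover have "1 / (S y / y powi m) = (1 / S y) / y ^ nat (- m)" for y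
    using False by (simp add: power_int_def divide_simps)
  ultimately have "nat (- m) = 1"
    using m False lim(2) by (intro left_inverse_order_pos[OF _ _ _ ev' \<open>q' \<noteq> 0\<close>, where c = "1 / c"]) auto
  then show ?thesis using False by simp
qed

section \<open>Values omitted by k, and exponents of a generator\<close>

lemma divide_halves: "(d::complex) \<noteq> 0 \<Longrightarrow> (2 / d) / (2 * k / d) = 1 / k"
  by (cases "k = 0") (simp_all add: field_simps)

text \<open>The relation excludes k = 1, which gives 0 = 2, and k = -1, which gives l = 0.\<close>

lemma rr_k_values:
  assumes "Im \<tau> > 0"
  shows "rr_k \<tau> \<noteq> 0" "rr_k \<tau> \<noteq> 1" "rr_k \<tau> \<noteq> - 1" "rr_l \<tau> = (1 + rr_k \<tau>) / (1 - rr_k \<tau>)"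
proof -
  note rel = rr_kl_relation[OF assms]
  show "rr_k \<tau> \<noteq> 0" by (rule rr_k_nonzero[OF assms])
  show 1: "rr_k \<tau> \<noteq> 1" using rel by auto
  show "rr_k \<tau> \<noteq> - 1" using rel rr_l_nonzero[OF assms] by auto
  show "rr_l \<tau> = (1 + rr_k \<tau>) / (1 - rr_k \<tau>)" using rel 1 by (simp add: field_simps)
qed

lemma rr_k_holomorphic: "rr_k holomorphic_on upper_half_plane"
  unfolding rr_k_eq_mono by (rule rr_mono_holomorphic)

lemma rr_k_not_constant: "\<not> rr_k constant_on upper_half_plane"
proof
  assume "rr_k constant_on upper_half_plane"
  then obtain c where c: "\<And>\<tau>. Im \<tau> > 0 \<Longrightarrow> rr_k \<tau> = c"
    by (auto simp: constant_on_def upper_half_plane_def)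
  have "cusp_order (\<lambda>\<tau>. rr_mono 1 2 (moeb 1 0 0 1 \<tau>)) (if even (0::int) then of_int (1 + 2 * 2) * of_int (rr_sign 1 0) / 5 else of_int (2 * 1 - 2) * of_int (rr_sign 1 0) / 10)"
    by (rule rr_mono_cusp_order) simp
  then have "cusp_order rr_k 1" by (simp add: rr_k_eq_mono rr_sign_def)
  then obtain L where "((\<lambda>\<tau>. rr_k \<tau> / nome \<tau>) \<longlongrightarrow> L) at_ii" by (auto simp: cusp_order_def)
  from tendsto_mult[OF this nome_tendsto_0] have "(rr_k \<longlongrightarrow> 0) at_ii" by simp
  moreover have "\<forall>\<^sub>F \<tau> in at_ii. rr_k \<tau> = c" using eventually_at_ii_gt[of 0] by eventually_elim (rule c)
  ultimately have "((\<lambda>_. c) \<longlongrightarrow> 0) at_ii" by (rule Lim_transform_eventually)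
  then have "c = 0" by (simp add: tendsto_const_iff)
  with c[of \<i>] rr_k_nonzero[of \<i>] show False by simp
qed

text \<open>F = S(k) with S(y) = y^m ((1+y)/(1-y))^n. If k = p(F)/q(F), then y q(S y) = p(S y) on
  the image of k, and by continuation on all of U. The orders of S at y = 0 and y = -1 are m and
  n.\<close>

lemma generator_exponents:
  assumes F: "\<And>\<tau>. Im \<tau> > 0 \<Longrightarrow> F \<tau> = rr_k \<tau> powi m * rr_l \<tau> powi n"
    and gen: "rr_k \<in> rational_functions_in F"
  shows "(m = 0 \<or> \<bar>m\<bar> = 1) \<and> (n = 0 \<or> \<bar>n\<bar> = 1) \<and> (m = 0 \<or> n = 0)"
proof -
  obtain p q where pq: "\<forall>\<^sub>\<approx>\<tau>\<in>upper_half_plane. poly q (F \<tau>) \<noteq> 0 \<and> rr_k \<tau> = poly p (F \<tau>) / poly q (F \<tau>)"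
    using gen by (auto simp: rational_functions_in_def)
  define U where "U = - {0, 1, - 1 :: complex}"
  define S where "S = (\<lambda>y::complex. y powi m * ((1 + y) / (1 - y)) powi n)"
  have U: "y \<in> U \<longleftrightarrow> y \<noteq> 0 \<and> 1 - y \<noteq> 0 \<and> 1 + y \<noteq> 0" for y
    by (auto simp: U_def add_eq_0_iff)
  have kU: "rr_k \<tau> \<in> U" if "Im \<tau> > 0" for \<tau> using rr_k_values[OF that] by (simp add: U_def)
  have FS: "F \<tau> = S (rr_k \<tau>)" if "Im \<tau> > 0" for \<tau>
    using F[OF that] rr_k_values[OF that] by (simp add: S_def)
  have openU: "open U" unfolding U_def by (intro open_Compl finite_imp_closed) simp
  have connU: "connected U"
    unfolding U_def Compl_eq_Diff_UNIV by (intro connected_open_diff_countable) auto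
  define E where "E = (\<lambda>y. y * poly q (S y) - poly p (S y))"
  have "S holomorphic_on U" unfolding S_def by (intro holomorphic_intros) (auto simp: U)
  then have E_hol: "E holomorphic_on U" unfolding E_def by (intro holomorphic_intros poly_holomorphic_on)
  have inH: "\<forall>\<^sub>\<approx>\<tau>\<in>upper_half_plane. \<tau> \<in> upper_half_plane"
    by (intro eventually_in_cosparse open_upper_half_plane order_refl)
  have nonbot: "cosparse upper_half_plane \<noteq> bot"
  proof -
    have "\<i> \<in> upper_half_plane" by (simp add: upper_half_plane_def)
    then show ?thesis by auto
  qed
  have E_co: "\<forall>\<^sub>\<approx>\<tau>\<in>upper_half_plane. E (rr_k \<tau>) = 0"
    using pq inH
  proof eventually_elim
    case (elim \<tau>)
    then have "E (rr_k \<tau>) = rr_k \<tau> * poly q (F \<tau>) - poly p (F \<tau>)"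
      by (simp add: E_def FS upper_half_plane_def)
    also have "\<dots> = 0" using elim by (metis diff_self nonzero_divide_eq_eq)
    finally show ?case .
  qed
  have Ek: "E (rr_k \<tau>) = 0" if "\<tau> \<in> upper_half_plane" for \<tau>
  proof -
    have "(E \<circ> rr_k) holomorphic_on upper_half_plane"
      using kU by (intro holomorphic_on_compose_gen[OF rr_k_holomorphic E_hol]) (auto simp: upper_half_plane_def)
    then have "(\<lambda>\<tau>. E (rr_k \<tau>)) nicely_meromorphic_on upper_half_plane"
      using open_upper_half_plane
      by (intro analytic_on_imp_nicely_meromorphic_on) (simp add: analytic_on_open o_def)
    from nicely_meromorphic_imp_constant_or_avoid[OF this open_upper_half_plane connected_upper_half_plane, of 0]
    show ?thesis
    proof
      assume "\<forall>\<^sub>\<approx>\<tau>\<in>upper_half_plane. E (rr_k \<tau>) \<noteq> 0"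
      with E_co have "\<forall>\<^sub>\<approx>\<tau>\<in>upper_half_plane. False" by eventually_elim auto
      with nonbot show ?thesis by (simp add: trivial_limit_def)
    qed (use that in blast)
  qed
  \<comment> \<open>The image of k is open by the open mapping theorem, and U is connected.\<close>
  have E0: "y * poly q (S y) = poly p (S y)" if "y \<in> U" for y
  proof -
    have "E y = 0"
    proof (rule analytic_continuation_open[of "rr_k ` upper_half_plane" U E "\<lambda>_. 0"])
      show "open (rr_k ` upper_half_plane)"
        using rr_k_not_constant
        by (intro open_mapping_thm[OF rr_k_holomorphic] open_upper_half_plane connected_upper_half_plane) auto
      show "rr_k ` upper_half_plane \<noteq> {}" using nonbot by auto
      show "rr_k ` upper_half_plane \<subseteq> U" using kU by (auto simp: upper_half_plane_def)
    qed (use openU connU E_hol Ek that in auto)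
    then show ?thesis by (simp add: E_def)
  qed
  \<comment> \<open>Supplies test points at which q(S y) is nonzero and a given nonzero polynomial
    in 1/y does not vanish; 1/y appears because \<open>poly_x_nonzero\<close> is about 1/k.\<close>
  have ex: "\<exists>y\<in>U. poly q (S y) \<noteq> 0 \<and> poly r (1 / y) \<noteq> 0" if "r \<noteq> 0" for r
  proof -
    interpret hauptmodul10 "\<lambda>\<tau>. 1 / rr_k \<tau>" by (rule rr_k_hauptmodul)
    from pq inH poly_x_nonzero[OF that]
    have "\<forall>\<^sub>\<approx>\<tau>\<in>upper_half_plane. \<tau> \<in> upper_half_plane \<and> poly q (F \<tau>) \<noteq> 0 \<and> poly r (1 / rr_k \<tau>) \<noteq> 0"
      by eventually_elim simp
    then obtain \<tau> where "\<tau> \<in> upper_half_plane" "poly q (F \<tau>) \<noteq> 0" "poly r (1 / rr_k \<tau>) \<noteq> 0"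
      using eventually_happens'[OF nonbot] by blast
    then show ?thesis using kU FS by (auto simp: upper_half_plane_def)
  qed
  obtain y0 where y0: "y0 \<in> U" "poly q (S y0) \<noteq> 0" using ex[of 1] by auto
  have m1: "\<bar>m\<bar> = 1" if "m \<noteq> 0"
  proof (rule left_inverse_order[OF that])
    have "((\<lambda>y. ((1 + y) / (1 - y)) powi n) \<longlongrightarrow> ((1 + 0) / (1 - 0)) powi n) (at (0::complex))"
      by (intro tendsto_power_int tendsto_intros) auto
    moreover have "\<forall>\<^sub>F y in at 0. ((1 + y) / (1 - y)) powi n = S y / y powi m"
      by (auto simp: eventually_at_filter S_def)
    ultimately show "((\<lambda>y. S y / y powi m) \<longlongrightarrow> 1) (at 0)"
      by (auto intro: Lim_transform_eventually)
    have "\<forall>\<^sub>F y in at 0. y \<in> ball 0 1 - {0::complex}"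
      by (intro eventually_at_in_open) auto
    then show "\<forall>\<^sub>F y in at 0. y * poly q (S y) = poly p (S y)"
      by eventually_elim (auto intro!: E0 simp: U_def)
    show "q \<noteq> 0" using y0 by auto
  qed simp
  have n1: "\<bar>n\<bar> = 1" if "n \<noteq> 0"
  proof (rule left_inverse_order[OF that])
    \<comment> \<open>The inverse of z = (1+y)/(1-y), taking z = 0 to y = -1. In this coordinate y =
      p/q becomes z = (q+p)/(q-p).\<close>
    let ?y = "\<lambda>z::complex. (z - 1) / (z + 1)"
    have "((\<lambda>z. ?y z powi m) \<longlongrightarrow> ((0 - 1) / (0 + 1)) powi m) (at (0::complex))"
      by (intro tendsto_power_int tendsto_intros) auto
    moreover have ev: "\<forall>\<^sub>F z in at 0. z \<in> ball 0 1 - {0::complex}"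
      by (intro eventually_at_in_open) auto
    have y: "(1 + ?y z) / (1 - ?y z) = z" "?y z \<in> U" "z + 1 \<noteq> 0" if "z \<in> ball 0 1 - {0}" for z
    proof -
      have z: "z \<noteq> 0" "z + 1 \<noteq> 0" "z - 1 \<noteq> 0" using that by (auto simp: add_eq_0_iff2)
      have "1 + ?y z = 2 * z / (z + 1)" "1 - ?y z = 2 / (z + 1)" using z by (simp_all add: field_simps)
      with z show "(1 + ?y z) / (1 - ?y z) = z" "?y z \<in> U" "z + 1 \<noteq> 0" by (auto simp: U)
    qed
    from ev have "\<forall>\<^sub>F z in at 0. ?y z powi m = S (?y z) / z powi n"
      by eventually_elim (use y in \<open>auto simp: S_def\<close>)
    ultimately show "((\<lambda>z. S (?y z) / z powi n) \<longlongrightarrow> (- 1) powi m) (at 0)"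
      by (auto intro: Lim_transform_eventually)
    from ev show "\<forall>\<^sub>F z in at 0. z * poly (q - p) (S (?y z)) = poly (q + p) (S (?y z))"
    proof eventually_elim
      case (elim z)
      from E0[OF y(2)[OF elim]] y(3)[OF elim] show ?case by (simp add: field_simps)
    qed
    have "poly p (S y0) \<noteq> poly q (S y0)"
      using E0[OF y0(1)] y0 by (auto simp: U_def)
    then show "q - p \<noteq> 0" by auto
  qed simp
  have "m = 0 \<or> n = 0"
  proof (rule ccontr)
    \<comment> \<open>\<open>S\<close> has degree 2 in these cases, so it is invariant under an involution.\<close>
    assume "\<not> (m = 0 \<or> n = 0)"
    then have mn: "\<bar>m\<bar> = 1" "\<bar>n\<bar> = 1" using m1 n1 by auto
    show False
    proof (cases "m = n")
      case True
      \<comment> \<open>The polynomial at 1/y vanishes exactly at the fixed points of the involution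
        y' below, so y and y' are distinct.\<close>
      obtain y where y: "y \<in> U" "poly q (S y) \<noteq> 0" "poly [:1, - 2, - 1:] (1 / y) \<noteq> 0"
        using ex[of "[:1, - 2, - 1:]"] by auto
      \<comment> \<open>With w = (1+y)/(1-y), this map sends the pair (y, w) to (-w, -y) and so
        preserves the product y w.\<close>
      define y' where "y' = - (1 + y) / (1 - y)"
      have nz: "y \<noteq> 0" "1 - y \<noteq> 0" "1 + y \<noteq> 0" using y(1) by (auto simp: U)
      have "1 + y' = - 2 * y / (1 - y)" "1 - y' = 2 / (1 - y)" using nz by (simp_all add: y'_def field_simps)
      then have y': "y' \<in> U" "(1 + y') / (1 - y') = - y" using nz by (auto simp: U y'_def)
      have "y' * - y = y * ((1 + y) / (1 - y))" using nz by (simp add: y'_def field_simps)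
      then have "S y' = S y"
        unfolding S_def y'(2) True by (simp only: power_int_mult_distrib[symmetric])
      then have "y' = y" using E0[OF y(1)] E0[OF y'(1)] y(2) by (metis mult_right_cancel)
      then have "- (1 + y) = y * (1 - y)" unfolding y'_def using nz by (simp add: field_simps)
      then have "y * y - 2 * y - 1 = 0" by (simp add: algebra_simps)
      moreover have "poly [:1, - 2, - 1:] (1 / y) = (y * y - 2 * y - 1) / (y * y)"
        using nz by (simp add: field_simps)
      ultimately show False using y(3) by simp
    next
      case False
      then have nm: "n = - m" using mn by linarith
      obtain y where y: "y \<in> U" "poly q (S y) \<noteq> 0" "poly [:1, 2, - 1:] (1 / y) \<noteq> 0"
        using ex[of "[:1, 2, - 1:]"] by auto
      \<comment> \<open>With w = (1+y)/(1-y), this map sends (y, w) to (1/w, 1/y) and so preserves y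
        / w.\<close>
      define y' where "y' = (1 - y) / (1 + y)"
      have nz: "y \<noteq> 0" "1 - y \<noteq> 0" "1 + y \<noteq> 0" using y(1) by (auto simp: U)
      have "1 + y' = 2 / (1 + y)" "1 - y' = 2 * y / (1 + y)" using nz by (simp_all add: y'_def field_simps)
      moreover from this have "y' \<in> U" using nz by (auto simp: U y'_def)
      ultimately have y': "y' \<in> U" "(1 + y') / (1 - y') = 1 / y"
        using divide_halves[OF nz(3), of y] by simp_all
      have S': "S z = (z * ((1 - z) / (1 + z))) powi m" for z
        unfolding S_def nm power_int_mult_distrib power_int_minus_left power_int_minus power_int_inverse[symmetric] by simp
      have "(1 - y') / (1 + y') = y" using y'(2) by (metis divide_divide_eq_right div_by_1 inverse_eq_divide inverse_divide inverse_inverse_eq mult_1)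
      then have "S y' = S y" unfolding S' by (simp add: y'_def mult.commute)
      then have "y' = y" using E0[OF y(1)] E0[OF y'(1)] y(2) by (metis mult_right_cancel)
      then have "1 - y = y * (1 + y)" unfolding y'_def using nz by (simp add: field_simps)
      then have "y * y + 2 * y - 1 = 0" by (simp add: algebra_simps)
      moreover have "poly [:1, 2, - 1:] (1 / y) = (y * y + 2 * y - 1) / (y * y)"
        using nz by (simp add: field_simps)
      ultimately show False using y(3) by simp
    qed
  qed
  with m1 n1 show ?thesis by blast
qed

text \<open>The orders at i infinity and at 1/5 are multiples of m + 2n and 2m - n, independent
  linear forms in the exponents.\<close>

lemma rr_mono_inj:
  assumes "eq_on_H (rr_mono a b) (rr_mono a' b')"
  shows "a = a' \<and> b = b'"
proof -
  define m n where "m = a - a'" and "n = b - b'"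
  have 1: "rr_mono m n \<tau> = 1" if "Im \<tau> > 0" for \<tau>
  proof -
    have "rr_cf \<tau> \<noteq> 0" "rr_cf (2 * \<tau>) \<noteq> 0" using that rr_cf_nonzero[of \<tau>] rr_cf_nonzero[of "2 * \<tau>"] by simp_all
    then have "rr_mono m n \<tau> = rr_mono a b \<tau> / rr_mono a' b' \<tau>"
      by (simp add: rr_mono_def m_def n_def power_int_diff)
    then show ?thesis
      using assms that rr_mono_nonzero[OF that] by (simp add: eq_on_H_def upper_half_plane_def)
  qed
  have ord0: "e = 0" if e: "cusp_order (\<lambda>\<tau>. rr_mono m n (mobius A \<tau>)) e" and A: "A \<in> SL2Z" for A e
  proof -
    have const: "cusp_order (\<lambda>_. 1) e"
      using e by (rule cusp_order_cong)
        (use eventually_at_ii_gt[of 0] in eventually_elim, simp add: 1 Im_mobius_pos[OF A])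
    have no: "\<not> e > 0" if ord: "cusp_order (\<lambda>_. 1) e" for e
    proof
      assume "e > 0"
      obtain L where "((\<lambda>\<tau>. 1 / nome (of_real e * \<tau>)) \<longlongrightarrow> L) at_ii"
        using ord by (auto simp: cusp_order_def)
      from tendsto_mult[OF this nome_scaled_tendsto_0[OF \<open>e > 0\<close>]]
      have "((\<lambda>_. 1) \<longlongrightarrow> (0::complex)) at_ii" by simp
      then show False by (simp add: tendsto_const_iff)
    qed
    from no[OF const] no[OF cusp_order_inverse[OF const, simplified]] show ?thesis by linarith
  qed
  have "mat2 1 0 0 1 \<in> SL2Z" by (simp add: SL2Z_iff)
  from ord0[OF rr_mono_mobius_order[OF this] this] have "real_of_int (m + 2 * n) = 0"
    by (simp add: rr_sign_def)
  moreover from ord0[OF rr_mono_mobius_order[OF Cmat_SL2Z] Cmat_SL2Z] have "real_of_int (2 * m - n) = 0"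
    by (simp add: Cmat_def rr_sign_def)
  ultimately have "m + 2 * n = 0" "2 * m - n = 0" by (simp_all only: of_int_eq_0_iff)
  then show ?thesis by (auto simp: m_def n_def)
qed

text \<open>The last two conjuncts make the count exact: k and l remain distinct up to taking
  reciprocals.\<close>

theorem theorem3p1:
  fixes a b :: int and F :: "complex \<Rightarrow> complex"
  assumes "(a, b) \<noteq> (0, 0)"
    and "[a = 3 * b] (mod 5)"
    and "F = (\<lambda>\<tau>. rr_cf \<tau> powi a * rr_cf (2 * \<tau>) powi b)"
  shows "F \<in> modular_functions (Gamma1 10) \<and>
    (modular_functions (Gamma1 10) = rational_functions_in F \<longleftrightarrow>
       (\<exists>G \<in> {rr_k, (\<lambda>\<tau>. 1 / rr_k \<tau>), rr_l, (\<lambda>\<tau>. 1 / rr_l \<tau>)}. eq_on_H F G)) \<and>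
    ((\<exists>G \<in> {rr_k, (\<lambda>\<tau>. 1 / rr_k \<tau>), rr_l, (\<lambda>\<tau>. 1 / rr_l \<tau>)}. eq_on_H F G) \<longleftrightarrow>
       (a, b) \<in> {(1, 2), (-1, -2), (-2, 1), (2, -1)}) \<and>
    \<not> eq_on_H rr_k rr_l \<and> \<not> eq_on_H rr_k (\<lambda>\<tau>. 1 / rr_l \<tau>)"
proof -
  have F: "F = rr_mono a b" using assms(3) by (auto simp: rr_mono_def)
  have mod5: "a mod 5 = (3 * b) mod 5" using assms(2) by (simp add: cong_def)
  have modular: "F \<in> modular_functions (Gamma1 10)"
    unfolding F by (rule rr_mono_modular) (use mod5 in presburger)
  have G_iff: "(\<exists>G \<in> {rr_k, (\<lambda>\<tau>. 1 / rr_k \<tau>), rr_l, (\<lambda>\<tau>. 1 / rr_l \<tau>)}. eq_on_H F G) \<longleftrightarrow>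
       (a, b) \<in> {(1, 2), (-1, -2), (-2, 1), (2, -1)}"
  proof -
    have "eq_on_H (rr_mono a b) (rr_mono a' b') \<longleftrightarrow> (a, b) = (a', b')" for a' b'
      using rr_mono_inj[of a b a' b'] by (auto simp: eq_on_H_def)
    then show ?thesis
      unfolding F inverse_rr_k_eq_mono inverse_rr_l_eq_mono
        unfolding rr_k_eq_mono rr_l_eq_mono by simp
  qed
  have gen: "modular_functions (Gamma1 10) = rational_functions_in F"
    if ab: "(a, b) \<in> {(1, 2), (-1, -2), (-2, 1), (2, -1)}"
  proof
    show "rational_functions_in F \<subseteq> modular_functions (Gamma1 10)"
      by (rule rational_functions_in_subset[OF modular])
    show "modular_functions (Gamma1 10) \<subseteq> rational_functions_in F"
    proof
      fix f assume f: "f \<in> modular_functions (Gamma1 10)"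
      consider "F = rr_k" | "F = (\<lambda>\<tau>. 1 / rr_k \<tau>)" | "F = rr_l" | "F = (\<lambda>\<tau>. 1 / rr_l \<tau>)"
        using ab unfolding F inverse_rr_k_eq_mono inverse_rr_l_eq_mono
        unfolding rr_k_eq_mono rr_l_eq_mono by auto
      then show "f \<in> rational_functions_in F"
      proof cases
        case 1
        show ?thesis
          by (rule modular_in_rational_functions[OF f, of 1 _ 0 0 1]) (auto simp: 1 rr_k_values)
      next
        case 2
        show ?thesis
          by (rule modular_in_rational_functions[OF f, of 0 _ 1 1 0]) (auto simp: 2)
      next
        case 3
        show ?thesis
        \<comment> \<open>Solving l = (1+k)/(1-k) for 1/k gives (l+1)/(l-1); for 1/l the denominator
          changes sign.\<close>
        proof (rule modular_in_rational_functions[OF f, of 1 _ "- 1" 1 1])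
          fix \<tau> assume \<tau>: "Im \<tau> > 0"
          have nz: "1 - rr_k \<tau> \<noteq> 0" using rr_k_values[OF \<tau>] by auto
          then have e: "1 * F \<tau> + - 1 = 2 * rr_k \<tau> / (1 - rr_k \<tau>)" "1 * F \<tau> + 1 = 2 / (1 - rr_k \<tau>)"
            unfolding 3 rr_k_values(4)[OF \<tau>] by (simp_all add: field_simps)
          show "1 * F \<tau> + - 1 \<noteq> 0 \<and> 1 / rr_k \<tau> = (1 * F \<tau> + 1) / (1 * F \<tau> + - 1)"
            unfolding e divide_halves[OF nz] using rr_k_values(1)[OF \<tau>] nz by simp
        qed
      next
        case 4
        show ?thesis
        proof (rule modular_in_rational_functions[OF f, of "- 1" _ 1 1 1])
          fix \<tau> assume \<tau>: "Im \<tau> > 0"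
          have nz: "1 - rr_k \<tau> \<noteq> 0" "1 + rr_k \<tau> \<noteq> 0" using rr_k_values[OF \<tau>] by (auto simp: add_eq_0_iff)
          then have e: "- 1 * F \<tau> + 1 = 2 * rr_k \<tau> / (1 + rr_k \<tau>)" "1 * F \<tau> + 1 = 2 / (1 + rr_k \<tau>)"
            unfolding 4 rr_k_values(4)[OF \<tau>] by (simp_all add: field_simps)
          show "- 1 * F \<tau> + 1 \<noteq> 0 \<and> 1 / rr_k \<tau> = (1 * F \<tau> + 1) / (- 1 * F \<tau> + 1)"
            unfolding e divide_halves[OF nz(2)] using rr_k_values(1)[OF \<tau>] nz by simp
        qed
      qed
    qed
  qed
  have nongen: "(a, b) \<in> {(1, 2), (-1, -2), (-2, 1), (2, -1)}"
    if eq: "modular_functions (Gamma1 10) = rational_functions_in F"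
  proof -
    obtain m where m: "a + 2 * b = 5 * m" 
    proof -
      have "5 dvd a + 2 * b" using mod5 by presburger
      then show thesis using that by (elim dvdE)
    qed
    \<comment> \<open>m and n solve a = m - 2n, b = 2m + n, the exponents of r(\<tau>) and r(2
      \<tau>) in k^m l^n.\<close>
    define n where "n = b - 2 * m"
    have ab: "a = m - 2 * n" "b = 2 * m + n" using m by (simp_all add: n_def)
    have "rr_k \<in> rational_functions_in F"
      unfolding eq[symmetric] rr_k_eq_mono by (rule rr_mono_modular) simp
    moreover have "F \<tau> = rr_k \<tau> powi m * rr_l \<tau> powi n" if "Im \<tau> > 0" for \<tau>
    proof -
      have nz: "rr_cf \<tau> \<noteq> 0" "rr_cf (2 * \<tau>) \<noteq> 0" using that rr_cf_nonzero[of \<tau>] rr_cf_nonzero[of "2 * \<tau>"] by simp_all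
      have "rr_cf \<tau> powi a = rr_cf \<tau> powi (1 * m) * rr_cf \<tau> powi (- 2 * n)"
        "rr_cf (2 * \<tau>) powi b = rr_cf (2 * \<tau>) powi (2 * m) * rr_cf (2 * \<tau>) powi (1 * n)"
        unfolding ab using nz by (simp_all flip: power_int_add)
      then show ?thesis
        unfolding F rr_k_eq_mono rr_l_eq_mono rr_mono_def
        by (simp only: power_int_mult power_int_mult_distrib) (simp only: mult_ac)
    qed
    ultimately have "(m = 0 \<or> \<bar>m\<bar> = 1) \<and> (n = 0 \<or> \<bar>n\<bar> = 1) \<and> (m = 0 \<or> n = 0)"
      by (intro generator_exponents)
    moreover have "m \<noteq> 0 \<or> n \<noteq> 0" using assms(1) ab by auto
    ultimately show ?thesis using ab by (auto simp: abs_if split: if_splits)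
  qed
  have ne: "\<not> eq_on_H rr_k rr_l" "\<not> eq_on_H rr_k (\<lambda>\<tau>. 1 / rr_l \<tau>)"
    unfolding inverse_rr_l_eq_mono unfolding rr_k_eq_mono rr_l_eq_mono using rr_mono_inj by force+
  have "modular_functions (Gamma1 10) = rational_functions_in F \<longleftrightarrow>
      (a, b) \<in> {(1, 2), (-1, -2), (-2, 1), (2, -1)}"
    using gen nongen by (rule iffI[rotated])
  then show ?thesis
    unfolding G_iff using modular ne by (intro conjI refl)
qed

end
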